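(* Let $F$ be the skew product over the three-legged horseshoe with fiber maps $f_0,f_1,f_2$ described in the context, satisfying (F0), (F1), (F2) and (F01), and let $\Lambda=\bigcap_{i\in\mathbb Z}F^i(\mathbf C)$. Then there is a (periodic) saddle $Q^*$ of $F$ of $u$-index two such that $\Lambda$ is the homoclinic class of $Q^*$ relative to $\mathbf C$, that is, $\Lambda=H(Q^*,F)$. In particular, $\Lambda$ is topologically transitive.
   Context: **Base.** $\Phi$ is a diffeomorphism of $\mathbb R^2$ having a horseshoe $\Gamma\subset\widehat{\mathbf C}=[0,1]^2$ and a homeomorphism $\varpi:\Gamma\to\Sigma_3=\{0,1,2\}^{\mathbb Z}$ with $\varpi\circ\Phi=\sigma\circ\varpi$, $\sigma$ the full shift. $\widehat{\mathbf C}_0,\widehat{\mathbf C}_1,\widehat{\mathbf C}_2$ are the three associated pairwise disjoint sub-rectangles of $\widehat{\mathbf C}$ ($\Gamma$ is the maximal invariant set of $\Phi$ in their union, and $X\in\Gamma$ lies in $\widehat{\mathbf C}_i$ iff the $0$-th symbol of $\varpi(X)$ is $i$). $\Phi$ is affine on each $\widehat{\mathbf C}_i$, contracting the first coordinate direction and expanding the second. **Skew product.** $\mathbf C=[0,1]^3$ and $F(\widehat x,x)=(\Phi(\widehat x),f_i(x))$ if $(\widehat x,x)\in\widehat{\mathbf C}_i\times[0,1]$, where $f_0,f_1,f_2:[0,1]\to[0,1]$ are $C^1$ injective maps. The expansion (contraction) of $\Phi$ is stronger than any expansion (contraction) of the $f_i$ (in particular $f_i'$ never vanishes), so that the $DF$-invariant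 splitting $E^{ss}\oplus E^c\oplus E^{uu}$ into the first, third and second coordinate directions is dominated. $\Lambda=\bigcap_{i\in\mathbb Z}F^i(\mathbf C)$, the set of points with complete $F$-orbit in $\mathbf C$. **Fiber maps.** (F0) $f_0$ is increasing with exactly two fixed points, both hyperbolic: $0$ (repelling) and $1$ (attracting); $\beta_0=f_0'(0)>1$, $\lambda_0=f_0'(1)\in(0,1)$, and $\lambda_0\le f_0'(x)$ for all $x\in[0,1]$. (F1) $f_1(x)=\gamma(1-x)$ is a contraction, $\lambda_0\le\gamma<1$. (F2) $f_2$ is increasing and has two hyperbolic fixed points, $0$ (repelling) and a point $p_2\in(0,1)$ (attracting); $\beta_2=f_2'(0)>1$. (F01) $f_0'$ is decreasing on $[0,1]$ and $\gamma\,\frac{\lambda_0^3(1-\lambda_0)}{1-\beta_0^{-1}}>1$. **Homoclinic class.** For a hyperbolic periodic saddle $Q$ of $F$, the $u$-index is the dimension of its unstable manifold. The homoclinic class of $Q$ relative to $\mathbf C$, denoted $H(Q,F)$, is the closure of the set of transverse intersection points of the stable and unstable manifolds of the orbit of $Q$ whose $F$-orbit is entirely contained in $\mathbf C$. Topologically transitive means existence of a dense orbit. *)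

theory Defs
  imports "HOL-Analysis.Analysis"
begin

section \<open>Partially defined maps\<close>

text \<open>
  A partially defined map is given by a total function \<open>F\<close> together with a domain \<open>D\<close>; values of
  \<open>F\<close> outside \<open>D\<close> are never used by the notions below.
\<close>

text \<open>\<open>power_image D F i S\<close> is \<open>F^i(S)\<close> for an integer \<open>i\<close> (iterated images for \<open>i \<ge> 0\<close>, iterated
  preimages for \<open>i < 0\<close>).\<close>

definition power_image :: "'a set \<Rightarrow> ('a \<Rightarrow> 'a) \<Rightarrow> int \<Rightarrow> 'a set \<Rightarrow> 'a set" where
  "power_image D F i S =
     (if 0 \<le> i then ((\<lambda>T. F ` (T \<inter> D)) ^^ nat i) S
      else ((\<lambda>T. {X \<in> D. F X \<in> T}) ^^ nat (- i)) S)"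

definition max_invariant :: "'a set \<Rightarrow> ('a \<Rightarrow> 'a) \<Rightarrow> 'a set \<Rightarrow> 'a set" where
  "max_invariant D F C = (\<Inter>i::int. power_image D F i C)"

definition complete_orbit :: "'a set \<Rightarrow> ('a \<Rightarrow> 'a) \<Rightarrow> (int \<Rightarrow> 'a) \<Rightarrow> bool" where
  "complete_orbit D F x \<longleftrightarrow> (\<forall>k. x k \<in> D \<and> F (x k) = x (k + 1))"

definition transitive_on ::
  "'a::topological_space set \<Rightarrow> ('a \<Rightarrow> 'a) \<Rightarrow> 'a set \<Rightarrow> bool" where
  "transitive_on D F L \<longleftrightarrow>
     (\<exists>x. complete_orbit D F x \<and> range x \<subseteq> L \<and> L \<subseteq> closure (range x))"

definition backward_orbit :: "'a set \<Rightarrow> ('a \<Rightarrow> 'a) \<Rightarrow> (nat \<Rightarrow> 'a) \<Rightarrow> bool" where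
  "backward_orbit D F x \<longleftrightarrow> (\<forall>n. x (Suc n) \<in> D \<and> F (x (Suc n)) = x n)"

definition forward_orbit :: "('a \<Rightarrow> 'a) \<Rightarrow> 'a \<Rightarrow> 'a set" where
  "forward_orbit F X = range (\<lambda>n. (F ^^ n) X)"


section \<open>Invariant manifolds, saddles and homoclinic classes\<close>

definition stable_manifold ::
  "'a::metric_space set \<Rightarrow> ('a \<Rightarrow> 'a) \<Rightarrow> 'a \<Rightarrow> 'a set" where
  "stable_manifold D F Y =
     {X. (\<forall>n. (F ^^ n) X \<in> D) \<and> (\<lambda>n. dist ((F ^^ n) X) ((F ^^ n) Y)) \<longlonglongrightarrow> 0}"

definition unstable_manifold ::
  "'a::metric_space set \<Rightarrow> ('a \<Rightarrow> 'a) \<Rightarrow> 'a \<Rightarrow> 'a set" where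
  "unstable_manifold D F Y =
     {X. \<exists>x y. backward_orbit D F x \<and> x 0 = X \<and> backward_orbit D F y \<and> y 0 = Y \<and>
           (\<lambda>n. dist (x n) (y n)) \<longlonglongrightarrow> 0}"

text \<open>
  Tangent space at \<open>X\<close> of an immersed manifold with image \<open>W\<close>, by velocities of \<open>C\<^sup>1\<close> curves that start
  at \<open>X\<close> and run in \<open>W\<close>. Continuous curves do not jump between the (countably many) leaves by which
  \<open>W\<close> may accumulate on itself. Since the phase space has boundary, curves are only required to
  stay in \<open>W\<close> on the one-sided interval \<open>[0, 1]\<close>, and the linear span is taken.
\<close>

definition tangent_space :: "'a::real_normed_vector set \<Rightarrow> 'a \<Rightarrow> 'a set" where
  "tangent_space W X =
     span {v. \<exists>c. c C1_differentiable_on {0..1} \<and> c 0 = X \<and> c ` {0..1} \<subseteq> W \<and>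
                  (c has_vector_derivative v) (at (0::real))}"

definition linear_saddle :: "('a::real_normed_vector \<Rightarrow> 'a) \<Rightarrow> bool" where
  "linear_saddle A \<longleftrightarrow>
     (\<exists>Es Eu K \<theta>. subspace Es \<and> subspace Eu \<and> Es \<noteq> {0} \<and> Eu \<noteq> {0} \<and>
        Es \<inter> Eu = {0} \<and> {v + w |v w. v \<in> Es \<and> w \<in> Eu} = UNIV \<and>
        A ` Es \<subseteq> Es \<and> A ` Eu = Eu \<and> 0 < K \<and> 0 < \<theta> \<and> \<theta> < 1 \<and>
        (\<forall>v\<in>Es. \<forall>n. norm ((A ^^ n) v) \<le> K * \<theta> ^ n * norm v) \<and>
        (\<forall>v\<in>Eu. \<forall>n. norm v \<le> K * \<theta> ^ n * norm ((A ^^ n) v)))"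

definition periodic_saddle ::
  "'a::real_normed_vector set \<Rightarrow> ('a \<Rightarrow> 'a) \<Rightarrow> 'a \<Rightarrow> bool" where
  "periodic_saddle D F Q \<longleftrightarrow>
     (\<forall>k. (F ^^ k) Q \<in> D) \<and>
     (\<exists>n>0. (F ^^ n) Q = Q \<and>
        (\<exists>A. ((F ^^ n) has_derivative A) (at Q within {X. \<forall>k<n. (F ^^ k) X \<in> D}) \<and>
             linear_saddle A))"

definition u_index :: "'a::euclidean_space set \<Rightarrow> ('a \<Rightarrow> 'a) \<Rightarrow> 'a \<Rightarrow> nat" where
  "u_index D F Q = dim (tangent_space (unstable_manifold D F Q) Q)"

definition transverse_at :: "'a::real_normed_vector set \<Rightarrow> 'a set \<Rightarrow> 'a \<Rightarrow> bool" where
  "transverse_at V W X \<longleftrightarrow>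
     X \<in> V \<inter> W \<and> {v + w |v w. v \<in> tangent_space V X \<and> w \<in> tangent_space W X} = UNIV"

definition homoclinic_class ::
  "'a::real_normed_vector set \<Rightarrow> ('a \<Rightarrow> 'a) \<Rightarrow> 'a set \<Rightarrow> 'a \<Rightarrow> 'a set" where
  "homoclinic_class D F C Q =
     closure {X \<in> max_invariant D F C.
        transverse_at (\<Union>Y\<in>forward_orbit F Q. stable_manifold D F Y)
                      (\<Union>Y\<in>forward_orbit F Q. unstable_manifold D F Y) X}"


section \<open>The three-legged horseshoe and the skew product\<close>

definition C1_map :: "('a::real_normed_vector \<Rightarrow> 'a) \<Rightarrow> bool" where
  "C1_map g \<longleftrightarrow>
     (\<exists>g' :: 'a \<Rightarrow> ('a \<Rightarrow>\<^sub>L 'a).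
        (\<forall>x. (g has_derivative blinfun_apply (g' x)) (at x)) \<and> continuous_on UNIV g')"

definition diffeomorphism :: "('a::real_normed_vector \<Rightarrow> 'a) \<Rightarrow> bool" where
  "diffeomorphism g \<longleftrightarrow> bij g \<and> C1_map g \<and> C1_map (inv g)"

text \<open>\<open>int \<Rightarrow> nat\<close> carries the product topology and \<open>nat\<close> is discrete, so the subspace topology on
  \<open>full_shift\<close> is the usual one.\<close>

definition full_shift :: "(int \<Rightarrow> nat) set" where
  "full_shift = {\<xi>. \<forall>k. \<xi> k \<in> {0, 1, 2}}"

definition shift :: "(int \<Rightarrow> nat) \<Rightarrow> (int \<Rightarrow> nat)" where
  "shift \<xi> = (\<lambda>k. \<xi> (k + 1))"

definition unit_cube :: "((real \<times> real) \<times> real) set" where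
  "unit_cube = ({0..1} \<times> {0..1}) \<times> {0..1}"

definition skew_domain :: "(nat \<Rightarrow> (real \<times> real) set) \<Rightarrow> ((real \<times> real) \<times> real) set" where
  "skew_domain R = (\<Union>i<3. R i) \<times> {0..1}"

definition skew_product ::
  "(real \<times> real \<Rightarrow> real \<times> real) \<Rightarrow> (nat \<Rightarrow> (real \<times> real) set) \<Rightarrow> (nat \<Rightarrow> real \<Rightarrow> real) \<Rightarrow>
   (real \<times> real) \<times> real \<Rightarrow> (real \<times> real) \<times> real" where
  "skew_product \<Phi> R f = (\<lambda>(y, x). (\<Phi> y, f (THE i. i < 3 \<and> y \<in> R i) x))"

text \<open>
  \<open>R i\<close> are the rectangles of the horseshoe, \<open>cs i\<close> and \<open>cu i\<close> the (possibly negative) multipliers of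
  \<open>\<Phi>\<close> on \<open>R i\<close> in the first (contracting) and second (expanding) coordinate, and \<open>f' i\<close> is the
  derivative of \<open>f i\<close>, one-sided at \<open>0\<close> and \<open>1\<close>.
\<close>

locale three_legged_skew_product =
  fixes \<Phi> :: "real \<times> real \<Rightarrow> real \<times> real"
    and R :: "nat \<Rightarrow> (real \<times> real) set"
    and \<Gamma> :: "(real \<times> real) set"
    and code :: "real \<times> real \<Rightarrow> int \<Rightarrow> nat"
    and cs cu :: "nat \<Rightarrow> real"
    and f f' :: "nat \<Rightarrow> real \<Rightarrow> real"
  assumes diffeo: "diffeomorphism \<Phi>"
    and rectangles: "\<And>i. i < 3 \<Longrightarrow>
          \<exists>a b c d. 0 \<le> a \<and> a < b \<and> b \<le> 1 \<and> 0 \<le> c \<and> c < d \<and> d \<le> 1 \<and> R i = {a..b} \<times> {c..d}"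
    and disjoint: "\<And>i j. i < 3 \<Longrightarrow> j < 3 \<Longrightarrow> i \<noteq> j \<Longrightarrow> R i \<inter> R j = {}"
    and horseshoe: "\<Gamma> = {y. \<forall>n. (\<Phi> ^^ n) y \<in> (\<Union>i<3. R i) \<and> (inv \<Phi> ^^ n) y \<in> (\<Union>i<3. R i)}"
    and coding: "\<exists>code'. homeomorphism \<Gamma> full_shift code code'"
    and conjugacy: "\<And>y. y \<in> \<Gamma> \<Longrightarrow> code (\<Phi> y) = shift (code y)"
    and symbol: "\<And>y i. y \<in> \<Gamma> \<Longrightarrow> i < 3 \<Longrightarrow> y \<in> R i \<longleftrightarrow> code y 0 = i"
    and affine: "\<And>i. i < 3 \<Longrightarrow> \<exists>p q. \<forall>(s, u)\<in>R i. \<Phi> (s, u) = (cs i * s + p, cu i * u + q)"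
    and hyperbolic: "\<And>i. i < 3 \<Longrightarrow> \<bar>cs i\<bar> < 1 \<and> 1 < \<bar>cu i\<bar>"
    and fiber_maps: "\<And>i. i < 3 \<Longrightarrow> f i ` {0..1} \<subseteq> {0..1} \<and> inj_on (f i) {0..1}"
    and fiber_derivative: "\<And>i x. i < 3 \<Longrightarrow> x \<in> {0..1} \<Longrightarrow>
          (f i has_real_derivative f' i x) (at x within {0..1})"
    and fiber_C1: "\<And>i. i < 3 \<Longrightarrow> continuous_on {0..1} (f' i)"
    and domination: "\<And>i j x. i < 3 \<Longrightarrow> j < 3 \<Longrightarrow> x \<in> {0..1} \<Longrightarrow>
          \<bar>cs i\<bar> < \<bar>f' j x\<bar> \<and> \<bar>f' j x\<bar> < \<bar>cu i\<bar>"


section \<open>Conditions on the fiber maps\<close>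

text \<open>In the conditions below, \<open>g'\<close> is the derivative of \<open>g\<close>; \<open>lam\<close> and \<open>beta\<close> stand for \<open>f\<^sub>0'(1)\<close> and \<open>f\<^sub>0'(0)\<close>.\<close>

definition F0 :: "(real \<Rightarrow> real) \<Rightarrow> (real \<Rightarrow> real) \<Rightarrow> bool" where
  "F0 g g' \<longleftrightarrow>
     strict_mono_on {0..1} g \<and> {x \<in> {0..1}. g x = x} = {0, 1} \<and>
     g' 0 > 1 \<and> 0 < g' 1 \<and> g' 1 < 1 \<and> (\<forall>x\<in>{0..1}. g' 1 \<le> g' x)"

definition F1 :: "(real \<Rightarrow> real) \<Rightarrow> real \<Rightarrow> real \<Rightarrow> bool" where
  "F1 g \<gamma> lam \<longleftrightarrow> (\<forall>x\<in>{0..1}. g x = \<gamma> * (1 - x)) \<and> lam \<le> \<gamma> \<and> \<gamma> < 1"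

definition F2 :: "(real \<Rightarrow> real) \<Rightarrow> (real \<Rightarrow> real) \<Rightarrow> bool" where
  "F2 g g' \<longleftrightarrow>
     strict_mono_on {0..1} g \<and> g 0 = 0 \<and> g' 0 > 1 \<and>
     (\<exists>p. 0 < p \<and> p < 1 \<and> g p = p \<and> 0 < g' p \<and> g' p < 1)"

definition F01 :: "(real \<Rightarrow> real) \<Rightarrow> real \<Rightarrow> real \<Rightarrow> real \<Rightarrow> bool" where
  "F01 g' \<gamma> lam beta \<longleftrightarrow>
     antimono_on {0..1} g' \<and> \<gamma> * (lam ^ 3 * (1 - lam) / (1 - inverse beta)) > 1"

end

theory Submission
  imports Defs
begin

text \<open>
  The conjugacy with the full shift and hyperbolicity make \<open>\<Gamma>\<close> a product set, so \<open>\<Phi>\<close> has the Markov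
  property on the hull \<open>Is \<times> Iu\<close> of \<open>\<Gamma>\<close>: a finite word \<open>v\<close> acts as a contraction \<open>fold B v\<close> of \<open>Is\<close>,
  its inverse branch \<open>foldr A v\<close> is a contraction of \<open>Iu\<close>, and \<open>fold f v\<close> acts on the fibre.

  Put \<open>g = f 0\<close> and let \<open>J\<close> be a fibre interval close to \<open>1\<close>. The map \<open>f 1\<close> sends \<open>J\<close> close to \<open>0\<close>, and an
  iterate of \<open>g\<close> brings it back close to \<open>1\<close>. Concavity of the iterates of \<open>g\<close> bounds the slope of this
  return from below by almost \<open>lam\<^sup>2 * (1 - lam) / (beta - 1)\<close>, which exceeds \<open>1\<close> by (F01), as long as the
  return does not cover a fundamental domain of \<open>g\<close>. Hence iterating the return does cover one, and then
  every point of \<open>(0,1)\<close> lies in the image of \<open>J\<close> under some word. The same estimate gives a repelling fixed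
  point \<open>q\<close> of a word \<open>1 0 \<dots> 0\<close>, hence a saddle \<open>Q\<close> whose local unstable set contains \<open>Iu\<close> times a
  neighbourhood of \<open>q\<close>. For a given cylinder and fibre interval, one word leads from this neighbourhood into
  the interval and another one from there exactly to \<open>q\<close>; this yields a homoclinic point in the cylinder.
  Chaining countably many such words yields a dense orbit.
\<close>

section \<open>Product structure of the horseshoe\<close>

text \<open>The hypotheses do not state that the image of a rectangle crosses the other rectangles;
  they only provide the coding. The Markov property is therefore extracted from the codes: a common
  past fixes the first coordinate and a common future the second, so pasts and futures recombine
  freely.

  The return factor has three sources. Near \<open>1\<close> the displacement
  \<open>f 0 y - y\<close> is about \<open>(1 - lam) * (1 - y)\<close>. A return that fails to cover
  a fundamental domain ends below the second image of the threshold \<open>a\<close>, which costs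
  \<open>lam\<^sup>2\<close>. Near \<open>0\<close> the displacement is at most
  \<open>beta - 1\<close> times the height. The slope of \<open>f 1\<close> scales the length of an
  interval and its height above \<open>0\<close> alike, so it cancels.

  The stable segment found for \<open>Q\<close> has constant fibre coordinate \<open>q\<close>. A
  homoclinic point must therefore arrive exactly at \<open>q\<close>, which is why the covering
  argument ends in a statement about points and not only about open sets.\<close>

lemma funpow_into_shift:
  fixes g h :: "'a \<Rightarrow> 'a"
  assumes "\<And>n. (g ^^ n) y \<in> Z \<and> (h ^^ n) y \<in> Z" and gh: "\<And>z. g (h z) = z"
  shows "(g ^^ n) (h y) \<in> Z \<and> (h ^^ n) (h y) \<in> Z"
proof
  show "(g ^^ n) (h y) \<in> Z"
    using assms(1)[of 1] assms(1)[of "n - 1"] by (cases n) (simp_all add: funpow_swap1 gh)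
  show "(h ^^ n) (h y) \<in> Z"
    using assms(1)[of "Suc n"] by (simp add: funpow_swap1)
qed

lemma eq_of_geometric:
  fixes s t r :: real
  assumes "0 \<le> r" "r < 1" "\<And>n. \<bar>s - t\<bar> \<le> r ^ n"
  shows "s = t"
proof -
  have "(\<lambda>n. r ^ n) \<longlonglongrightarrow> 0" using assms by (simp add: LIMSEQ_realpow_zero)
  then have "\<bar>s - t\<bar> \<le> 0" by (rule LIMSEQ_le_const) (use assms in auto)
  then show ?thesis by simp
qed

lemma hull_subset_interval:
  fixes T :: "real set"
  assumes "T \<noteq> {}" "T \<subseteq> {a..b}"
  shows "{Inf T..Sup T} \<subseteq> {a..b}"
proof -
  have "a \<le> Inf T" by (rule cInf_greatest) (use assms in auto)
  moreover have "Sup T \<le> b" by (rule cSup_least) (use assms in auto)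
  ultimately show ?thesis by auto
qed

text \<open>The affine preimage of an interval is an interval, so containment passes from a set to
  its hull. The sign of \<open>k\<close> is split because multipliers may be negative.\<close>

lemma affine_hull_subset:
  fixes T :: "real set"
  assumes T: "T \<noteq> {}" "bdd_below T" "bdd_above T" and m: "\<And>t. t \<in> T \<Longrightarrow> k * t + d \<in> {a..b}"
    and x: "x \<in> {Inf T..Sup T}"
  shows "k * x + d \<in> {a..b}"
proof (cases "k = 0")
  case True
  then show ?thesis using T m by auto
next
  case False
  show ?thesis
  proof (cases "k > 0")
    case True
    have "t \<in> {(a - d) / k..(b - d) / k}" if "t \<in> T" for t
      using m[OF that] True by (simp add: pos_divide_le_eq pos_le_divide_eq algebra_simps)
    then have "T \<subseteq> {(a - d) / k..(b - d) / k}" by blast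
    then have "x \<in> {(a - d) / k..(b - d) / k}" using hull_subset_interval[OF T(1)] x by blast
    then show ?thesis using True by (simp add: pos_divide_le_eq pos_le_divide_eq algebra_simps)
  next
    case F: False
    then have "k < 0" using False by simp
    have "t \<in> {(b - d) / k..(a - d) / k}" if "t \<in> T" for t
      using m[OF that] \<open>k < 0\<close> by (simp add: neg_divide_le_eq neg_le_divide_eq algebra_simps)
    then have "T \<subseteq> {(b - d) / k..(a - d) / k}" by blast
    then have "x \<in> {(b - d) / k..(a - d) / k}" using hull_subset_interval[OF T(1)] x by blast
    then show ?thesis using \<open>k < 0\<close> by (simp add: neg_divide_le_eq neg_le_divide_eq algebra_simps)
  qed
qed

context three_legged_skew_product
begin

lemma Phi_bij: "bij \<Phi>" and inv_Phi_cont: "continuous_on UNIV (inv \<Phi>)"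
proof -
  show "bij \<Phi>" using diffeo by (simp add: diffeomorphism_def)
  have "C1_map (inv \<Phi>)" using diffeo by (simp add: diffeomorphism_def)
  then show "continuous_on UNIV (inv \<Phi>)"
    unfolding C1_map_def by (blast intro: continuous_at_imp_continuous_on has_derivative_continuous)
qed

lemma Phi_inv [simp]: "\<Phi> (inv \<Phi> y) = y" "inv \<Phi> (\<Phi> y) = y"
  using Phi_bij by (simp_all add: bij_is_inj bij_is_surj surj_f_inv_f)

lemma Gamma_Phi: "y \<in> \<Gamma> \<Longrightarrow> \<Phi> y \<in> \<Gamma>"
  using funpow_into_shift[of "inv \<Phi>" y "\<Union>i<3. R i" \<Phi>] unfolding horseshoe by simp

lemma Gamma_inv: "y \<in> \<Gamma> \<Longrightarrow> inv \<Phi> y \<in> \<Gamma>"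
  using funpow_into_shift[of \<Phi> y "\<Union>i<3. R i" "inv \<Phi>"] unfolding horseshoe by simp

lemma Gamma_code_bij: "bij_betw code \<Gamma> full_shift"
proof -
  obtain code' where "homeomorphism \<Gamma> full_shift code code'" using coding by blast
  then show ?thesis
    by (intro bij_betw_byWitness[of _ code']) (auto simp: homeomorphism_def)
qed

lemma Gamma_in_R: "y \<in> \<Gamma> \<Longrightarrow> code y 0 < 3 \<and> y \<in> R (code y 0)"
proof -
  assume y: "y \<in> \<Gamma>"
  then have "(\<Phi> ^^ 0) y \<in> (\<Union>i<3. R i)" unfolding horseshoe by blast
  then obtain i where "i < 3" "y \<in> R i" by auto
  then show ?thesis using symbol[OF y] by simp
qed

lemma code_Phi: "y \<in> \<Gamma> \<Longrightarrow> code (\<Phi> y) k = code y (k + 1)"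
  using conjugacy by (simp add: shift_def)

lemma code_inv: "y \<in> \<Gamma> \<Longrightarrow> code (inv \<Phi> y) k = code y (k - 1)"
  using code_Phi[OF Gamma_inv, of y "k - 1"] by simp

section \<open>Affine branches of \<Phi> and their common contraction rate\<close>

definition offset :: "nat \<Rightarrow> real \<times> real" where
  "offset i = (SOME pq. \<forall>(s, u)\<in>R i. \<Phi> (s, u) = (cs i * s + fst pq, cu i * u + snd pq))"

definition B :: "nat \<Rightarrow> real \<Rightarrow> real" where
  "B i s = cs i * s + fst (offset i)"

text \<open>The inverse branch in the expanding coordinate: with \<open>A\<close> in place of the
  expansion, both coordinates are governed by contractions.\<close>

definition A :: "nat \<Rightarrow> real \<Rightarrow> real" where
  "A i u = (u - snd (offset i)) / cu i"

lemma Phi_R: "i < 3 \<Longrightarrow> y \<in> R i \<Longrightarrow> \<Phi> y = (B i (fst y), cu i * snd y + snd (offset i))"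
proof -
  assume i: "i < 3" and y: "y \<in> R i"
  obtain p q where pq: "\<forall>(s, u)\<in>R i. \<Phi> (s, u) = (cs i * s + p, cu i * u + q)"
    using affine[OF i] by blast
  have "\<forall>(s, u)\<in>R i. \<Phi> (s, u) = (cs i * s + fst (offset i), cu i * u + snd (offset i))"
    unfolding offset_def by (rule someI[of _ "(p, q)"]) (use pq in simp)
  then show ?thesis using y by (cases y) (auto simp: B_def)
qed

lemma cu_nz: "i < 3 \<Longrightarrow> cu i \<noteq> 0" using hyperbolic[of i] by auto

lemma snd_Phi_R: "i < 3 \<Longrightarrow> y \<in> R i \<Longrightarrow> snd y = A i (snd (\<Phi> y))"
  using Phi_R[of i y] cu_nz[of i] by (simp add: A_def)

lemma fst_Phi_R: "i < 3 \<Longrightarrow> y \<in> R i \<Longrightarrow> fst (\<Phi> y) = B i (fst y)"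
  using Phi_R[of i y] by simp

definition rate :: real where
  "rate = Max ((\<lambda>i. max \<bar>cs i\<bar> (1 / \<bar>cu i\<bar>)) ` {..<3})"

lemma rate_bounds: "i < 3 \<Longrightarrow> \<bar>cs i\<bar> \<le> rate" "i < 3 \<Longrightarrow> 1 / \<bar>cu i\<bar> \<le> rate" "0 \<le> rate" "rate < 1"
proof -
  have *: "max \<bar>cs i\<bar> (1 / \<bar>cu i\<bar>) \<le> rate" if "i < 3" for i
    unfolding rate_def by (rule Max_ge) (use that in auto)
  show "i < 3 \<Longrightarrow> \<bar>cs i\<bar> \<le> rate" "i < 3 \<Longrightarrow> 1 / \<bar>cu i\<bar> \<le> rate" using *[of i] by simp_all
  show "0 \<le> rate" using *[of 0] abs_ge_zero[of "cs 0"] by linarith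
  have "rate \<in> (\<lambda>i. max \<bar>cs i\<bar> (1 / \<bar>cu i\<bar>)) ` {..<3}"
    unfolding rate_def by (rule Max_in) (auto simp: lessThan_empty_iff)
  then obtain i where "i < 3" "rate = max \<bar>cs i\<bar> (1 / \<bar>cu i\<bar>)" by auto
  then show "rate < 1" using hyperbolic[of i] by auto
qed

lemma B_contraction: "i < 3 \<Longrightarrow> \<bar>B i s - B i t\<bar> \<le> rate * \<bar>s - t\<bar>"
proof -
  assume i: "i < 3"
  have "\<bar>B i s - B i t\<bar> = \<bar>cs i\<bar> * \<bar>s - t\<bar>" by (simp add: B_def abs_mult [symmetric] algebra_simps)
  then show ?thesis using rate_bounds(1)[OF i] by (simp add: mult_right_mono)
qed

lemma A_contraction: "i < 3 \<Longrightarrow> \<bar>A i s - A i t\<bar> \<le> rate * \<bar>s - t\<bar>"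
proof -
  assume i: "i < 3"
  have "\<bar>A i s - A i t\<bar> = \<bar>(s - t) / cu i\<bar>"
    by (simp add: A_def diff_divide_distrib [symmetric])
  also have "\<dots> = 1 / \<bar>cu i\<bar> * \<bar>s - t\<bar>" by (simp add: abs_divide)
  also have "\<dots> \<le> rate * \<bar>s - t\<bar>" by (rule mult_right_mono[OF rate_bounds(2)[OF i]]) simp
  finally show ?thesis .
qed

lemma R_unit: "i < 3 \<Longrightarrow> y \<in> R i \<Longrightarrow> fst y \<in> {0..1} \<and> snd y \<in> {0..1}"
  using rectangles[of i] by force

lemma Gamma_unit: "y \<in> \<Gamma> \<Longrightarrow> fst y \<in> {0..1} \<and> snd y \<in> {0..1}"
  using Gamma_in_R R_unit by blast

section \<open>Coordinates determined by past and future symbols\<close>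

text \<open>A common past keeps all preimages in common rectangles, so the two points are images
  under the same \<open>n\<close> branches \<open>B\<close>, and their first coordinates differ by
  at most \<open>rate ^ n\<close>.\<close>

lemma same_past_fst:
  assumes "y \<in> \<Gamma>" "z \<in> \<Gamma>" "\<And>k. k < 0 \<Longrightarrow> code y k = code z k"
  shows "fst y = fst z"
proof (rule eq_of_geometric[OF rate_bounds(3,4)])
  show "\<bar>fst y - fst z\<bar> \<le> rate ^ n" for n
    using assms
  proof (induction n arbitrary: y z)
    case 0
    then show ?case using Gamma_unit[of y] Gamma_unit[of z] by auto
  next
    case (Suc n)
    let ?y = "inv \<Phi> y" and ?z = "inv \<Phi> z"
    have G: "?y \<in> \<Gamma>" "?z \<in> \<Gamma>" using Suc.prems Gamma_inv by auto
    have c: "code ?y k = code ?z k" if "k \<le> 0" for k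
      using Suc.prems code_inv that by simp
    let ?i = "code ?y 0"
    have i: "?i < 3" "?y \<in> R ?i" "?z \<in> R ?i" using Gamma_in_R[OF G(1)] Gamma_in_R[OF G(2)] c[of 0] by auto
    have "\<bar>fst y - fst z\<bar> = \<bar>B ?i (fst ?y) - B ?i (fst ?z)\<bar>"
      using fst_Phi_R[OF i(1,2)] fst_Phi_R[OF i(1,3)] by simp
    also have "\<dots> \<le> rate * \<bar>fst ?y - fst ?z\<bar>" by (rule B_contraction[OF i(1)])
    also have "\<dots> \<le> rate * rate ^ n"
      by (rule mult_left_mono[OF Suc.IH[OF G]]) (use c rate_bounds in auto)
    finally show ?case by simp
  qed
qed

lemma same_future_snd:
  assumes "y \<in> \<Gamma>" "z \<in> \<Gamma>" "\<And>k. 0 \<le> k \<Longrightarrow> code y k = code z k"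
  shows "snd y = snd z"
proof (rule eq_of_geometric[OF rate_bounds(3,4)])
  show "\<bar>snd y - snd z\<bar> \<le> rate ^ n" for n
    using assms
  proof (induction n arbitrary: y z)
    case 0
    then show ?case using Gamma_unit[of y] Gamma_unit[of z] by auto
  next
    case (Suc n)
    let ?y = "\<Phi> y" and ?z = "\<Phi> z"
    have G: "?y \<in> \<Gamma>" "?z \<in> \<Gamma>" using Suc.prems Gamma_Phi by auto
    have c: "code ?y k = code ?z k" if "0 \<le> k" for k
      using Suc.prems code_Phi that by simp
    let ?i = "code y 0"
    have i: "?i < 3" "y \<in> R ?i" "z \<in> R ?i" 
      using Gamma_in_R[OF Suc.prems(1)] Gamma_in_R[OF Suc.prems(2)] Suc.prems(3)[of 0] by auto
    have "\<bar>snd y - snd z\<bar> = \<bar>A ?i (snd ?y) - A ?i (snd ?z)\<bar>"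
      using snd_Phi_R[OF i(1,2)] snd_Phi_R[OF i(1,3)] by simp
    also have "\<dots> \<le> rate * \<bar>snd ?y - snd ?z\<bar>" by (rule A_contraction[OF i(1)])
    also have "\<dots> \<le> rate * rate ^ n"
      by (rule mult_left_mono[OF Suc.IH[OF G]]) (use c rate_bounds in auto)
    finally show ?case by simp
  qed
qed

lemma code_surj:
  assumes "\<And>k. \<xi> k < 3"
  obtains y where "y \<in> \<Gamma>" "code y = \<xi>"
proof -
  have "\<xi> k \<in> {0, 1, 2}" for k using assms[of k] by auto
  then have "\<xi> \<in> full_shift" by (simp add: full_shift_def)
  then show ?thesis using Gamma_code_bij that by (metis bij_betw_def imageE)
qed

lemma code_lt: "y \<in> \<Gamma> \<Longrightarrow> code y k < 3"
proof -
  assume "y \<in> \<Gamma>"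
  then have "code y \<in> full_shift" using Gamma_code_bij by (auto simp: bij_betw_def)
  then have "code y k \<in> {0, 1, 2}" unfolding full_shift_def by blast
  then show ?thesis by auto
qed

text \<open>Replacing the symbols from position 0 on (resp. before it) keeps the first (resp. second)
  coordinate; so the horseshoe is a product set.\<close>

lemma glue:
  assumes y: "y \<in> \<Gamma>" and z: "z \<in> \<Gamma>"
  shows "(fst y, snd z) \<in> \<Gamma>" "\<And>k. code (fst y, snd z) k = (if k < 0 then code y k else code z k)"
proof -
  let ?\<xi> = "\<lambda>k. if k < 0 then code y k else code z k"
  obtain x where x: "x \<in> \<Gamma>" "code x = ?\<xi>"
    by (rule code_surj[of ?\<xi>]) (use y z code_lt in auto)
  have "fst x = fst y" by (rule same_past_fst) (use x y in auto)
  moreover have "snd x = snd z" by (rule same_future_snd) (use x z in auto)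
  ultimately have e: "(fst y, snd z) = x" by (cases x) simp
  show "(fst y, snd z) \<in> \<Gamma>" "\<And>k. code (fst y, snd z) k = (if k < 0 then code y k else code z k)"
    unfolding e using x by auto
qed

lemma prepend_fst:
  assumes y: "y \<in> \<Gamma>" and i: "i < 3"
  shows "\<exists>z\<in>\<Gamma>. z \<in> R i \<and> fst z = fst y"
proof -
  obtain c where c: "c \<in> \<Gamma>" "code c = (\<lambda>k. i)" by (rule code_surj[of "\<lambda>k. i"]) (use i in auto)
  let ?z = "(fst y, snd c)"
  have "?z \<in> \<Gamma>" "?z \<in> R i"
    using glue[OF y c(1)] symbol[of ?z i] i c by auto
  then show ?thesis by force
qed

text \<open>The Markov property. The point \<open>\<Phi> z\<close> has symbol \<open>i\<close> at
  position -1; gluing its past to the future of \<open>y\<close> and applying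
  \<open>inv \<Phi>\<close> gives a point of \<open>R i\<close> that \<Phi> maps to the height of
  \<open>y\<close>.\<close>

lemma prepend_snd:
  assumes y: "y \<in> \<Gamma>" and i: "i < 3"
  shows "\<exists>z\<in>\<Gamma>. z \<in> R i \<and> snd z = A i (snd y)"
proof -
  obtain z where z: "z \<in> \<Gamma>" "z \<in> R i" using prepend_fst[OF y i] by blast
  let ?y = "(fst (\<Phi> z), snd y)"
  let ?x = "inv \<Phi> ?y"
  have y': "?y \<in> \<Gamma>" "code ?y (-1) = i"
    using glue[OF Gamma_Phi[OF z(1)] y] code_Phi[OF z(1)] symbol[OF z(1) i] z by auto
  have x: "?x \<in> \<Gamma>" using Gamma_inv y' by blast
  have "code ?x 0 = i" using code_inv[OF y'(1), of 0] y' by simp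
  then have xR: "?x \<in> R i" using symbol x i by blast
  have "snd ?x = A i (snd y)" using snd_Phi_R[OF i xR] by simp
  with x xR show ?thesis by blast
qed

section \<open>Hulls of the projections and the Markov property on them\<close>

text \<open>Hulls instead of the projections themselves, since tangent vectors require segments. The
  box \<open>Is \<times> Iu\<close> may stick out of the rectangles; \<open>A_R\<close> exhibits the
  part of it that lies in \<open>R i\<close>.\<close>

definition Is :: "real set" where "Is = {Inf (fst ` \<Gamma>)..Sup (fst ` \<Gamma>)}"
definition Iu :: "real set" where "Iu = {Inf (snd ` \<Gamma>)..Sup (snd ` \<Gamma>)}"

lemma Gamma_ne: "\<Gamma> \<noteq> {}" using code_surj[of "\<lambda>k. 0"] by auto

lemma Gamma_bdd: "bdd_below (fst ` \<Gamma>)" "bdd_above (fst ` \<Gamma>)" "bdd_below (snd ` \<Gamma>)" "bdd_above (snd ` \<Gamma>)"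
  using Gamma_unit by (auto intro!: bdd_belowI[of _ 0] bdd_aboveI[of _ 1])
   
lemma Gamma_Is: "y \<in> \<Gamma> \<Longrightarrow> fst y \<in> Is" and Gamma_Iu: "y \<in> \<Gamma> \<Longrightarrow> snd y \<in> Iu"
  using Gamma_bdd by (auto simp: Is_def Iu_def intro!: cInf_lower cSup_upper)

lemma B_Is: "i < 3 \<Longrightarrow> s \<in> Is \<Longrightarrow> B i s \<in> Is"
proof -
  assume i: "i < 3" and s: "s \<in> Is"
  have "cs i * t + fst (offset i) \<in> Is" if "t \<in> fst ` \<Gamma>" for t
  proof -
    obtain y where y: "y \<in> \<Gamma>" "t = fst y" using \<open>t \<in> fst ` \<Gamma>\<close> by blast
    obtain z where z: "z \<in> \<Gamma>" "z \<in> R i" "fst z = t" using prepend_fst[OF y(1) i] y(2) by blast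
    show ?thesis using Gamma_Is[OF Gamma_Phi[OF z(1)]] fst_Phi_R[OF i z(2)] z(3) by (simp add: B_def)
  qed
  note m = this[unfolded Is_def]
  show ?thesis
    unfolding B_def Is_def
    by (rule affine_hull_subset[of "fst ` \<Gamma>", OF _ Gamma_bdd(1,2) m s[unfolded Is_def]])
      (use Gamma_ne in simp)
qed

lemma A_Iu: "i < 3 \<Longrightarrow> u \<in> Iu \<Longrightarrow> A i u \<in> Iu"
  and A_R: "i < 3 \<Longrightarrow> u \<in> Iu \<Longrightarrow> s \<in> Is \<Longrightarrow> (s, A i u) \<in> R i"
proof -
  have A': "A i u = (1 / cu i) * u + (- snd (offset i) / cu i)" for i u
    by (simp add: A_def diff_divide_distrib)
  \<comment> \<open>The bounds are left open: the ends of \<open>Iu\<close> give invariance, and the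
    sides of \<open>R i\<close> give membership in the rectangle.\<close>
  have *: "A i u \<in> {a..b}" if i: "i < 3" and u: "u \<in> Iu" and ab: "\<And>y. y \<in> \<Gamma> \<Longrightarrow> y \<in> R i \<Longrightarrow> snd y \<in> {a..b}" for i u a b
    unfolding A'
  proof (rule affine_hull_subset[of "snd ` \<Gamma>"])
    show "u \<in> {Inf (snd ` \<Gamma>)..Sup (snd ` \<Gamma>)}" using u by (simp add: Iu_def)
    fix t assume "t \<in> snd ` \<Gamma>"
    then obtain y where y: "y \<in> \<Gamma>" "t = snd y" by auto
    obtain z where z: "z \<in> \<Gamma>" "z \<in> R i" "snd z = A i t"
      using prepend_snd[OF y(1) i] y(2) by blast
    then show "1 / cu i * t + - snd (offset i) / cu i \<in> {a..b}" using ab[OF z(1,2)] A'[of i t] by simp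
  qed (use Gamma_ne Gamma_bdd in auto)
  show "i < 3 \<Longrightarrow> u \<in> Iu \<Longrightarrow> A i u \<in> Iu"
    unfolding Iu_def by (rule *) (use Gamma_Iu in \<open>auto simp: Iu_def\<close>)
  assume i: "i < 3" and u: "u \<in> Iu" and s: "s \<in> Is"
  obtain a b c d where R: "R i = {a..b} \<times> {c..d}" using rectangles[OF i] by blast
  have "A i u \<in> {c..d}" by (rule *[OF i u]) (use R in auto)
  moreover have "s \<in> {a..b}"
  proof -
    have "fst ` \<Gamma> \<subseteq> {a..b}"
    proof
      fix t assume "t \<in> fst ` \<Gamma>"
      then obtain y where y: "y \<in> \<Gamma>" "t = fst y" by auto
      obtain z where "z \<in> R i" "fst z = t" using prepend_fst[OF y(1) i] y(2) by blast
      then show "t \<in> {a..b}" using R by auto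
    qed
    then show ?thesis using hull_subset_interval[of "fst ` \<Gamma>" a b] s Gamma_ne by (auto simp: Is_def)
  qed
  ultimately show "(s, A i u) \<in> R i" using R by auto
qed

lemma Phi_A: "i < 3 \<Longrightarrow> u \<in> Iu \<Longrightarrow> s \<in> Is \<Longrightarrow> \<Phi> (s, A i u) = (B i s, u)"
  using Phi_R[OF _ A_R, of i u s] cu_nz[of i] by (simp add: A_def)

text \<open>If points with different symbols at -1 shared the first coordinate, gluing both to one
  future would produce a single point with two codes; the second coordinate is treated alike at
  position 0.\<close>

lemma Is_nondegenerate: "\<exists>s0 s1. s0 < s1 \<and> Is = {s0..s1}"
  and Iu_nondegenerate: "\<exists>u0 u1. u0 < u1 \<and> Iu = {u0..u1}"
proof -
  obtain y where y: "y \<in> \<Gamma>" "code y = (\<lambda>k. 0)" by (rule code_surj[of "\<lambda>k. 0"]) auto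
  obtain z where z: "z \<in> \<Gamma>" "code z = (\<lambda>k. 1)" by (rule code_surj[of "\<lambda>k. 1"]) auto
  have "fst y \<noteq> fst z"
  proof
    assume "fst y = fst z"
    then have "(fst y, snd y) = (fst z, snd y)" by simp
    then have "code (fst y, snd y) (-1) = code (fst z, snd y) (-1)" by simp
    then show False using glue(2)[OF y(1) y(1), of "-1"] glue(2)[OF z(1) y(1), of "-1"] y z by simp
  qed
  moreover have "fst y \<in> Is" "fst z \<in> Is" using y z Gamma_Is by auto
  ultimately have "Inf (fst ` \<Gamma>) < Sup (fst ` \<Gamma>)" by (auto simp: Is_def)
  then show "\<exists>s0 s1. s0 < s1 \<and> Is = {s0..s1}" unfolding Is_def by blast
  have "snd y \<noteq> snd z"
  proof
    assume "snd y = snd z"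
    then have "(fst y, snd y) = (fst y, snd z)" by simp
    then have "code (fst y, snd y) 0 = code (fst y, snd z) 0" by simp
    then show False using glue(2)[OF y(1) y(1), of "0"] glue(2)[OF y(1) z(1), of "0"] y z by simp
  qed
  moreover have "snd y \<in> Iu" "snd z \<in> Iu" using y z Gamma_Iu by auto
  ultimately have "Inf (snd ` \<Gamma>) < Sup (snd ` \<Gamma>)" by (auto simp: Iu_def)
  then show "\<exists>u0 u1. u0 < u1 \<and> Iu = {u0..u1}" unfolding Iu_def by blast
qed

end

section \<open>Expanding returns in the fibre\<close>

locale porcupine = three_legged_skew_product +
  fixes \<gamma> :: real
  assumes F0: "F0 (f 0) (f' 0)"
    and F1: "F1 (f 1) \<gamma> (f' 0 1)"
    and F2: "F2 (f 2) (f' 2)"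
    and F01: "F01 (f' 0) \<gamma> (f' 0 1) (f' 0 0)"
begin

section \<open>Constants and elementary properties of the fibre maps\<close>

abbreviation g :: "real \<Rightarrow> real" where "g \<equiv> f 0"
abbreviation lam :: real where "lam \<equiv> f' 0 1"
abbreviation beta :: real where "beta \<equiv> f' 0 0"

lemma constants: "0 < lam" "lam < 1" "1 < beta" "lam \<le> \<gamma>" "\<gamma> < 1" "0 < \<gamma>"
  using F0 F1 by (auto simp: F0_def F1_def)

text \<open>The form in which (F01) enters the estimates: the quotient of the two sides is the
  expansion factor of a return, up to an arbitrarily small loss.\<close>

lemma key_inequality: "beta - 1 < (1 - lam) * lam\<^sup>2"
proof -
  let ?k = "lam ^ 3 * (1 - lam)"
  have k: "0 < ?k" using constants by simp
  have b: "0 < 1 - inverse beta" using constants by (simp add: inverse_less_1_iff)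
  have "1 - inverse beta < \<gamma> * ?k" using F01 b by (simp add: F01_def pos_less_divide_eq)
  also have "\<dots> < ?k" using mult_strict_right_mono[OF constants(5) k] by simp
  finally have "beta * (1 - inverse beta) < beta * ?k"
    using constants by (intro mult_strict_left_mono) auto
  then have 1: "beta - 1 < beta * ?k" using constants by (simp add: right_diff_distrib)
  \<comment> \<open>The product equals \<open>1 - lam - ?k\<close>. The resulting bound
    \<open>beta * lam \<le> 1\<close> absorbs \<open>beta\<close> together with one of the three
    factors \<open>lam\<close> in \<open>beta * ?k\<close>.\<close>
  have "0 \<le> (1 - lam) * (1 - lam ^ 3)" using constants by (intro mult_nonneg_nonneg) (auto simp: power_le_one)
  then have "lam \<le> 1 - ?k" by (simp add: algebra_simps)
  then have "beta * lam \<le> beta * (1 - ?k)" using constants by (intro mult_left_mono) auto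
  then have "beta * lam \<le> 1" using 1 by (simp add: right_diff_distrib)
  then have "(beta * lam) * (lam\<^sup>2 * (1 - lam)) \<le> 1 * (lam\<^sup>2 * (1 - lam))"
    using constants by (intro mult_right_mono) auto
  moreover have "(beta * lam) * (lam\<^sup>2 * (1 - lam)) = beta * ?k"
    by (simp add: power2_eq_square power3_eq_cube)
  ultimately have "beta * ?k \<le> 1 * (lam\<^sup>2 * (1 - lam))" by argo
  then show ?thesis using 1 by (simp only: mult_1 mult.commute)
qed

lemma f_unit: "i < 3 \<Longrightarrow> x \<in> {0..1} \<Longrightarrow> f i x \<in> {0..1}"
  using fiber_maps[of i] by blast

lemma f_continuous: "i < 3 \<Longrightarrow> continuous_on {0..1} (f i)"
  by (rule DERIV_continuous_on[OF fiber_derivative])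

lemma f1: "x \<in> {0..1} \<Longrightarrow> f 1 x = \<gamma> * (1 - x)"
  using F1 by (simp add: F1_def)

lemma g_less: "x \<in> {0..1} \<Longrightarrow> y \<in> {0..1} \<Longrightarrow> x < y \<Longrightarrow> g x < g y"
  using F0 by (auto simp: F0_def strict_mono_on_def)

lemma g_fixed: "x \<in> {0..1} \<Longrightarrow> g x = x \<longleftrightarrow> x = 0 \<or> x = 1"
  using F0 by (auto simp: F0_def)

lemma g01 [simp]: "g 0 = 0" "g 1 = 1" using g_fixed by auto

lemma f_inside: "i < 3 \<Longrightarrow> x \<in> {0<..<1} \<Longrightarrow> f i x \<in> {0<..<1}"
proof -
  assume i: "i < 3" and x: "x \<in> {0<..<1}"
  consider "i = 0" | "i = 1" | "i = 2" using i by linarith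
  then show ?thesis
  proof cases
    case 1 then show ?thesis using g_less[of 0 x] g_less[of x 1] x by simp
  next
    case 2
    have "\<gamma> * (1 - x) < 1 * (1 - x)" using constants x by (intro mult_strict_right_mono) auto
    moreover have "1 * (1 - x) < 1" using x by simp
    ultimately have "\<gamma> * (1 - x) < 1" by (rule less_trans)
    then show ?thesis using constants x 2 f1[of x] by simp
  next
    case 3
    have "strict_mono_on {0..1} (f 2)" "f 2 0 = 0" using F2 by (auto simp: F2_def)
    then have "f 2 0 < f 2 x" "f 2 x < f 2 1" "f 2 0 = 0"
      using strict_mono_onD[of "{0..1}" "f 2" 0 x] strict_mono_onD[of "{0..1}" "f 2" x 1] x by auto
    then show ?thesis using f_unit[of 2 1] 3 by simp
  qed
qed

section \<open>Concavity of \<open>f 0\<close> and of its iterates\<close>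

lemma g_mvt:
  assumes "0 \<le> p" "p < q" "q \<le> 1"
  shows "\<exists>z. p < z \<and> z < q \<and> g q - g p = f' 0 z * (q - p)"
proof -
  have "\<exists>z\<in>{p<..<q}. g q - g p = (\<lambda>h. f' 0 z * h) (q - p)"
  proof (rule mvt_simple[OF assms(2)])
    fix x assume x: "p \<le> x" "x \<le> q"
    have "(g has_real_derivative f' 0 x) (at x within {0..1})"
      by (rule fiber_derivative) (use x assms in auto)
    then show "(g has_derivative (\<lambda>h. f' 0 x * h)) (at x within {p..q})"
      unfolding has_field_derivative_def by (rule has_derivative_subset) (use assms in auto)
  qed
  then show ?thesis by auto
qed

lemma f'0_antimono: "0 \<le> x \<Longrightarrow> x \<le> y \<Longrightarrow> y \<le> 1 \<Longrightarrow> f' 0 y \<le> f' 0 x"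
  using F01 by (auto simp: F01_def monotone_on_def)

lemma g_le_beta: "0 \<le> z \<Longrightarrow> z \<le> 1 \<Longrightarrow> g z \<le> beta * z"
proof (cases "z = 0")
  case False
  assume z: "0 \<le> z" "z \<le> 1"
  then obtain x where x: "0 < x" "x < z" "g z - g 0 = f' 0 x * (z - 0)"
    using g_mvt[of 0 z] False by auto
  then show ?thesis using f'0_antimono[of 0 x] z by (auto intro!: mult_right_mono)
qed simp

lemma one_minus_g: "0 \<le> y \<Longrightarrow> y \<le> 1 \<Longrightarrow> lam * (1 - y) \<le> 1 - g y"
proof (cases "y = 1")
  case False
  assume y: "0 \<le> y" "y \<le> 1"
  then obtain x where x: "y < x" "x < 1" "g 1 - g y = f' 0 x * (1 - y)"
    using g_mvt[of y 1] False by auto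
  then show ?thesis using f'0_antimono[of x 1] y by (auto intro!: mult_right_mono)
qed simp

text \<open>Slopes of adjacent chords compared without division, the form that passes to
  iterates.\<close>

lemma g_concave:
  assumes "0 \<le> p" "p < q" "q < r" "r \<le> 1"
  shows "(g r - g q) * (q - p) \<le> (g q - g p) * (r - q)"
proof -
  obtain x where x: "p < x" "x < q" "g q - g p = f' 0 x * (q - p)" using g_mvt[of p q] assms by auto
  obtain y where y: "q < y" "y < r" "g r - g q = f' 0 y * (r - q)" using g_mvt[of q r] assms by auto
  have "f' 0 y * ((r - q) * (q - p)) \<le> f' 0 x * ((r - q) * (q - p))"
    using f'0_antimono[of x y] x y assms by (intro mult_right_mono mult_nonneg_nonneg) auto
  then show ?thesis unfolding x(3) y(3) by (simp add: mult_ac)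
qed

text \<open>By concavity the graph lies above the chord from \<open>(0, 0)\<close> to
  \<open>(1, 1)\<close>; equality would be an interior fixed point.\<close>

lemma g_gt: "0 < x \<Longrightarrow> x < 1 \<Longrightarrow> x < g x"
proof -
  assume x: "0 < x" "x < 1"
  then have "(g 1 - g x) * (x - 0) \<le> (g x - g 0) * (1 - x)" by (intro g_concave) auto
  then have "x \<le> g x" by (simp add: algebra_simps)
  then show ?thesis using g_fixed[of x] x by simp
qed

lemma pow_unit: "x \<in> {0..1} \<Longrightarrow> (g ^^ M) x \<in> {0..1}"
  by (induction M) (use f_unit[of 0] in auto)

lemma pow_inside: "x \<in> {0<..<1} \<Longrightarrow> (g ^^ M) x \<in> {0<..<1}"
proof (induction M)
  case (Suc M) then show ?case using f_inside[of 0 "(g ^^ M) x"] by simp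
qed simp

lemma pow_less: "x \<in> {0..1} \<Longrightarrow> y \<in> {0..1} \<Longrightarrow> x < y \<Longrightarrow> (g ^^ M) x < (g ^^ M) y"
proof (induction M)
  case (Suc M) then show ?case using g_less pow_unit by simp
qed simp

text \<open>An increasing concave function of an increasing concave one is concave: the chord
  inequality for \<open>g\<close> at the image points is combined with the induction hypothesis, and
  the middle length \<open>Q - P\<close> cancels.\<close>

lemma pow_concave:
  assumes "0 \<le> p" "p < q" "q < r" "r \<le> 1"
  shows "((g ^^ M) r - (g ^^ M) q) * (q - p) \<le> ((g ^^ M) q - (g ^^ M) p) * (r - q)"
proof (induction M)
  case (Suc M)
  define P Q T where "P = (g ^^ M) p" and "Q = (g ^^ M) q" and "T = (g ^^ M) r"
  have o: "P < Q" "Q < T" using pow_less assms by (auto simp: P_def Q_def T_def)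
  have u: "0 \<le> P" "T \<le> 1" using pow_unit[of p M] pow_unit[of r M] assms by (auto simp: P_def T_def)
  have c: "(g T - g Q) * (Q - P) \<le> (g Q - g P) * (T - Q)" by (rule g_concave) (use o u in auto)
  have IH: "(T - Q) * (q - p) \<le> (Q - P) * (r - q)" using Suc by (simp add: P_def Q_def T_def)
  have n: "0 < g Q - g P" using g_less[of P Q] o u by simp
  have "(g T - g Q) * (q - p) * (Q - P) \<le> (g Q - g P) * ((T - Q) * (q - p))"
    using mult_right_mono[OF c, of "q - p"] assms by (simp add: mult_ac)
  also have "\<dots> \<le> (g Q - g P) * ((Q - P) * (r - q))"
    using mult_left_mono[OF IH, of "g Q - g P"] n by simp
  finally have "(g T - g Q) * (q - p) * (Q - P) \<le> (g Q - g P) * (r - q) * (Q - P)" by (simp add: mult_ac)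
  then have "(g T - g Q) * (q - p) \<le> (g Q - g P) * (r - q)"
    by (rule mult_right_le_imp_le) (use o in simp)
  then show ?case by (simp add: P_def Q_def T_def)
qed simp

text \<open>The orbit increases; if it stayed below \<open>b\<close>, its limit would be a fixed
  point inside \<open>(0, 1)\<close>.\<close>

lemma reach:
  assumes z: "0 < z" "z < 1" and b: "b < 1"
  shows "\<exists>M. b \<le> (g ^^ M) z"
proof (rule ccontr)
  assume "\<not> ?thesis"
  then have lt: "(g ^^ M) z < b" for M by (simp add: not_le)
  have ins: "(g ^^ M) z \<in> {0<..<1}" for M using pow_inside z by simp
  have inc: "incseq (\<lambda>M. (g ^^ M) z)"
    by (rule incseq_SucI) (use g_gt ins in \<open>auto intro: less_imp_le\<close>)
  obtain L where L: "(\<lambda>M. (g ^^ M) z) \<longlonglongrightarrow> L" "\<forall>M. (g ^^ M) z \<le> L"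
    using incseq_convergent[OF inc, of b] lt less_imp_le by blast
  have Lb: "L \<le> b" by (rule LIMSEQ_le_const2[OF L(1)]) (use lt less_imp_le in blast)
  have L0: "z \<le> L" using L(2) by (metis funpow_0)
  have LU: "L \<in> {0..1}" using L0 Lb z b by auto
  have "(\<lambda>M. g ((g ^^ M) z)) \<longlonglongrightarrow> g L"
    by (rule continuous_on_tendsto_compose[OF f_continuous[of 0] L(1) LU])
      (use ins in \<open>auto intro!: always_eventually less_imp_le\<close>)
  moreover have "(\<lambda>M. g ((g ^^ M) z)) \<longlonglongrightarrow> L" using LIMSEQ_Suc[OF L(1)] by simp
  ultimately have "g L = L" by (rule LIMSEQ_unique)
  then show False using g_gt[of L] L0 Lb z b by simp
qed

text \<open>The upper bound holds because the preceding iterate is still below \<open>b\<close>: the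
  first iterate past \<open>b\<close> lands in the fundamental domain between \<open>b\<close> and
  \<open>g b\<close>.\<close>

lemma first_reach:
  assumes "0 < z" "z < b" "b < 1"
  shows "\<exists>M. b \<le> (g ^^ M) z \<and> (g ^^ M) z < g b"
proof -
  define M where "M = (LEAST M. b \<le> (g ^^ M) z)"
  have ex: "\<exists>M. b \<le> (g ^^ M) z" using reach[of z b] assms by simp
  have M: "b \<le> (g ^^ M) z" unfolding M_def using LeastI_ex[OF ex] .
  then obtain N where N: "M = Suc N" using assms by (cases M) auto
  then have "\<not> b \<le> (g ^^ N) z" using not_less_Least[of N "\<lambda>M. b \<le> (g ^^ M) z"] by (auto simp: M_def)
  moreover have "(g ^^ N) z \<in> {0..1}" using pow_unit assms by simp
  ultimately have "(g ^^ M) z < g b" using g_less[of "(g ^^ N) z" b] N assms by simp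
  then show ?thesis using M by blast
qed

section \<open>Fibre maps of finite words\<close>

lemma fold_replicate_pow: "fold f (replicate M i) x = (f i ^^ M) x"
  by (induction M arbitrary: x) (auto simp: funpow_swap1)

text \<open>A word is an itinerary read from left to right. \<open>fold\<close> applies its first
  letter first; \<open>foldr A\<close> applies it last, because inverse branches compose in the
  opposite order.\<close>

abbreviation word :: "nat list \<Rightarrow> bool" where "word v \<equiv> set v \<subseteq> {..<3}"

lemma word_unit: "word v \<Longrightarrow> x \<in> {0..1} \<Longrightarrow> fold f v x \<in> {0..1}"
  by (induction v arbitrary: x) (use f_unit in auto)

lemma word_inside: "word v \<Longrightarrow> x \<in> {0<..<1} \<Longrightarrow> fold f v x \<in> {0<..<1}"
proof (induction v arbitrary: x)
  case (Cons i v) then show ?case using f_inside[of i x] by simp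
qed simp

lemma word_continuous: "word v \<Longrightarrow> continuous_on {0..1} (fold f v)"
proof (induction v)
  case (Cons i v)
  have "continuous_on {0..1} (fold f v \<circ> f i)"
    by (rule continuous_on_compose[OF f_continuous continuous_on_subset[OF Cons.IH]])
      (use Cons.prems f_unit in auto)
  then show ?case by simp
qed (simp add: id_def continuous_on_id)

lemma word_inj: "word v \<Longrightarrow> inj_on (fold f v) {0..1}"
proof (induction v)
  case (Cons i v)
  have "inj_on (fold f v \<circ> f i) {0..1}"
    by (rule comp_inj_on) (use Cons fiber_maps[of i] in \<open>auto intro: inj_on_subset\<close>)
  then show ?case by (simp add: comp_def)
qed simp

text \<open>Both orders of the end values occur, because each letter \<open>1\<close> reverses
  orientation.\<close>

lemma word_ivt:
  assumes v: "word v" and x: "0 \<le> x1" "x1 \<le> x2" "x2 \<le> 1"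
    and y: "fold f v x1 \<le> y \<and> y \<le> fold f v x2 \<or> fold f v x2 \<le> y \<and> y \<le> fold f v x1"
  shows "\<exists>x\<in>{x1..x2}. fold f v x = y"
proof -
  have c: "continuous_on {x1..x2} (fold f v)"
    by (rule continuous_on_subset[OF word_continuous[OF v]]) (use x in auto)
  from y show ?thesis
  proof
    assume "fold f v x1 \<le> y \<and> y \<le> fold f v x2"
    then show ?thesis using IVT'[OF _ _ x(2) c, of y] by auto
  next
    assume "fold f v x2 \<le> y \<and> y \<le> fold f v x1"
    then show ?thesis using IVT2'[OF _ _ x(2) c, of y] by auto
  qed
qed

lemma word_deriv: "word v \<Longrightarrow> x \<in> {0..1} \<Longrightarrow> \<exists>d. (fold f v has_real_derivative d) (at x within {0..1})"
proof (induction v arbitrary: x)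
  case Nil
  have "((\<lambda>x. x) has_real_derivative 1) (at x within {0..1})" by simp
  then show ?case by (auto simp: id_def intro: exI[of _ 1])
next
  case (Cons i v)
  then obtain d where d: "(fold f v has_real_derivative d) (at (f i x) within {0..1})"
    using f_unit by force
  have "(fold f v \<circ> f i has_real_derivative d * f' i x) (at x within {0..1})"
    by (rule DERIV_image_chain[OF DERIV_subset[OF d] fiber_derivative])
      (use Cons.prems f_unit in auto)
  then show ?case by (auto simp: comp_def)
qed

section \<open>Returns near \<open>1\<close> and the covering of a fundamental domain\<close>

text \<open>\<open>c\<close> gives up a little of the limiting rate \<open>1 - lam\<close> but stays
  above \<open>(beta - 1) / lam\<^sup>2\<close>, which is possible by \<open>key_inequality\<close>.
  The bound \<open>1/2 < a\<close> makes \<open>f 1\<close> send \<open>[a, 1]\<close> below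
  \<open>a\<close>, so that a return has to climb back.\<close>

lemma domain_near_1:
  obtains a c where "1/2 < a" "a < 1" "0 < c" "beta - 1 < c * lam\<^sup>2" "c < 1"
    "\<And>y. a \<le> y \<Longrightarrow> y \<le> 1 \<Longrightarrow> c * (1 - y) \<le> g y - y"
proof -
  have l2: "0 < lam\<^sup>2" using constants by simp
  have "(beta - 1) / lam\<^sup>2 < 1 - lam" using key_inequality l2 by (simp add: pos_divide_less_eq)
  then obtain c where c: "(beta - 1) / lam\<^sup>2 < c" "c < 1 - lam" using dense by blast
  have c': "beta - 1 < c * lam\<^sup>2" using c l2 by (simp add: pos_divide_less_eq)
  have c0: "0 < c" using c constants l2 by (meson divide_pos_pos diff_gt_0_iff_gt less_trans)
  have "(g has_real_derivative lam) (at 1 within {0..1})" by (rule fiber_derivative) auto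
  then have "((\<lambda>y. (g y - g 1) / (y - 1)) \<longlongrightarrow> lam) (at 1 within {0..1})"
    by (simp add: has_field_derivative_iff)
  then have "\<forall>\<^sub>F y in at 1 within {0..1}. (g y - g 1) / (y - 1) < 1 - c"
    by (rule order_tendstoD) (use c in simp)
  then obtain d where d: "d > 0" "\<And>y. y \<in> {0..1} \<Longrightarrow> y \<noteq> 1 \<Longrightarrow> dist y 1 < d \<Longrightarrow> (g y - g 1) / (y - 1) < 1 - c"
    by (auto simp: eventually_at)
  define a where "a = max (3/4) (1 - d/2)"
  show ?thesis
  proof (rule that[of a c])
    fix y assume y: "a \<le> y" "y \<le> 1"
    show "c * (1 - y) \<le> g y - y"
    proof (cases "y = 1")
      case False
      then have lt: "y < 1" using y by simp
      have "(g y - 1) / (y - 1) < 1 - c" using d(2)[of y] y False d(1) by (simp add: a_def dist_real_def)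
      then have "(1 - g y) / (1 - y) < 1 - c" by (metis minus_diff_eq minus_divide_divide)
      then have "1 - g y < (1 - c) * (1 - y)" using lt by (simp add: pos_divide_less_eq)
      then show ?thesis by (simp add: algebra_simps)
    qed simp
  qed (use c c0 c' d(1) constants in \<open>auto simp: a_def max_def\<close>)
qed

text \<open>Since \<open>f 0 ^^ M\<close> is concave, its slope on \<open>{z1..z2}\<close> is at least its slope on \<open>{z2..f 0 z2}\<close>.\<close>

lemma slope_bound:
  assumes z: "0 \<le> z1" "z1 < z2" "z2 < 1"
  shows "(g ((g ^^ M) z2) - (g ^^ M) z2) * (z2 - z1) \<le> ((g ^^ M) z2 - (g ^^ M) z1) * ((beta - 1) * z2)"
proof -
  have "z2 < g z2" using g_gt z by simp
  then have "((g ^^ M) (g z2) - (g ^^ M) z2) * (z2 - z1) \<le> ((g ^^ M) z2 - (g ^^ M) z1) * (g z2 - z2)"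
    using pow_concave[of z1 z2 "g z2" M] z f_unit[of 0 z2] by simp
  also have "\<dots> \<le> ((g ^^ M) z2 - (g ^^ M) z1) * ((beta - 1) * z2)"
    using pow_less[of z1 z2 M] g_le_beta[of z2] z by (intro mult_left_mono) (auto simp: algebra_simps)
  finally show ?thesis by (simp add: funpow_swap1)
qed

text \<open>\<open>M\<close> is the first time at which the lower end \<open>f 1 x2\<close> passes
  \<open>a\<close>, so \<open>m < g a\<close>. If the domain from \<open>m\<close> to
  \<open>g m\<close> is not covered, then \<open>w < g m < g (g a)\<close>, hence
  \<open>1 - w\<close> is at least \<open>lam\<^sup>2 * (1 - a)\<close>; this keeps the displacement
  at \<open>w\<close> large enough for \<open>slope_bound\<close>.\<close>

lemma step:
  assumes a: "1/2 < a" "a < 1" and c: "0 < c" "\<And>y. a \<le> y \<Longrightarrow> y \<le> 1 \<Longrightarrow> c * (1 - y) \<le> g y - y"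
    and x: "a \<le> x1" "x1 < x2" "x2 < 1"
  obtains M m w where "a \<le> m" "m < w" "w < 1" "m = (g ^^ M) (f 1 x2)" "w = (g ^^ M) (f 1 x1)"
    "g m \<le> w \<or> c * lam\<^sup>2 * (x2 - x1) \<le> (w - m) * (beta - 1)"
proof -
  define z1 z2 where "z1 = f 1 x2" and "z2 = f 1 x1"
  have z: "z1 = \<gamma> * (1 - x2)" "z2 = \<gamma> * (1 - x1)" using f1[of x1] f1[of x2] a x by (auto simp: z1_def z2_def)
  have z12: "z1 < z2" unfolding z using constants x by simp
  have "z2 < 1 - x1" using mult_strict_right_mono[of \<gamma> 1 "1 - x1"] constants x z by simp
  then have z2: "z2 < a" using a x by simp
  have z1: "0 < z1" using z constants x by simp
  obtain M where M: "a \<le> (g ^^ M) z1" "(g ^^ M) z1 < g a" using first_reach[of z1 a] a z1 z12 z2 by auto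
  define m w where "m = (g ^^ M) z1" and "w = (g ^^ M) z2"
  have mw: "m < w" using pow_less[of z1 z2] z1 z12 z2 a by (simp add: m_def w_def)
  have w1: "w < 1" using pow_inside[of z2 M] z1 z12 z2 a by (simp add: w_def)
  have "c * lam\<^sup>2 * (x2 - x1) \<le> (w - m) * (beta - 1)" if "w < g m"
  proof -
    have ga: "g a \<in> {0..1}" using f_unit[of 0 a] a by simp
    have "g m < g (g a)" using M mw w1 a ga by (intro g_less) (auto simp: m_def)
    then have wg: "w < g (g a)" using that by simp
    have "lam\<^sup>2 * (1 - a) = lam * (lam * (1 - a))" by (simp add: power2_eq_square)
    also have "\<dots> \<le> lam * (1 - g a)" using one_minus_g[of a] a constants by (intro mult_left_mono) auto
    also have "\<dots> \<le> 1 - g (g a)" using one_minus_g[of "g a"] ga by simp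
    also have "\<dots> \<le> 1 - w" using wg by simp
    finally have 1: "lam\<^sup>2 * (1 - a) \<le> 1 - w" .
    \<comment> \<open>The factor \<open>\<gamma> * (1 - a)\<close> is an upper bound for
      \<open>z2\<close>, and \<open>\<gamma> * (x2 - x1)\<close> is the length
      \<open>z2 - z1\<close>; the former cancels at the end of the chain.\<close>
    have "c * lam\<^sup>2 * (x2 - x1) * (\<gamma> * (1 - a)) = c * (lam\<^sup>2 * (1 - a)) * (\<gamma> * (x2 - x1))" by simp
    also have "\<dots> \<le> c * (1 - w) * (\<gamma> * (x2 - x1))"
      using 1 c x constants by (intro mult_right_mono mult_left_mono) auto
    also have "\<dots> \<le> (g w - w) * (\<gamma> * (x2 - x1))"
      using c(2)[of w] mw M w1 x constants by (intro mult_right_mono) (auto simp: m_def)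
    also have "\<dots> = (g w - w) * (z2 - z1)" by (simp add: z algebra_simps)
    also have "\<dots> \<le> (w - m) * ((beta - 1) * z2)"
      using slope_bound[of z1 z2 M] z1 z12 z2 a by (simp add: m_def w_def)
    also have "\<dots> \<le> (w - m) * ((beta - 1) * (\<gamma> * (1 - a)))"
      using mw constants x unfolding z by (intro mult_left_mono) auto
    finally have "c * lam\<^sup>2 * (x2 - x1) * (\<gamma> * (1 - a)) \<le> (w - m) * (beta - 1) * (\<gamma> * (1 - a))"
      by (simp add: mult_ac)
    then show ?thesis by (rule mult_right_le_imp_le) (use constants a in simp)
  qed
  then show ?thesis
    using that[of m w M] M mw w1 by (fastforce simp: m_def w_def z1_def z2_def)
qed

text \<open>Induction over an \<open>n\<close> for which \<open>\<kappa> ^ n\<close> times the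
  length is at least 1. A return that does not cover multiplies the length by at least
  \<open>\<kappa>\<close>, which pays for one step; the base case is contradictory because intervals
  in \<open>[a, 1)\<close> are shorter than 1.\<close>

lemma cover_domain:
  assumes a: "1/2 < a" "a < 1" and c: "0 < c" "\<And>y. a \<le> y \<Longrightarrow> y \<le> 1 \<Longrightarrow> c * (1 - y) \<le> g y - y"
    "beta - 1 < c * lam\<^sup>2" and x: "a \<le> x1" "x1 < x2" "x2 < 1"
  shows "\<exists>v m. word v \<and> a \<le> m \<and> m < 1 \<and> {m..g m} \<subseteq> fold f v ` {x1..x2}"
proof -
  define \<kappa> where "\<kappa> = c * lam\<^sup>2 / (beta - 1)"
  have k1: "1 < \<kappa>" using c constants by (simp add: \<kappa>_def pos_less_divide_eq)
  obtain n where "1 / (x2 - x1) < \<kappa> ^ n" using real_arch_pow[OF k1] by blast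
  then have "1 \<le> \<kappa> ^ n * (x2 - x1)" using x by (simp add: pos_divide_less_eq)
  then show ?thesis
    using x
  proof (induction n arbitrary: x1 x2)
    case 0 then show ?case using a by simp
  next
    case (Suc n)
    obtain M m w where s: "a \<le> m" "m < w" "w < 1" "m = (g ^^ M) (f 1 x2)" "w = (g ^^ M) (f 1 x1)"
      "g m \<le> w \<or> c * lam\<^sup>2 * (x2 - x1) \<le> (w - m) * (beta - 1)"
      using step[OF a c(1,2) Suc.prems(2-4)] by blast
    define u where "u = 1 # replicate M (0::nat)"
    have u: "word u" by (auto simp: u_def)
    have ends: "fold f u x2 = m" "fold f u x1 = w" by (simp_all add: u_def fold_replicate_pow s)
    have im: "{m..w} \<subseteq> fold f u ` {x1..x2}"
    proof
      fix y assume "y \<in> {m..w}"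
      then have "\<exists>x\<in>{x1..x2}. fold f u x = y"
        by (intro word_ivt[OF u]) (use ends Suc.prems a in auto)
      then show "y \<in> fold f u ` {x1..x2}" by blast
    qed
    show ?case
    proof (cases "g m \<le> w")
      case True
      then show ?thesis using im s u by (intro exI[of _ u] exI[of _ m]) auto
    next
      case False
      then have "\<kappa> * (x2 - x1) \<le> w - m" using s(6) constants by (simp add: \<kappa>_def pos_divide_le_eq)
      then have "\<kappa> ^ n * (\<kappa> * (x2 - x1)) \<le> \<kappa> ^ n * (w - m)" using k1 by (intro mult_left_mono) auto
      then have "1 \<le> \<kappa> ^ n * (w - m)" using Suc.prems(1) by (simp add: mult_ac)
      then obtain v m' where v: "word v" "a \<le> m'" "m' < 1" "{m'..g m'} \<subseteq> fold f v ` {m..w}"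
        using Suc.IH[of w m] s(1-3) by blast
      have "{m'..g m'} \<subseteq> fold f (u @ v) ` {x1..x2}" using v(4) im by (fastforce simp: image_iff)
      then show ?thesis using v u by (intro exI[of _ "u @ v"] exI[of _ m']) auto
    qed
  qed
qed

text \<open>The iterates of \<open>g\<close> move the covered fundamental domain over all of
  \<open>[m, 1)\<close>, but never below \<open>m\<close>. A general target is reached by going near
  \<open>1\<close>, applying \<open>f 1\<close> and climbing again; the witnesses are built
  backwards from \<open>t\<close>.\<close>

proposition interval_hits_point:
  assumes x: "0 < x1" "x1 < x2" "x2 < 1" and t: "0 < t" "t < 1"
  shows "\<exists>v. word v \<and> t \<in> fold f v ` {x1..x2}"
proof -
  obtain a c where a: "1/2 < a" "a < 1" and c: "0 < c" "beta - 1 < c * lam\<^sup>2"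
    "\<And>y. a \<le> y \<Longrightarrow> y \<le> 1 \<Longrightarrow> c * (1 - y) \<le> g y - y" using domain_near_1 by metis
  obtain K where K: "a \<le> (g ^^ K) x1" using reach[of x1 a] x a by auto
  define X1 X2 where "X1 = (g ^^ K) x1" and "X2 = (g ^^ K) x2"
  have X: "X1 < X2" "X2 < 1" using pow_less[of x1 x2 K] pow_inside[of x2 K] x by (auto simp: X1_def X2_def)
  obtain v m where v: "word v" "a \<le> m" "m < 1" "{m..g m} \<subseteq> fold f v ` {X1..X2}"
    using cover_domain[OF a c(1,3,2), of X1 X2] K X by (auto simp: X1_def)
  have m0: "0 < m" using a v by simp
  \<comment> \<open>\<open>e\<close> is the value of \<open>f 1\<close> at \<open>m\<close>: a
    preimage of \<open>t\<close> under \<open>g ^^ k\<close> taken in \<open>(0, e]\<close> has its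
    own preimage \<open>y\<close> under \<open>f 1\<close> in \<open>[m, 1)\<close>.\<close>
  define e where "e = \<gamma> * (1 - m)"
  have "\<gamma> * (1 - m) < 1 * (1 - m)" using constants v by (intro mult_strict_right_mono) auto
  also have "1 * (1 - m) < 1" using m0 by simp
  finally have e: "0 < e" "e < 1" using constants v m0 by (auto simp: e_def)
  obtain k where k: "t \<le> (g ^^ k) e" using reach[of e t] e t by auto
  have z0: "(g ^^ k) 0 = 0" by (induction k) auto
  have "\<exists>z\<in>{0..e}. fold f (replicate k 0) z = t"
    by (rule word_ivt) (use k z0 e t in \<open>auto simp: fold_replicate_pow\<close>)
  then obtain z where z: "z \<in> {0..e}" "(g ^^ k) z = t" by (auto simp: fold_replicate_pow)
  have zp: "0 < z" using z z0 t by (cases "z = 0") auto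
  define y where "y = 1 - z / \<gamma>"
  have y1: "y < 1" using zp constants by (simp add: y_def)
  have "z / \<gamma> \<le> 1 - m" using z constants by (simp add: e_def pos_divide_le_eq mult.commute)
  then have ym: "m \<le> y" by (simp add: y_def)
  have "y \<in> {0..1}" using ym y1 m0 by simp
  then have fy: "f 1 y = z" using f1[of y] constants by (simp add: y_def)
  have "\<exists>j. (g ^^ j) m \<le> y \<and> y \<le> (g ^^ j) (g m)"
  proof (cases "m = y")
    case True then show ?thesis using g_gt[of m] m0 v by (intro exI[of _ 0]) auto
  next
    case False
    \<comment> \<open>The least exponent that moves \<open>m\<close> to or past \<open>y\<close> is
      one too many; its predecessor places \<open>y\<close> in the translated fundamental
      domain.\<close>
    define L where "L = (LEAST M. y \<le> (g ^^ M) m)"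
    have ex: "\<exists>M. y \<le> (g ^^ M) m" using reach[of m y] m0 v y1 by simp
    have L: "y \<le> (g ^^ L) m" unfolding L_def using LeastI_ex[OF ex] .
    then obtain N where N: "L = Suc N" using False ym by (cases L) auto
    then have "\<not> y \<le> (g ^^ N) m" using not_less_Least[of N "\<lambda>M. y \<le> (g ^^ M) m"] by (auto simp: L_def)
    then show ?thesis using L N by (intro exI[of _ N]) (simp add: funpow_swap1)
  qed
  then obtain j where j: "(g ^^ j) m \<le> y" "y \<le> (g ^^ j) (g m)" by blast
  have "\<exists>s\<in>{m..g m}. fold f (replicate j 0) s = y"
    by (rule word_ivt) (use j m0 v g_gt[of m] f_unit[of 0 m] in \<open>auto simp: fold_replicate_pow less_imp_le\<close>)
  then obtain s where s: "s \<in> {m..g m}" "fold f (replicate j 0) s = y" by auto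
  then obtain r where r: "r \<in> {X1..X2}" "fold f v r = s" using v(4) by auto
  have "\<exists>p\<in>{x1..x2}. fold f (replicate K 0) p = r"
    by (rule word_ivt) (use r x in \<open>auto simp: fold_replicate_pow X1_def X2_def\<close>)
  then obtain p where p: "p \<in> {x1..x2}" "fold f (replicate K 0) p = r" by auto
  let ?u = "replicate K 0 @ v @ replicate j 0 @ [1] @ replicate k 0"
  have "fold f ?u p = t" using p r s fy z by (simp add: fold_replicate_pow)
  moreover have "word ?u" using v by auto
  ultimately show ?thesis using p by (intro exI[of _ ?u]) force
qed

text \<open>By injectivity the word image of an interval is again nondegenerate, so
  \<open>interval_hits_point\<close> applies to it. \<open>min\<close> and \<open>max\<close>
  account for a reversal of orientation.\<close>

lemma word_image_hits_point:
  assumes w: "word w" and x: "0 < x1" "x1 < x2" "x2 < 1" and t: "0 < t" "t < 1"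
  shows "\<exists>v. word v \<and> t \<in> fold f (w @ v) ` {x1..x2}"
proof -
  define e1 e2 where "e1 = fold f w x1" and "e2 = fold f w x2"
  have ins: "e1 \<in> {0<..<1}" "e2 \<in> {0<..<1}" using word_inside[OF w] x by (auto simp: e1_def e2_def)
  have "e1 \<noteq> e2" using inj_onD[OF word_inj[OF w], of x1 x2] x by (auto simp: e1_def e2_def)
  then have "\<exists>v. word v \<and> t \<in> fold f v ` {min e1 e2..max e1 e2}"
    by (intro interval_hits_point) (use ins t in auto)
  then obtain v y where v: "word v" and y: "min e1 e2 \<le> y" "y \<le> max e1 e2" "t = fold f v y" by auto
  have "\<exists>x\<in>{x1..x2}. fold f w x = y"
    by (rule word_ivt[OF w]) (use x y in \<open>auto simp: e1_def e2_def min_def max_def split: if_splits\<close>)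
  then show ?thesis using v y by (intro exI[of _ v]) force
qed

text \<open>Continuity turns an exact hit of the midpoint into a whole subinterval of starting
  points, which leaves room for a further word.\<close>

lemma word_image_hits_interval:
  assumes w: "word w" and x: "0 < x1" "x1 < x2" "x2 < 1" and z: "0 < z1" "z1 < z2" "z2 < 1"
  shows "\<exists>v y1 y2. word v \<and> x1 \<le> y1 \<and> y1 < y2 \<and> y2 \<le> x2 \<and> fold f (w @ v) ` {y1..y2} \<subseteq> {z1..z2}"
proof -
  have "\<exists>v. word v \<and> (z1 + z2) / 2 \<in> fold f (w @ v) ` {x1..x2}"
    by (rule word_image_hits_point[OF w x]) (use z in auto)
  then obtain v p where v: "word v" and p: "p \<in> {x1..x2}" "fold f (w @ v) p = (z1 + z2) / 2" by force
  have "continuous_on {x1..x2} (fold f (w @ v))"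
    by (rule continuous_on_subset[OF word_continuous]) (use x v w in auto)
  then obtain d where d: "d > 0"
    "\<And>y. y \<in> {x1..x2} \<Longrightarrow> dist y p < d \<Longrightarrow> dist (fold f (w @ v) y) (fold f (w @ v) p) < (z2 - z1) / 2"
    using p z unfolding continuous_on_iff by (metis diff_gt_0_iff_gt half_gt_zero)
  define y1 y2 where "y1 = max x1 (p - d / 2)" and "y2 = min x2 (p + d / 2)"
  have "fold f (w @ v) ` {y1..y2} \<subseteq> {z1..z2}"
  proof
    fix t assume "t \<in> fold f (w @ v) ` {y1..y2}"
    then obtain y where y: "y \<in> {y1..y2}" "t = fold f (w @ v) y" by blast
    have "y \<in> {x1..x2}" "dist y p < d" using y(1) d(1) by (auto simp: y1_def y2_def dist_real_def)
    from d(2)[OF this] have "dist t ((z1 + z2) / 2) < (z2 - z1) / 2" unfolding p(2) y(2) .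
    then show "t \<in> {z1..z2}" unfolding dist_real_def abs_less_iff by (simp add: field_simps)
  qed
  moreover have "y1 < y2" using p d(1) x by (auto simp: y1_def y2_def)
  ultimately show ?thesis using v
    by (intro exI[of _ v] exI[of _ y1] exI[of _ y2]) (auto simp: y1_def y2_def)
qed

text \<open>The number of letters \<open>0\<close> is the first return time of \<open>a\<close>. The
  word map sends \<open>a\<close> into \<open>[a, g a)\<close> and, being decreasing, sends
  \<open>g a\<close> below \<open>g a\<close>; hence there is a fixed point in between.\<close>

proposition repelling_word:
  obtains w q d where "word w" "w \<noteq> []" "0 < q" "q < 1" "fold f w q = q"
    "(fold f w has_real_derivative d) (at q within {0..1})" "1 < \<bar>d\<bar>"
proof -
  obtain a c where a: "1/2 < a" "a < 1" and c: "0 < c" "beta - 1 < c * lam\<^sup>2"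
    "\<And>y. a \<le> y \<Longrightarrow> y \<le> 1 \<Longrightarrow> c * (1 - y) \<le> g y - y" using domain_near_1 by metis
  have fa: "f 1 a = \<gamma> * (1 - a)" using f1[of a] a by simp
  have "\<gamma> * (1 - a) < 1 * (1 - a)" using constants a by (intro mult_strict_right_mono) auto
  also have "1 * (1 - a) < a" using a by simp
  finally have "f 1 a < a" using fa by simp
  moreover have "0 < f 1 a" using fa a constants by simp
  ultimately obtain M where M: "a \<le> (g ^^ M) (f 1 a)" "(g ^^ M) (f 1 a) < g a"
    using first_reach[of "f 1 a" a] a by auto
  define w where "w = 1 # replicate M (0::nat)"
  have w: "word w" by (auto simp: w_def)
  have wf: "fold f w x = (g ^^ M) (f 1 x)" for x by (simp add: w_def fold_replicate_pow)
  have ga: "a < g a" "g a < 1" using g_gt[of a] f_inside[of 0 a] a by auto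
  have "fold f w (g a) \<le> g a"
  proof -
    have "f 1 (g a) < f 1 a" using f1[of "g a"] f1[of a] ga a constants by simp
    then have "(g ^^ M) (f 1 (g a)) < (g ^^ M) (f 1 a)"
      using f_unit[of 1 a] f_unit[of 1 "g a"] ga a by (intro pow_less) auto
    then show ?thesis using M wf by simp
  qed
  moreover have "continuous_on {a..g a} (\<lambda>x. fold f w x - x)"
    by (intro continuous_intros continuous_on_subset[OF word_continuous[OF w]]) (use a ga in auto)
  ultimately obtain q where q: "a \<le> q" "q \<le> g a" "fold f w q - q = 0"
    using IVT2'[of "\<lambda>x. fold f w x - x" "g a" 0 a] M wf[of a] ga by auto
  have q1: "q < 1" "0 < q" using q ga a by auto
  have "word (replicate M 0)" by auto
  then obtain D where D: "(fold f (replicate M 0) has_real_derivative D) (at (f 1 q) within {0..1})"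
    using word_deriv[of "replicate M 0" "f 1 q"] f_unit[of 1 q] q1 by (auto simp del: fold_replicate)
  have Dg: "((g ^^ M) has_real_derivative D) (at (f 1 q) within {0..1})"
    using D by (simp add: fold_replicate_pow[abs_def])
  define z where "z = f 1 q"
  have z: "z = \<gamma> * (1 - q)" "0 < z" "z < 1" using f1[of q] f_inside[of 1 q] q1 by (auto simp: z_def)
  have gz: "(g ^^ M) z = q" using q wf[of q] by (simp add: z_def)
  \<comment> \<open>\<open>slope_bound\<close> with upper point \<open>z\<close>, where
    \<open>(g ^^ M) z = q\<close>, makes \<open>r\<close> a lower bound for the slopes of all chords
    ending at \<open>z\<close> from the left, hence for \<open>D\<close>.\<close>
  define r where "r = (g q - q) / ((beta - 1) * z)"
  have bz: "0 < (beta - 1) * z" using z constants by simp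
  have "r \<le> D"
  proof (rule tendsto_lowerbound)
    have "((g ^^ M) has_real_derivative D) (at z)"
      using Dg[folded z_def] z(2,3) by (simp add: at_within_Icc_at)
    then have "((\<lambda>y. ((g ^^ M) y - (g ^^ M) z) / (y - z)) \<longlongrightarrow> D) (at z)"
      by (simp add: has_field_derivative_iff)
    then show "((\<lambda>y. ((g ^^ M) y - (g ^^ M) z) / (y - z)) \<longlongrightarrow> D) (at_left z)"
      by (rule filterlim_mono) (auto simp: at_within_le_at at_le)
    show "\<forall>\<^sub>F y in at_left z. r \<le> ((g ^^ M) y - (g ^^ M) z) / (y - z)"
      unfolding eventually_at_left_field
    proof (intro exI conjI allI impI)
      show "0 < z" by fact
      fix y assume y: "0 < y" "y < z"
      have "(g q - q) * (z - y) \<le> (q - (g ^^ M) y) * ((beta - 1) * z)"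
        using slope_bound[of y z M] y z gz by simp
      then have "r \<le> (q - (g ^^ M) y) / (z - y)"
        unfolding r_def using bz y by (simp add: pos_divide_le_eq pos_le_divide_eq mult.commute)
      then show "r \<le> ((g ^^ M) y - (g ^^ M) z) / (y - z)"
        using gz by (metis minus_diff_eq minus_divide_divide)
    qed
    show "at_left z \<noteq> bot" by (simp add: trivial_limit_at_left_real)
  qed
  \<comment> \<open>Since \<open>z = \<gamma> * (1 - q)\<close>, the product is
    \<open>(g q - q) / ((beta - 1) * (1 - q))\<close>, which is at least
    \<open>c / (beta - 1)\<close>.\<close>
  moreover have "1 < r * \<gamma>"
  proof -
    have l: "lam\<^sup>2 < 1" using constants by (simp add: power_less_one_iff)
    have "beta - 1 < c" using c(2) mult_strict_left_mono[OF l c(1)] by linarith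
    then have "(beta - 1) * (1 - q) < c * (1 - q)" using q1 by (intro mult_strict_right_mono) auto
    also have "\<dots> \<le> g q - q" using c(3) q q1 by simp
    finally have "(beta - 1) * z < (g q - q) * \<gamma>" using constants z by (simp add: mult.left_commute mult.commute)
    then show ?thesis unfolding r_def using bz by (simp add: pos_less_divide_eq)
  qed
  ultimately have 1: "1 < D * \<gamma>" using constants mult_right_mono[of r D \<gamma>] by linarith
  have d1: "(f 1 has_real_derivative - \<gamma>) (at q within {0..1})"
  proof (rule has_field_derivative_transform_within[of "\<lambda>x. \<gamma> * (1 - x)" _ _ _ 1])
    show "((\<lambda>x. \<gamma> * (1 - x)) has_real_derivative - \<gamma>) (at q within {0..1})"
      by (auto intro!: derivative_eq_intros)
  qed (use q1 f1 in auto)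
  have "((g ^^ M) \<circ> f 1 has_real_derivative D * - \<gamma>) (at q within {0..1})"
    by (rule DERIV_image_chain[OF DERIV_subset[OF Dg] d1]) (use f_unit[of 1] in auto)
  moreover have "(g ^^ M) \<circ> f 1 = fold f w" using wf by (simp add: fun_eq_iff)
  ultimately show ?thesis
    by (intro that[of w q "D * - \<gamma>"]) (use w q q1 1 in \<open>auto simp: w_def\<close>)
qed

end

section \<open>Invariant manifolds and maximal invariant sets\<close>

lemma stable_pullback:
  assumes "X \<in> D" "F X \<in> stable_manifold D F (F Y)"
  shows "X \<in> stable_manifold D F Y"
proof -
  have "(F ^^ n) X \<in> D" for n
    using assms by (cases n) (auto simp: stable_manifold_def funpow_swap1)
  moreover have "(\<lambda>n. dist ((F ^^ Suc n) X) ((F ^^ Suc n) Y)) \<longlonglongrightarrow> 0"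
    using assms by (simp add: stable_manifold_def funpow_swap1)
  then have "(\<lambda>n. dist ((F ^^ n) X) ((F ^^ n) Y)) \<longlonglongrightarrow> 0" by (rule LIMSEQ_imp_Suc)
  ultimately show ?thesis by (simp add: stable_manifold_def)
qed

lemma stable_pullback_pow:
  assumes "\<And>k. k < n \<Longrightarrow> (F ^^ k) X \<in> D" "(F ^^ n) X \<in> stable_manifold D F ((F ^^ n) Y)"
  shows "X \<in> stable_manifold D F Y"
  using assms
proof (induction n)
  case (Suc n)
  have "(F ^^ n) X \<in> stable_manifold D F ((F ^^ n) Y)"
    by (rule stable_pullback) (use Suc.prems in auto)
  then show ?case using Suc by simp
qed simp

lemma unstable_push:
  assumes "X \<in> D" "Y \<in> D" "X \<in> unstable_manifold D F Y"
  shows "F X \<in> unstable_manifold D F (F Y)"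
proof -
  obtain x y where xy: "backward_orbit D F x" "x 0 = X" "backward_orbit D F y" "y 0 = Y"
    "(\<lambda>n. dist (x n) (y n)) \<longlonglongrightarrow> 0" using assms by (auto simp: unstable_manifold_def)
  let ?x = "case_nat (F X) x" and ?y = "case_nat (F Y) y"
  have "backward_orbit D F ?x" "backward_orbit D F ?y"
    using xy assms by (auto simp: backward_orbit_def split: nat.split)
  moreover have "(\<lambda>n. dist (?x n) (?y n)) \<longlonglongrightarrow> 0"
    by (rule LIMSEQ_imp_Suc) (use xy in simp)
  ultimately show ?thesis
    unfolding unstable_manifold_def by (intro CollectI exI[of _ ?x] exI[of _ ?y]) auto
qed

lemma unstable_push_pow:
  assumes "\<And>k. k < n \<Longrightarrow> (F ^^ k) X \<in> D" "\<And>k. k < n \<Longrightarrow> (F ^^ k) Y \<in> D" "X \<in> unstable_manifold D F Y"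
  shows "(F ^^ n) X \<in> unstable_manifold D F ((F ^^ n) Y)"
  using assms by (induction n) (auto intro: unstable_push)

text \<open>It suffices to follow a backward orbit at the multiples of the period.\<close>

lemma unstable_periodic:
  fixes F :: "'a::metric_space \<Rightarrow> 'a"
  assumes F: "continuous_on D F" and P: "0 < P" "(F ^^ P) Q = Q" and Q: "\<And>k. (F ^^ k) Q \<in> D"
    and Z: "\<And>k. (F ^^ P) (Z (Suc k)) = Z k" "\<And>k j. j < P \<Longrightarrow> (F ^^ j) (Z (Suc k)) \<in> D" "Z \<longlonglongrightarrow> Q"
  shows "Z 0 \<in> unstable_manifold D F Q"
proof -
  \<comment> \<open>The point \<open>n\<close> steps back lies between
    \<open>Z (Suc (n div P))\<close> and \<open>Z (n div P)\<close>; the exponent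
    \<open>P - n mod P\<close> runs from \<open>P\<close> down to 1 and never reaches 0.\<close>
  define bk where "bk Z n = (F ^^ (P - n mod P)) (Z (Suc (n div P)))" for Z :: "nat \<Rightarrow> 'a" and n
  have bk: "backward_orbit D F (bk Z)" "bk Z 0 = Z 0"
    if Z: "\<And>k. (F ^^ P) (Z (Suc k)) = Z k" "\<And>k j. j < P \<Longrightarrow> (F ^^ j) (Z (Suc k)) \<in> D" for Z
  proof -
    show "bk Z 0 = Z 0" using Z(1)[of 0] by (simp add: bk_def)
    have "bk Z (Suc n) \<in> D \<and> F (bk Z (Suc n)) = bk Z n" for n
    proof (cases "Suc (n mod P) = P")
      case True
      then have "Suc n mod P = 0" "Suc n div P = Suc (n div P)" "P - n mod P = 1"
        by (auto simp: mod_Suc div_Suc)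
      then show ?thesis using Z(1)[of "Suc (n div P)"] Z(2)[OF P(1)] by (simp add: bk_def)
    next
      case False
      then have "Suc (n mod P) < P" using P(1) by (simp add: Suc_lessI)
      moreover have "Suc n mod P = Suc (n mod P)" "Suc n div P = n div P"
        using False by (auto simp: mod_Suc div_Suc)
      moreover have "P - n mod P = Suc (P - Suc (n mod P))" using calculation by simp
      ultimately show ?thesis using Z(2)[of "P - Suc (n mod P)" "n div P"] P(1) by (simp add: bk_def)
    qed
    then show "backward_orbit D F (bk Z)" by (simp add: backward_orbit_def)
  qed
  have lim: "(\<lambda>k. (F ^^ j) (Z (Suc k))) \<longlonglongrightarrow> (F ^^ j) Q" if "j \<le> P" for j
    using that
  proof (induction j)
    case 0 then show ?case using LIMSEQ_Suc[OF Z(3)] by simp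
  next
    case (Suc j)
    then show ?case
      using continuous_on_tendsto_compose[OF F Suc.IH Q] Z(2)[of j] by (simp add: always_eventually)
  qed
  \<comment> \<open>One sum over all phases \<open>j\<close> bounds the distance at every position
    within a period at once.\<close>
  have "(\<lambda>k. \<Sum>j\<le>P. dist ((F ^^ j) (Z (Suc k))) ((F ^^ j) Q)) \<longlonglongrightarrow> (\<Sum>j\<le>P. 0)"
    by (rule tendsto_sum) (use lim in \<open>simp add: tendsto_dist_iff [symmetric]\<close>)
  then have "(\<lambda>k. \<Sum>j\<le>P. dist ((F ^^ j) (Z (Suc k))) ((F ^^ j) Q)) \<longlonglongrightarrow> 0" by simp
  then have "(\<lambda>n. \<Sum>j\<le>P. dist ((F ^^ j) (Z (Suc (n div P)))) ((F ^^ j) Q)) \<longlonglongrightarrow> 0"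
    by (rule filterlim_compose[OF _ filterlim_at_top_div_const_nat[OF P(1)]])
  note bound = this
  have "(\<lambda>n. dist (bk Z n) (bk (\<lambda>_. Q) n)) \<longlonglongrightarrow> 0"
  proof (rule tendsto_sandwich[OF _ _ tendsto_const bound])
    have "dist (bk Z n) (bk (\<lambda>_. Q) n) \<le> (\<Sum>j\<le>P. dist ((F ^^ j) (Z (Suc (n div P)))) ((F ^^ j) Q))" for n
      unfolding bk_def
      by (rule member_le_sum[where f = "\<lambda>j. dist ((F ^^ j) (Z (Suc (n div P)))) ((F ^^ j) Q)"]) auto
    then show "\<forall>\<^sub>F n in sequentially. dist (bk Z n) (bk (\<lambda>_. Q) n)
        \<le> (\<Sum>j\<le>P. dist ((F ^^ j) (Z (Suc (n div P)))) ((F ^^ j) Q))"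
      by (simp add: always_eventually)
  qed (simp add: always_eventually)
  then show ?thesis
    unfolding unstable_manifold_def using bk[of Z, OF Z(1,2)] bk[of "\<lambda>_. Q", OF P(2) Q] by blast
qed

section \<open>Tangent vectors and diagonal linear maps\<close>

lemma segment_in_tangent_space:
  assumes "\<And>t. t \<in> {0..1} \<Longrightarrow> X + t *\<^sub>R v \<in> W"
  shows "v \<in> tangent_space W X"
  unfolding tangent_space_def
proof (rule span_base, safe)
  let ?c = "\<lambda>t. X + t *\<^sub>R v"
  have d: "(?c has_vector_derivative v) (at t)" for t
    by (auto intro!: derivative_eq_intros)
  show "\<exists>c. c C1_differentiable_on {0..1} \<and> c 0 = X \<and> c ` {0..1} \<subseteq> W \<and> (c has_vector_derivative v) (at 0)"
  proof (intro exI conjI)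
    show "?c C1_differentiable_on {0..1}" unfolding C1_differentiable_on_def
      by (intro exI[of _ "\<lambda>_. v"]) (use d in auto)
  qed (use assms d in auto)
qed

text \<open>The point may be an end of the interval, so only one direction may be available; its
  sign is immaterial for a linear span.\<close>

lemma interval_direction:
  fixes y :: real
  assumes "y \<in> {a..b}" "a < b"
  obtains e where "e \<noteq> 0" "\<And>t. t \<in> {0..1} \<Longrightarrow> y + t * e \<in> {a..b}"
proof -
  have "(1 - t) * y + t * z \<in> {a..b}" if "t \<in> {0..1}" "z \<in> {a..b}" for t z
    using convexD[OF convex_real_interval(5)[of a b] assms(1) that(2), of "1 - t" t] that(1) by simp
  then have *: "y + t * (z - y) \<in> {a..b}" if "t \<in> {0..1}" "z \<in> {a..b}" for t z
    using that by (fastforce simp: algebra_simps)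
  show ?thesis
  proof (cases "y < b")
    case True then show ?thesis using that[of "b - y"] *[of _ b] assms by auto
  next
    case False then show ?thesis using that[of "a - y"] *[of _ a] assms by auto
  qed
qed

lemma subspace_tangent_space: "subspace (tangent_space W X)"
  by (simp add: tangent_space_def)

lemma rescale_in_subspace: "subspace S \<Longrightarrow> e *\<^sub>R v \<in> S \<Longrightarrow> e \<noteq> 0 \<Longrightarrow> v \<in> S"
  using subspace_scale[of S "e *\<^sub>R v" "inverse e"] by simp

definition diag :: "real \<Rightarrow> real \<Rightarrow> real \<Rightarrow> (real \<times> real) \<times> real \<Rightarrow> (real \<times> real) \<times> real" where
  "diag a b c = (\<lambda>v. ((a * fst (fst v), b * snd (fst v)), c * snd v))"

lemma diag_power: "(diag a b c ^^ n) v = diag (a ^ n) (b ^ n) (c ^ n) v"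
  by (induction n) (simp_all add: diag_def mult.assoc)

text \<open>The fibre direction joins the expanding base direction in \<open>Eu\<close>, in
  accordance with index two.\<close>

lemma linear_saddle_diag:
  assumes a: "\<bar>a\<bar> < 1" and b: "1 < \<bar>b\<bar>" and c: "1 < \<bar>c\<bar>"
  shows "linear_saddle (diag a b c)"
proof -
  define Es :: "((real \<times> real) \<times> real) set" where "Es = {v. snd (fst v) = 0 \<and> snd v = 0}"
  define Eu :: "((real \<times> real) \<times> real) set" where "Eu = {v. fst (fst v) = 0}"
  define \<theta> where "\<theta> = Max {\<bar>a\<bar>, 1 / \<bar>b\<bar>, 1 / \<bar>c\<bar>}"
  have th: "\<bar>a\<bar> \<le> \<theta>" "1 / \<bar>b\<bar> \<le> \<theta>" "1 / \<bar>c\<bar> \<le> \<theta>" by (auto simp: \<theta>_def)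
  have th0: "0 < \<theta>" using th(2) b by (meson less_le_trans zero_less_divide_1_iff less_trans zero_less_one)
  have th1: "\<theta> < 1" using a b c by (simp add: \<theta>_def)
  have ge: "\<bar>y\<bar> \<le> \<theta> ^ n * \<bar>k ^ n * y\<bar>" if "1 / \<bar>k\<bar> \<le> \<theta>" "1 < \<bar>k\<bar>" for k y n
  proof -
    have "1 \<le> \<theta> * \<bar>k\<bar>" using that by (simp add: pos_divide_le_eq)
    then have "1 \<le> (\<theta> * \<bar>k\<bar>) ^ n" by (rule one_le_power)
    then have "1 * \<bar>y\<bar> \<le> (\<theta> * \<bar>k\<bar>) ^ n * \<bar>y\<bar>" by (rule mult_right_mono) simp
    then show ?thesis by (simp add: power_mult_distrib abs_mult power_abs mult.assoc)
  qed
  show ?thesis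
    unfolding linear_saddle_def
  proof (rule exI[of _ Es], rule exI[of _ Eu], rule exI[of _ 1], rule exI[of _ \<theta>], intro conjI ballI allI)
    show "subspace Es" "subspace Eu" by (auto simp: Es_def Eu_def subspace_def)
    have "((1, 0), 0) \<in> Es" "((0, 1), 0) \<in> Eu" by (auto simp: Es_def Eu_def)
    then show "Es \<noteq> {0}" "Eu \<noteq> {0}" by (auto simp: zero_prod_def)
    show "Es \<inter> Eu = {0}" by (auto simp: Es_def Eu_def prod_eq_iff)
    have "x \<in> {v + w |v w. v \<in> Es \<and> w \<in> Eu}" for x
      by (rule CollectI, rule exI[of _ "((fst (fst x), 0), 0)"], rule exI[of _ "((0, snd (fst x)), snd x)"])
        (auto simp: Es_def Eu_def prod_eq_iff)
    then show "{v + w |v w. v \<in> Es \<and> w \<in> Eu} = UNIV" by blast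
    show "diag a b c ` Es \<subseteq> Es" by (auto simp: Es_def diag_def)
    have "x \<in> diag a b c ` Eu" if "x \<in> Eu" for x
      by (rule image_eqI[of _ _ "((0, snd (fst x) / b), snd x / c)"])
        (use that b c in \<open>auto simp: Eu_def diag_def prod_eq_iff\<close>)
    then show "diag a b c ` Eu = Eu" by (auto simp: Eu_def diag_def)
    fix v n
    show "norm ((diag a b c ^^ n) v) \<le> 1 * \<theta> ^ n * norm v" if "v \<in> Es"
    proof -
      have "\<bar>a\<bar> ^ n * \<bar>fst (fst v)\<bar> \<le> \<theta> ^ n * \<bar>fst (fst v)\<bar>"
        using th(1) by (intro mult_right_mono power_mono) auto
      then show ?thesis using that unfolding diag_power
        by (cases v) (auto simp: diag_def Es_def norm_Pair abs_mult power_abs)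
    qed
    show "norm v \<le> 1 * \<theta> ^ n * norm ((diag a b c ^^ n) v)" if "v \<in> Eu"
    proof -
      define u x where "u = snd (fst v)" and "x = snd v"
      have v: "v = ((0, u), x)" using that by (simp add: Eu_def prod_eq_iff u_def x_def)
      have "norm v = sqrt (\<bar>u\<bar>\<^sup>2 + \<bar>x\<bar>\<^sup>2)" by (simp add: v norm_Pair)
      also have "\<dots> \<le> sqrt ((\<theta> ^ n * \<bar>b ^ n * u\<bar>)\<^sup>2 + (\<theta> ^ n * \<bar>c ^ n * x\<bar>)\<^sup>2)"
        using ge[OF th(2) b, of u n] ge[OF th(3) c, of x n]
        by (intro real_sqrt_le_mono add_mono power_mono) auto
      also have "\<dots> = sqrt ((\<theta> ^ n)\<^sup>2 * (\<bar>b ^ n * u\<bar>\<^sup>2 + \<bar>c ^ n * x\<bar>\<^sup>2))"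
        by (simp add: power_mult_distrib distrib_left)
      also have "\<dots> = \<theta> ^ n * norm ((diag a b c ^^ n) v)"
        using th0 unfolding diag_power by (simp add: real_sqrt_mult v diag_def norm_Pair)
      finally show ?thesis by simp
    qed
  qed (use th0 th1 in auto)
qed

lemma dist_triple_le:
  fixes a b c a' b' c' :: real
  shows "dist ((a, b), c) ((a', b'), c') \<le> \<bar>a - a'\<bar> + \<bar>b - b'\<bar> + \<bar>c - c'\<bar>"
proof -
  have 1: "dist (a, b) (a', b') \<le> \<bar>a - a'\<bar> + \<bar>b - b'\<bar>"
    using sqrt_sum_squares_le_sum_abs[of "dist a a'" "dist b b'"] by (simp add: dist_Pair_Pair dist_real_def)
  have "dist ((a, b), c) ((a', b'), c') \<le> dist (a, b) (a', b') + \<bar>c - c'\<bar>"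
    using sqrt_sum_squares_le_sum_abs[of "dist (a, b) (a', b')" "dist c c'"]
    by (simp add: dist_Pair_Pair[of "(a, b)"] dist_real_def[of c])
  with 1 show ?thesis by linarith
qed

section \<open>Iterated images and the maximal invariant set\<close>

lemma power_image_nonneg:
  "((\<lambda>T. F ` (T \<inter> D)) ^^ n) S = {X. \<exists>Z\<in>S. (\<forall>k<n. (F ^^ k) Z \<in> D) \<and> (F ^^ n) Z = X}"
proof (induction n)
  case (Suc n)
  show ?case
    by (simp add: Suc) (auto simp: less_Suc_eq image_iff)
qed auto

lemma power_image_neg:
  "((\<lambda>T. {X \<in> D. F X \<in> T}) ^^ n) S = {X. (\<forall>k<n. (F ^^ k) X \<in> D) \<and> (F ^^ n) X \<in> S}"
proof (induction n)
  case (Suc n)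
  have "(\<forall>k<Suc n. (F ^^ k) X \<in> D) \<longleftrightarrow> X \<in> D \<and> (\<forall>k<n. (F ^^ k) (F X) \<in> D)" for X
    by (auto simp: less_Suc_eq_0_disj funpow_swap1)
  then show ?case by (auto simp: Suc funpow_swap1)
qed auto

lemma funpow_inj_on_orbits:
  assumes "inj_on F D" "\<And>k. k < n \<Longrightarrow> (F ^^ k) X \<in> D" "\<And>k. k < n \<Longrightarrow> (F ^^ k) Y \<in> D"
    "(F ^^ n) X = (F ^^ n) Y"
  shows "X = Y"
  using assms(2-)
proof (induction n)
  case (Suc n)
  then have "(F ^^ n) X = (F ^^ n) Y" using inj_onD[OF assms(1)] by simp
  then show ?case using Suc by simp
qed simp

lemma backward_orbit_pow:
  assumes "backward_orbit D F b"
  shows "k \<le> n \<Longrightarrow> (F ^^ k) (b n) = b (n - k)"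
proof (induction k)
  case (Suc k)
  then have "(F ^^ Suc k) (b n) = F (b (Suc (n - Suc k)))" by (simp add: Suc_diff_Suc)
  then show ?case using assms by (simp add: backward_orbit_def)
qed simp

text \<open>The forward images provide an \<open>n\<close>-th preimage of \<open>X\<close> for each
  \<open>n\<close> separately; injectivity forces these finite histories to fit together into one
  backward orbit.\<close>

lemma max_invariant_iff:
  assumes inj: "inj_on F D" and D: "D \<subseteq> C"
  shows "X \<in> max_invariant D F C \<longleftrightarrow>
    (\<forall>n. (F ^^ n) X \<in> D) \<and> (\<exists>b. backward_orbit D F b \<and> b 0 = X)"
proof
  assume X: "X \<in> max_invariant D F C"
  have "(F ^^ n) X \<in> D" for n
  proof -
    \<comment> \<open>Order \<open>Suc n\<close>, because the preimage of order \<open>n\<close>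
      only places the iterates before \<open>n\<close> in \<open>D\<close>.\<close>
    have "X \<in> power_image D F (- int (Suc n)) C" using X by (auto simp: max_invariant_def)
    then have "X \<in> ((\<lambda>T. {X \<in> D. F X \<in> T}) ^^ Suc n) C"
      by (simp add: power_image_def nat_add_distrib del: funpow.simps)
    then show ?thesis unfolding power_image_neg by blast
  qed
  moreover have "\<exists>Z. (\<forall>k<n. (F ^^ k) Z \<in> D) \<and> (F ^^ n) Z = X" for n
  proof -
    have "X \<in> power_image D F (int n) C" using X by (auto simp: max_invariant_def)
    then have "X \<in> ((\<lambda>T. F ` (T \<inter> D)) ^^ n) C" by (simp add: power_image_def)
    then show ?thesis unfolding power_image_nonneg by blast
  qed
  then obtain b where b: "\<And>n. (\<forall>k<n. (F ^^ k) (b n) \<in> D) \<and> (F ^^ n) (b n) = X" by metis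
  have "F (b (Suc n)) = b n" for n
  proof (rule funpow_inj_on_orbits[OF inj, of n])
    show "(F ^^ k) (F (b (Suc n))) \<in> D" if "k < n" for k
      using b[of "Suc n"] that by (metis Suc_less_eq funpow_swap1 funpow_simps_right(2) comp_apply)
    show "(F ^^ n) (F (b (Suc n))) = (F ^^ n) (b n)"
      using b[of "Suc n"] b[of n] by (simp add: funpow_swap1)
  qed (use b in auto)
  moreover have "b (Suc n) \<in> D" for n using b[of "Suc n"] by (metis funpow_0 zero_less_Suc)
  ultimately show "(\<forall>n. (F ^^ n) X \<in> D) \<and> (\<exists>b. backward_orbit D F b \<and> b 0 = X)"
    using b[of 0] by (intro conjI exI[of _ b]) (auto simp: backward_orbit_def)
next
  assume "(\<forall>n. (F ^^ n) X \<in> D) \<and> (\<exists>b. backward_orbit D F b \<and> b 0 = X)"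
  then obtain b where X: "\<And>n. (F ^^ n) X \<in> D" and b: "backward_orbit D F b" "b 0 = X" by blast
  have bD: "b n \<in> D" for n using X[of 0] b by (cases n) (auto simp: backward_orbit_def)
  show "X \<in> max_invariant D F C"
    unfolding max_invariant_def
  proof
    fix i :: int
    show "X \<in> power_image D F i C"
    proof (cases "0 \<le> i")
      case True
      have "(F ^^ nat i) (b (nat i)) = X" "\<forall>k<nat i. (F ^^ k) (b (nat i)) \<in> D" "b (nat i) \<in> C"
        using backward_orbit_pow[OF b(1)] b(2) bD D by auto
      then show ?thesis using True by (auto simp: power_image_def power_image_nonneg)
    next
      case False
      then show ?thesis using X D by (auto simp: power_image_def power_image_neg)
    qed
  qed
qed

lemma closed_max_invariant:
  fixes F :: "'a::t2_space \<Rightarrow> 'a"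
  assumes F: "continuous_on D F" and D: "compact D" and C: "closed C" "compact C"
  shows "closed (max_invariant D F C)"
proof -
  have "compact (((\<lambda>T. F ` (T \<inter> D)) ^^ n) C)" for n
  proof (induction n)
    case (Suc n)
    then have "compact (((\<lambda>T. F ` (T \<inter> D)) ^^ n) C \<inter> D)"
      using D by (intro compact_Int_closed compact_imp_closed)
    then show ?case
      using compact_continuous_image[OF continuous_on_subset[OF F]] by simp
  qed (use C in simp)
  moreover have "closed (((\<lambda>T. {X \<in> D. F X \<in> T}) ^^ n) C)" for n
  proof (induction n)
    case (Suc n)
    have "{X \<in> D. F X \<in> T} = D \<inter> F -` T" for T by auto
    then show ?case
      using continuous_closed_preimage[OF F compact_imp_closed[OF D] Suc] by simp
  qed (use C in simp)
  ultimately show ?thesis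
    unfolding max_invariant_def power_image_def
    by (intro closed_INT) (auto intro: compact_imp_closed)
qed

section \<open>The dynamics of the skew product\<close>

context porcupine
begin

section \<open>Injectivity, compactness and continuity for the skew product\<close>

abbreviation F where "F \<equiv> skew_product \<Phi> R f"
abbreviation D where "D \<equiv> skew_domain R"

lemma R_unique: "i < 3 \<Longrightarrow> j < 3 \<Longrightarrow> y \<in> R i \<Longrightarrow> y \<in> R j \<Longrightarrow> i = j"
  using disjoint by blast

lemma F_eq: "i < 3 \<Longrightarrow> fst X \<in> R i \<Longrightarrow> F X = (\<Phi> (fst X), f i (snd X))"
proof -
  assume i: "i < 3" "fst X \<in> R i"
  have "(THE j. j < 3 \<and> fst X \<in> R j) = i" 
    by (rule the_equality) (use i R_unique[OF i(1) _ i(2)] in blast)+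
  then show ?thesis by (simp add: skew_product_def case_prod_beta)
qed

lemma D_iff: "X \<in> D \<longleftrightarrow> (\<exists>i<3. fst X \<in> R i) \<and> snd X \<in> {0..1}"
  by (cases X) (auto simp: skew_domain_def)

lemma fst_F: "X \<in> D \<Longrightarrow> fst (F X) = \<Phi> (fst X)"
  using F_eq unfolding D_iff by (metis fst_conv)

lemma F_inj: "inj_on F D"
proof (rule inj_onI)
  fix X Y assume X: "X \<in> D" and Y: "Y \<in> D" and eq: "F X = F Y"
  have "\<Phi> (fst X) = \<Phi> (fst Y)" using fst_F[OF X] fst_F[OF Y] eq by simp
  then have 1: "fst X = fst Y" using Phi_bij by (metis bij_pointE)
  obtain i where i: "i < 3" "fst X \<in> R i" using X by (auto simp: D_iff)
  then have "f i (snd X) = f i (snd Y)" using F_eq[of i X] F_eq[of i Y] eq 1 by simp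
  then have "snd X = snd Y" using fiber_maps[OF i(1)] X Y by (auto simp: D_iff inj_on_def)
  with 1 show "X = Y" by (simp add: prod_eq_iff)
qed

lemma D_Union: "D = (\<Union>i\<in>{..<3}. R i \<times> {0..1})"
  by (auto simp: skew_domain_def)

lemma R_compact: "i < 3 \<Longrightarrow> compact (R i)"
  using rectangles[of i] by (auto intro!: compact_Times)

lemma D_compact: "compact D"
  unfolding D_Union by (intro compact_UN compact_Times R_compact) auto

lemma D_cube: "D \<subseteq> unit_cube"
proof
  fix X assume X: "X \<in> D"
  then obtain i where "i < 3" "fst X \<in> R i" by (auto simp: D_iff)
  then have "fst (fst X) \<in> {0..1} \<and> snd (fst X) \<in> {0..1}" by (rule R_unit)
  then show "X \<in> unit_cube" using X by (cases X) (auto simp: unit_cube_def D_iff mem_Times_iff)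
qed

lemma F_continuous: "continuous_on D F"
  unfolding D_Union
proof (rule continuous_on_closed_Union)
  fix i :: nat assume i: "i \<in> {..<3}"
  show "closed (R i \<times> {0..1::real})"
    using i R_compact by (intro closed_Times compact_imp_closed) auto
  have "C1_map \<Phi>" using diffeo by (simp add: diffeomorphism_def)
  then have "continuous_on UNIV \<Phi>"
    unfolding C1_map_def by (blast intro: continuous_at_imp_continuous_on has_derivative_continuous)
  then have "continuous_on (R i \<times> {0..1}) (\<lambda>X. \<Phi> (fst X))"
    by (rule continuous_on_compose2) (auto intro: continuous_intros)
  moreover have "continuous_on (R i \<times> {0..1}) (\<lambda>X. f i (snd X))"
    by (rule continuous_on_compose2[OF f_continuous]) (use i in \<open>auto intro: continuous_intros\<close>)
  ultimately have "continuous_on (R i \<times> {0..1}) (\<lambda>X. (\<Phi> (fst X), f i (snd X)))"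
    by (rule continuous_on_Pair)
  then show "continuous_on (R i \<times> {0..1}) F"
    by (rule continuous_on_eq) (use F_eq i in \<open>simp add: mem_Times_iff\<close>)
qed simp

section \<open>Words acting on the hull\<close>

lemma fold_B_Is: "word v \<Longrightarrow> s \<in> Is \<Longrightarrow> fold B v s \<in> Is"
  by (induction v arbitrary: s) (use B_Is in auto)

lemma foldr_A_Iu: "word v \<Longrightarrow> u \<in> Iu \<Longrightarrow> foldr A v u \<in> Iu"
  by (induction v) (use A_Iu in auto)

lemma fold_B_contraction: "word v \<Longrightarrow> \<bar>fold B v s - fold B v t\<bar> \<le> rate ^ length v * \<bar>s - t\<bar>"
proof (induction v arbitrary: s t)
  case (Cons i v)
  have "\<bar>fold B v (B i s) - fold B v (B i t)\<bar> \<le> rate ^ length v * \<bar>B i s - B i t\<bar>"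
    using Cons by simp
  also have "\<dots> \<le> rate ^ length v * (rate * \<bar>s - t\<bar>)"
    using B_contraction[of i s t] Cons.prems rate_bounds by (intro mult_left_mono) auto
  finally show ?case by (simp add: mult_ac)
qed simp

lemma foldr_A_contraction: "word v \<Longrightarrow> \<bar>foldr A v s - foldr A v t\<bar> \<le> rate ^ length v * \<bar>s - t\<bar>"
proof (induction v)
  case (Cons i v)
  have "\<bar>A i (foldr A v s) - A i (foldr A v t)\<bar> \<le> rate * \<bar>foldr A v s - foldr A v t\<bar>"
    using A_contraction Cons.prems by simp
  also have "\<dots> \<le> rate * (rate ^ length v * \<bar>s - t\<bar>)"
    using Cons rate_bounds by (intro mult_left_mono) auto
  finally show ?case by (simp add: mult_ac)
qed simp

text \<open>Prescribing the future through the second coordinate makes the orbit follow the word.\<close>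

lemma word_orbit:
  assumes "word v" "s \<in> Is" "u \<in> Iu" "x \<in> {0..1}"
  shows word_orbit_end: "(F ^^ length v) ((s, foldr A v u), x) = ((fold B v s, u), fold f v x)"
    and word_orbit_in_D: "k < length v \<Longrightarrow> (F ^^ k) ((s, foldr A v u), x) \<in> D"
proof -
  have "(F ^^ length v) ((s, foldr A v u), x) = ((fold B v s, u), fold f v x) \<and>
      (\<forall>k<length v. (F ^^ k) ((s, foldr A v u), x) \<in> D)"
    using assms
  proof (induction v arbitrary: s x)
    case (Cons i v)
    let ?u = "foldr A v u"
    have u: "?u \<in> Iu" using foldr_A_Iu Cons.prems by simp
    have i: "i < 3" and R: "(s, A i ?u) \<in> R i" using A_R[OF _ u] Cons.prems by auto
    have FX: "F ((s, foldr A (i # v) u), x) = ((B i s, ?u), f i x)"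
      using F_eq[OF i, of "((s, A i ?u), x)"] R Phi_A[OF i u Cons.prems(2)] by simp
    have IH: "(F ^^ length v) ((B i s, ?u), f i x) = ((fold B v (B i s), u), fold f v (f i x)) \<and>
      (\<forall>k<length v. (F ^^ k) ((B i s, ?u), f i x) \<in> D)"
      by (rule Cons.IH) (use Cons.prems B_Is f_unit in auto)
    have "((s, foldr A (i # v) u), x) \<in> D" using R i Cons.prems by (auto simp: D_iff)
    then have "\<forall>k<Suc (length v). (F ^^ k) ((s, foldr A (i # v) u), x) \<in> D"
      using IH by (auto simp: less_Suc_eq_0_disj funpow_swap1 FX simp del: foldr.simps)
    then show ?case using IH by (simp add: funpow_swap1 FX del: foldr.simps)
  qed simp
  then show "(F ^^ length v) ((s, foldr A v u), x) = ((fold B v s, u), fold f v x)"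
    "k < length v \<Longrightarrow> (F ^^ k) ((s, foldr A v u), x) \<in> D" by auto
qed

section \<open>Cylinder neighbourhoods in the maximal invariant set\<close>

abbreviation \<Lambda> where "\<Lambda> \<equiv> max_invariant D F unit_cube"

lemmas Lambda_iff = max_invariant_iff[OF F_inj D_cube]

lemma closed_Lambda: "closed \<Lambda>"
proof (rule closed_max_invariant[OF F_continuous D_compact])
  show "compact unit_cube" by (auto simp: unit_cube_def intro: compact_Times)
  then show "closed unit_cube" by (rule compact_imp_closed)
qed

lemma Is_Iu_unit: "Is \<subseteq> {0..1}" "Iu \<subseteq> {0..1}"
  using hull_subset_interval[of "fst ` \<Gamma>" 0 1] hull_subset_interval[of "snd ` \<Gamma>" 0 1] Gamma_ne Gamma_unit
  unfolding Is_def Iu_def by blast+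

lemma Lambda_base: "X \<in> \<Lambda> \<Longrightarrow> fst X \<in> \<Gamma>"
proof -
  assume "X \<in> \<Lambda>"
  then obtain b where fw: "\<And>n. (F ^^ n) X \<in> D" and b: "backward_orbit D F b" "b 0 = X"
    unfolding Lambda_iff by blast
  have bD: "b n \<in> D" for n using b fw[of 0] by (cases n) (auto simp: backward_orbit_def)
  have "(\<Phi> ^^ n) (fst X) = fst ((F ^^ n) X)" for n
    by (induction n) (use fst_F fw in auto)
  moreover have "(inv \<Phi> ^^ n) (fst X) = fst (b n)" for n
  proof (induction n)
    case (Suc n)
    have "fst (b n) = \<Phi> (fst (b (Suc n)))" using b fst_F[OF bD] by (metis backward_orbit_def)
    then show ?case using Suc by simp
  qed (use b in simp)
  ultimately show ?thesis unfolding horseshoe using fw bD by (simp add: D_iff) blast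
qed

lemma forward_word: "y \<in> \<Gamma> \<Longrightarrow> \<exists>\<beta>. word \<beta> \<and> length \<beta> = n \<and> (\<exists>u\<in>Iu. snd y = foldr A \<beta> u)"
proof (induction n arbitrary: y)
  case 0 then show ?case using Gamma_Iu[of y] by auto
next
  case (Suc n)
  obtain \<beta> u where \<beta>: "word \<beta>" "length \<beta> = n" "u \<in> Iu" "snd (\<Phi> y) = foldr A \<beta> u"
    using Suc.IH[OF Gamma_Phi[OF Suc.prems]] by blast
  have "snd y = A (code y 0) (snd (\<Phi> y))" using snd_Phi_R Gamma_in_R[OF Suc.prems] by blast
  then show ?case using \<beta> Gamma_in_R[OF Suc.prems] by (intro exI[of _ "code y 0 # \<beta>"]) auto
qed

lemma backward_word:
  assumes b: "backward_orbit D F b" and G: "fst (b 0) \<in> \<Gamma>" and b0: "b 0 \<in> D"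
  shows "\<exists>v. word v \<and> length v = n \<and> (\<exists>s\<in>Is. \<exists>x\<in>{0..1}. fst (fst (b 0)) = fold B v s \<and> snd (b 0) = fold f v x)"
proof -
  have bD: "b n \<in> D" for n using b b0 by (cases n) (auto simp: backward_orbit_def)
  have bG: "fst (b n) \<in> \<Gamma>" for n
  proof (induction n)
    case (Suc n)
    have "fst (b n) = \<Phi> (fst (b (Suc n)))" using b fst_F[OF bD] by (metis backward_orbit_def)
    then show ?case using Gamma_inv[OF Suc] by simp
  qed (rule G)
  have "\<exists>v. word v \<and> length v = n \<and> fst (fst (b 0)) = fold B v (fst (fst (b n))) \<and> snd (b 0) = fold f v (snd (b n))"
  proof (induction n)
    case (Suc n)
    then obtain v where v: "word v" "length v = n" "fst (fst (b 0)) = fold B v (fst (fst (b n)))"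
      "snd (b 0) = fold f v (snd (b n))" by blast
    obtain i where i: "i < 3" "fst (b (Suc n)) \<in> R i" using bD[of "Suc n"] by (auto simp: D_iff)
    have "b n = F (b (Suc n))" using b by (simp add: backward_orbit_def)
    then have "fst (fst (b n)) = B i (fst (fst (b (Suc n))))" "snd (b n) = f i (snd (b (Suc n)))"
      using F_eq[OF i] fst_Phi_R[OF i] by auto
    then show ?case using v i by (intro exI[of _ "i # v"]) auto
  qed simp
  moreover have "snd (b n) \<in> {0..1}" using bD[of n] by (simp add: D_iff)
  ultimately show ?thesis using Gamma_Is[OF bG[of n]] by blast
qed

text \<open>\<open>v\<close> is the recent past and \<open>\<beta>\<close> the near future of
  \<open>X\<close>; the fibre interval is taken at the start of \<open>v\<close> and carried along
  by continuity of \<open>fold f v\<close>. Rational ends make the cylinders countable, so that one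
  orbit can visit them all.\<close>

lemma Lambda_approx:
  assumes X: "X \<in> \<Lambda>" and e: "0 < \<epsilon>"
  obtains v \<beta> z1 z2 where "word v" "word \<beta>" "v \<noteq> []" "0 < real_of_rat z1" "z1 < z2" "real_of_rat z2 < 1"
    "\<And>s u z. s \<in> Is \<Longrightarrow> u \<in> Iu \<Longrightarrow> z \<in> {real_of_rat z1..real_of_rat z2} \<Longrightarrow>
      dist ((fold B v s, foldr A \<beta> u), fold f v z) X < \<epsilon>"
proof -
  obtain b where b: "backward_orbit D F b" "b 0 = X" and XD: "(F ^^ 0) X \<in> D"
    using X unfolding Lambda_iff by blast
  have G: "fst X \<in> \<Gamma>" by (rule Lambda_base[OF X])
  have "\<exists>n. rate ^ n < \<epsilon> / 3" using real_arch_pow_inv[of "\<epsilon> / 3" rate] e rate_bounds by simp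
  then obtain n where n: "rate ^ n < \<epsilon> / 3" by blast
  have "rate * rate ^ n \<le> 1 * rate ^ n" using rate_bounds by (intro mult_right_mono) auto
  then have n': "rate ^ Suc n < \<epsilon> / 3" using n by simp
  have G0: "fst (b 0) \<in> \<Gamma>" "b 0 \<in> D" using G XD b(2) by simp_all
  obtain v s0 x0 where v: "word v" "length v = Suc n" "s0 \<in> Is" "x0 \<in> {0..1}"
    "fst (fst X) = fold B v s0" "snd X = fold f v x0"
    using backward_word[OF b(1) G0, of "Suc n", unfolded b(2)] by blast
  obtain \<beta> u0 where \<beta>: "word \<beta>" "length \<beta> = Suc n" "u0 \<in> Iu" "snd (fst X) = foldr A \<beta> u0"
    using forward_word[OF G, of "Suc n"] by blast
  have "\<forall>e>0. \<exists>d>0. \<forall>z\<in>{0..1}. dist z x0 < d \<longrightarrow> dist (fold f v z) (fold f v x0) < e"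
    using word_continuous[OF v(1)] v(4) unfolding continuous_on_iff by blast
  moreover have "0 < \<epsilon> / 3" using e by simp
  ultimately obtain d where d: "d > 0"
    "\<And>z. z \<in> {0..1} \<Longrightarrow> dist z x0 < d \<Longrightarrow> dist (fold f v z) (fold f v x0) < \<epsilon> / 3" by blast
  \<comment> \<open>\<open>x0\<close> may be \<open>0\<close> or \<open>1\<close>; the interval is
    chosen beside it inside the open fibre, which words map into itself.\<close>
  have "max 0 (x0 - d) < min 1 (x0 + d)" using d(1) v(4) by auto
  then obtain z2 where z2: "max 0 (x0 - d) < real_of_rat z2" "real_of_rat z2 < min 1 (x0 + d)"
    using of_rat_dense by blast
  obtain z1 where z1: "max 0 (x0 - d) < real_of_rat z1" "real_of_rat z1 < real_of_rat z2"
    using of_rat_dense[OF z2(1)] by blast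
  show ?thesis
  proof (rule that[of v \<beta> z1 z2])
    fix s u z assume s: "s \<in> Is" and u: "u \<in> Iu" and z: "z \<in> {real_of_rat z1..real_of_rat z2}"
    have le1: "\<bar>p - q\<bar> \<le> 1" if "p \<in> {0..1}" "q \<in> {0..1}" for p q :: real using that by auto
    have su: "\<bar>s - s0\<bar> \<le> 1" "\<bar>u - u0\<bar> \<le> 1"
      by (rule le1; use s u v(3) \<beta>(3) Is_Iu_unit in blast)+
    have "\<bar>fold B v s - fold B v s0\<bar> \<le> rate ^ Suc n * \<bar>s - s0\<bar>"
      using fold_B_contraction[OF v(1), of s s0] v(2) by simp
    also have "\<dots> \<le> rate ^ Suc n * 1"
      using su(1) rate_bounds by (intro mult_left_mono zero_le_power) auto
    finally have 1: "\<bar>fold B v s - fold B v s0\<bar> < \<epsilon> / 3" using n' by linarith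
    have "\<bar>foldr A \<beta> u - foldr A \<beta> u0\<bar> \<le> rate ^ Suc n * \<bar>u - u0\<bar>"
      using foldr_A_contraction[OF \<beta>(1), of u u0] \<beta>(2) by simp
    also have "\<dots> \<le> rate ^ Suc n * 1"
      using su(2) rate_bounds by (intro mult_left_mono zero_le_power) auto
    finally have 2: "\<bar>foldr A \<beta> u - foldr A \<beta> u0\<bar> < \<epsilon> / 3" using n' by linarith
    have "max 0 (x0 - d) < z" using z z1(1) by (meson atLeastAtMost_iff less_le_trans)
    moreover have "z < min 1 (x0 + d)" using z z2(2) by (meson atLeastAtMost_iff le_less_trans)
    ultimately have "z \<in> {0..1}" "dist z x0 < d" by (auto simp: dist_real_def abs_less_iff)
    from d(2)[OF this] have 3: "\<bar>fold f v z - fold f v x0\<bar> < \<epsilon> / 3" by (simp add: dist_real_def)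
    have Xeq: "X = ((fold B v s0, foldr A \<beta> u0), fold f v x0)" using v \<beta> by (simp add: prod_eq_iff)
    have "dist ((fold B v s, foldr A \<beta> u), fold f v z) X
        \<le> \<bar>fold B v s - fold B v s0\<bar> + \<bar>foldr A \<beta> u - foldr A \<beta> u0\<bar> + \<bar>fold f v z - fold f v x0\<bar>"
      unfolding Xeq by (rule dist_triple_le)
    then show "dist ((fold B v s, foldr A \<beta> u), fold f v z) X < \<epsilon>" using 1 2 3 by linarith
  next
    show "v \<noteq> []" using v(2) by auto
  qed (use v(1) \<beta>(1) z1 z2 in \<open>simp_all add: of_rat_less\<close>)
qed

section \<open>Derivatives along words\<close>

lemma F_has_derivative:
  assumes i: "i < 3" and X: "fst X \<in> R i" "snd X \<in> {0..1}"
  shows "(F has_derivative diag (cs i) (cu i) (f' i (snd X))) (at X within D)"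
proof -
  let ?S = "R i \<times> {0..1::real}"
  \<comment> \<open>The boxes are compact and pairwise disjoint, so near \<open>X\<close> the domain
    is the single box \<open>?S\<close>.\<close>
  define O' where "O' = - (\<Union>j\<in>{..<3} - {i}. R j \<times> {0..1::real})"
  have "open O'"
    unfolding O'_def by (intro open_Compl closed_UN ballI closed_Times compact_imp_closed R_compact) auto
  moreover have "X \<in> O'" using R_unique[OF i _ X(1)] by (cases X) (auto simp: O'_def)
  moreover have "D \<inter> O' - {X} = ?S \<inter> O' - {X}"
    unfolding D_Union O'_def using i by blast
  ultimately have at: "at X within D = at X within ?S" by (intro at_within_nhd)
  have "(f i has_derivative (\<lambda>h. f' i (snd X) * h)) (at (snd X) within {0..1})"
    using fiber_derivative[OF i X(2)] by (simp add: has_field_derivative_def)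
  then have "(f i has_derivative (\<lambda>h. f' i (snd X) * h)) (at (snd X) within snd ` ?S)"
    by (rule has_derivative_subset) auto
  then have fi: "((\<lambda>Z. f i (snd Z)) has_derivative (\<lambda>h. f' i (snd X) * snd h)) (at X within ?S)"
    by (rule has_derivative_in_compose[rotated]) (auto intro!: derivative_eq_intros)
  have "((\<lambda>Z. ((cs i * fst (fst Z) + fst (offset i), cu i * snd (fst Z) + snd (offset i)), f i (snd Z)))
      has_derivative diag (cs i) (cu i) (f' i (snd X))) (at X within ?S)"
    unfolding diag_def by (intro has_derivative_Pair fi) (auto intro!: derivative_eq_intros)
  then have "(F has_derivative diag (cs i) (cu i) (f' i (snd X))) (at X within ?S)"
  proof (rule has_derivative_transform_within[of _ _ _ _ 1])
    show "X \<in> ?S" using X by (cases X) auto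
    fix Z assume "Z \<in> ?S"
    then have "fst Z \<in> R i" by auto
    then show "((cs i * fst (fst Z) + fst (offset i), cu i * snd (fst Z) + snd (offset i)), f i (snd Z)) = F Z"
      using F_eq[OF i] Phi_R[OF i] by (simp add: B_def)
  qed simp
  then show ?thesis by (simp add: at)
qed

text \<open>Every letter has a diagonal derivative, so the chain rule multiplies entries. The last
  entry is the fibre derivative of the word, the quantity controlled by the choice of
  \<open>q\<close>.\<close>

lemma word_has_derivative:
  assumes "word v" "s \<in> Is" "u \<in> Iu" "x \<in> {0..1}"
  shows "\<exists>a b c. \<bar>a\<bar> \<le> rate ^ length v \<and> 1 \<le> \<bar>b\<bar> * rate ^ length v \<and>
    (fold f v has_real_derivative c) (at x within {0..1}) \<and>
    ((F ^^ length v) has_derivative diag a b c)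
      (at ((s, foldr A v u), x) within {X. \<forall>k<length v. (F ^^ k) X \<in> D})"
  using assms
proof (induction v arbitrary: s x)
  case Nil
  have "diag 1 1 1 = (\<lambda>v. v)" by (simp add: diag_def)
  moreover have "((\<lambda>x. x) has_real_derivative 1) (at x within {0..1})" by simp
  ultimately show ?case by (intro exI[of _ 1]) (auto simp: id_def)
next
  case (Cons i v)
  let ?n = "length v"
  let ?E = "\<lambda>n. {X. \<forall>k<n. (F ^^ k) X \<in> D}"
  let ?u = "foldr A v u"
  let ?X = "((s, foldr A (i # v) u), x)"
  have u: "?u \<in> Iu" using foldr_A_Iu Cons.prems by simp
  have i: "i < 3" and RX: "(s, A i ?u) \<in> R i" using A_R[OF _ u] Cons.prems by auto
  have FX: "F ?X = ((B i s, ?u), f i x)"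
    using F_eq[OF i, of "((s, A i ?u), x)"] RX Phi_A[OF i u Cons.prems(2)] by simp
  obtain a b c where abc: "\<bar>a\<bar> \<le> rate ^ ?n" "1 \<le> \<bar>b\<bar> * rate ^ ?n"
    "(fold f v has_real_derivative c) (at (f i x) within {0..1})"
    "((F ^^ ?n) has_derivative diag a b c) (at ((B i s, ?u), f i x) within ?E ?n)"
    using Cons.IH[of "B i s" "f i x"] Cons.prems B_Is f_unit by auto
  have sub: "?E (Suc ?n) \<subseteq> D" by force
  have "(F has_derivative diag (cs i) (cu i) (f' i x)) (at ?X within ?E (Suc ?n))"
    by (rule has_derivative_subset[OF _ sub]) (use F_has_derivative[OF i, of ?X] RX Cons.prems in simp)
  moreover have "F ` ?E (Suc ?n) \<subseteq> ?E ?n"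
    by (auto simp: less_Suc_eq_0_disj funpow_swap1)
  then have "((F ^^ ?n) has_derivative diag a b c) (at (F ?X) within F ` ?E (Suc ?n))"
    unfolding FX using abc(4) by (rule has_derivative_subset[rotated])
  ultimately have "((\<lambda>Z. (F ^^ ?n) (F Z)) has_derivative (\<lambda>h. diag a b c (diag (cs i) (cu i) (f' i x) h)))
      (at ?X within ?E (Suc ?n))" by (rule has_derivative_in_compose)
  moreover have "(\<lambda>Z. (F ^^ ?n) (F Z)) = F ^^ Suc ?n" by (simp add: fun_eq_iff funpow_swap1)
  moreover have "(\<lambda>h. diag a b c (diag (cs i) (cu i) (f' i x) h)) = diag (a * cs i) (b * cu i) (c * f' i x)"
    by (simp add: diag_def mult.assoc)
  ultimately have "((F ^^ length (i # v)) has_derivative diag (a * cs i) (b * cu i) (c * f' i x))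
      (at ?X within ?E (length (i # v)))" by simp
  moreover have "(fold f (i # v) has_real_derivative c * f' i x) (at x within {0..1})"
  proof -
    have "(fold f v \<circ> f i has_real_derivative c * f' i x) (at x within {0..1})"
      by (rule DERIV_image_chain[OF DERIV_subset[OF abc(3)] fiber_derivative])
        (use Cons.prems f_unit in auto)
    then show ?thesis by (simp add: comp_def)
  qed
  moreover have "\<bar>a * cs i\<bar> \<le> rate ^ length (i # v)"
    using mult_mono[OF abc(1) rate_bounds(1)[OF i]] rate_bounds by (simp add: abs_mult mult.commute)
  moreover have "1 \<le> \<bar>b * cu i\<bar> * rate ^ length (i # v)"
  proof -
    have "1 \<le> \<bar>cu i\<bar> * rate" using rate_bounds(2)[OF i] cu_nz[OF i] by (simp add: pos_divide_le_eq mult.commute)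
    then have "1 * 1 \<le> (\<bar>b\<bar> * rate ^ ?n) * (\<bar>cu i\<bar> * rate)" using abc(2) by (intro mult_mono) auto
    then show ?thesis by (simp add: abs_mult mult_ac)
  qed
  ultimately show ?case by blast
qed

end

section \<open>Homoclinic points and transitivity\<close>

text \<open>The orbit of \<open>Q\<close> has itinerary \<open>w\<close> repeated: its base
  coordinates are the fixed points of the two contractions attached to \<open>w\<close>, and
  \<open>1 < \<bar>d\<bar>\<close> makes the fibre an unstable direction.\<close>

locale porcupine_saddle = porcupine +
  fixes w :: "nat list" and q d sQ uQ :: real
  assumes w: "set w \<subseteq> {..<3}" "w \<noteq> []"
    and q: "0 < q" "q < 1" "fold f w q = q"
    and d: "(fold f w has_real_derivative d) (at q within {0..1})" "1 < \<bar>d\<bar>"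
    and sQ: "sQ \<in> Is" "fold B w sQ = sQ"
    and uQ: "uQ \<in> Iu" "foldr A w uQ = uQ"
begin

abbreviation P :: nat where "P \<equiv> length w"
abbreviation Q :: "(real \<times> real) \<times> real" where "Q \<equiv> ((sQ, uQ), q)"

lemma Q_period: "(F ^^ P) Q = Q" "0 < P"
  using word_orbit_end[OF w(1) sQ(1) uQ(1), of q] w(2) q sQ uQ by simp_all

lemma Q_multiple_period: "(F ^^ (n * P)) Q = Q"
proof (induction n)
  case (Suc n)
  have "(F ^^ (P + n * P)) Q = (F ^^ P) ((F ^^ (n * P)) Q)" by (simp only: funpow_add comp_apply)
  then show ?case using Suc Q_period by simp
qed simp

lemma Q_in_D: "(F ^^ k) Q \<in> D"
proof -
  have "(F ^^ (k mod P + (k div P) * P)) Q = (F ^^ (k mod P)) ((F ^^ ((k div P) * P)) Q)"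
    by (simp only: funpow_add comp_apply)
  then have "(F ^^ k) Q = (F ^^ (k mod P)) Q" by (simp add: Q_multiple_period)
  then show ?thesis
    using word_orbit_in_D[OF w(1) sQ(1) uQ(1), of q "k mod P"] Q_period uQ q by simp
qed

lemma rate_pow_P: "rate ^ P < 1"
  using power_less_one_iff[OF rate_bounds(3), of P] rate_bounds(4) Q_period(2) by simp

lemma Q_saddle: "periodic_saddle D F Q"
proof -
  obtain a b c where abc: "\<bar>a\<bar> \<le> rate ^ P" "1 \<le> \<bar>b\<bar> * rate ^ P"
    "(fold f w has_real_derivative c) (at q within {0..1})"
    "((F ^^ P) has_derivative diag a b c) (at ((sQ, foldr A w uQ), q) within {X. \<forall>k<P. (F ^^ k) X \<in> D})"
    using word_has_derivative[OF w(1) sQ(1) uQ(1), of q] q by auto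
  have "at q within {0..1} = at q" using q by (simp add: at_within_Icc_at)
  then have "c = d" using DERIV_unique[of "fold f w" c q d] abc(3) d(1) by simp
  moreover have "1 < \<bar>b\<bar>"
  proof (rule ccontr)
    assume "\<not> 1 < \<bar>b\<bar>"
    then have "\<bar>b\<bar> * rate ^ P \<le> 1 * rate ^ P" using rate_bounds by (intro mult_right_mono) auto
    then show False using abc(2) rate_pow_P by linarith
  qed
  ultimately have "linear_saddle (diag a b c)"
    using abc(1) rate_pow_P d(2) by (intro linear_saddle_diag) auto
  then show ?thesis
    unfolding periodic_saddle_def using Q_in_D Q_period abc(4) uQ(2) by (auto intro!: exI[of _ P])
qed

section \<open>Local and global invariant sets of \<open>Q\<close>\<close>

text \<open>Expansion relative to \<open>q\<close> and surjectivity onto the window give, by choice,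
  a right inverse \<open>h\<close> of the word map that contracts towards \<open>q\<close>; its
  iterates are the required history.\<close>

lemma local_unstable_fibre:
  obtains \<delta> where "0 < \<delta>" "0 < q - \<delta>" "q + \<delta> < 1"
    "\<And>x. x \<in> {q - \<delta>..q + \<delta>} \<Longrightarrow> \<exists>z. z 0 = x \<and> (\<forall>k. z k \<in> {0..1} \<and> fold f w (z (Suc k)) = z k) \<and> z \<longlonglongrightarrow> q"
proof -
  obtain \<kappa> where k: "1 < \<kappa>" "\<kappa> < \<bar>d\<bar>" using dense d(2) by blast
  let ?T = "fold f w"
  have "((\<lambda>y. (?T y - ?T q) / (y - q)) \<longlongrightarrow> d) (at q within {0..1})"
    using d(1) by (simp add: has_field_derivative_iff)
  \<comment> \<open>The factor \<open>sgn d\<close> turns the limit into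
    \<open>\<bar>d\<bar>\<close>, so that both orientations are treated together.\<close>
  then have "((\<lambda>y. sgn d * ((?T y - q) / (y - q))) \<longlongrightarrow> sgn d * d) (at q within {0..1})"
    unfolding q(3) by (rule tendsto_mult_left)
  then have "\<forall>\<^sub>F y in at q within {0..1}. \<kappa> < sgn d * ((?T y - q) / (y - q))"
    by (rule order_tendstoD) (use k in \<open>simp add: abs_sgn mult.commute\<close>)
  then obtain e where e: "e > 0"
    "\<And>y. y \<in> {0..1} \<Longrightarrow> y \<noteq> q \<Longrightarrow> dist y q < e \<Longrightarrow> \<kappa> < sgn d * ((?T y - q) / (y - q))"
    by (auto simp: eventually_at)
  define \<delta> where "\<delta> = min (e / 2) (min (q / 2) ((1 - q) / 2))"
  have del: "0 < \<delta>" "\<delta> < e" "\<delta> \<le> q / 2" "\<delta> \<le> (1 - q) / 2" 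
    using e(1) q min.cobounded1[of "e / 2"] min.cobounded2[of "e / 2" "min (q / 2) ((1 - q) / 2)"]
    unfolding \<delta>_def by (simp_all only: min_def split: if_splits) auto
  have "0 < q - \<delta>" using del q by linarith
  moreover have "q + \<delta> < 1"
  proof -
    have "2 * \<delta> \<le> 1 - q" using del(4) by simp
    then show ?thesis using q(2) by linarith
  qed
  ultimately have del': "0 < q - \<delta>" "q + \<delta> < 1" by auto
  let ?W = "{q - \<delta>..q + \<delta>}"
  have exp: "\<kappa> * \<bar>y - q\<bar> \<le> \<bar>?T y - q\<bar>" if "y \<in> ?W" for y
  proof (cases "y = q")
    case False
    have "\<kappa> < sgn d * ((?T y - q) / (y - q))"
      by (rule e(2)) (use that False del del' in \<open>auto simp: dist_real_def abs_if\<close>)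
    also have "\<dots> \<le> \<bar>sgn d\<bar> * \<bar>(?T y - q) / (y - q)\<bar>" using abs_ge_self[of "sgn d * ((?T y - q) / (y - q))"] by (simp only: abs_mult)
    also have "\<dots> = \<bar>?T y - q\<bar> / \<bar>y - q\<bar>" 
    proof -
      have "d \<noteq> 0" using d(2) by auto
      then show ?thesis by (simp add: abs_divide abs_sgn_eq)
    qed
    finally show ?thesis using False by (simp add: pos_less_divide_eq)
  qed simp
  have ends: "\<kappa> * \<delta> < sgn d * (?T (q + \<delta>) - q)" "\<kappa> * \<delta> < - (sgn d * (?T (q - \<delta>) - q))"
  proof -
    have "\<kappa> < sgn d * ((?T (q + \<delta>) - q) / \<delta>)"
      using e(2)[of "q + \<delta>"] del del' q by (simp add: dist_real_def)
    then show "\<kappa> * \<delta> < sgn d * (?T (q + \<delta>) - q)" using del by (simp add: pos_less_divide_eq)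
    have "\<kappa> < sgn d * ((?T (q - \<delta>) - q) / (- \<delta>))"
      using e(2)[of "q - \<delta>"] del del' q by (simp add: dist_real_def)
    then have "\<kappa> < - (sgn d * (?T (q - \<delta>) - q)) / \<delta>" by simp
    then show "\<kappa> * \<delta> < - (sgn d * (?T (q - \<delta>) - q))" using del by (simp only: pos_less_divide_eq)
  qed
  have kd: "\<delta> < \<kappa> * \<delta>" using k del by simp
  have sur: "\<exists>y\<in>?W. ?T y = x" if "x \<in> ?W" for x
  proof (rule word_ivt[OF w(1)])
    have "sgn d = 1 \<or> sgn d = -1"
      using d(2) by (cases d "0 :: real" rule: linorder_cases) auto
    then consider "sgn d = 1" | "sgn d = -1" by blast
    then show "?T (q - \<delta>) \<le> x \<and> x \<le> ?T (q + \<delta>) \<or> ?T (q + \<delta>) \<le> x \<and> x \<le> ?T (q - \<delta>)"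
    proof cases
      case 1 then show ?thesis using ends kd that by auto
    next
      case 2 then show ?thesis using ends kd that by auto
    qed
  qed (use del del' in auto)
  then obtain h where h: "\<And>x. x \<in> ?W \<Longrightarrow> h x \<in> ?W \<and> ?T (h x) = x" by metis
  have hc: "\<bar>h x - q\<bar> \<le> (1 / \<kappa>) * \<bar>x - q\<bar>" if "x \<in> ?W" for x
  proof -
    have "\<kappa> * \<bar>h x - q\<bar> \<le> \<bar>x - q\<bar>" using exp[of "h x"] h[OF that] by simp
    then show ?thesis using k by (simp add: pos_le_divide_eq mult.commute)
  qed
  show ?thesis
  proof (rule that[OF del(1) del'])
    fix x assume x: "x \<in> ?W"
    define z where "z n = (h ^^ n) x" for n
    have zW: "z n \<in> ?W" for n by (induction n) (use x h in \<open>auto simp: z_def\<close>)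
    have zT: "?T (z (Suc n)) = z n" for n using h[OF zW[of n]] by (simp add: z_def)
    have zb: "\<bar>z n - q\<bar> \<le> (1 / \<kappa>) ^ n * \<bar>x - q\<bar>" for n
    proof (induction n)
      case (Suc n)
      have "\<bar>z (Suc n) - q\<bar> \<le> (1 / \<kappa>) * \<bar>z n - q\<bar>" using hc[OF zW[of n]] by (simp add: z_def)
      also have "\<dots> \<le> (1 / \<kappa>) * ((1 / \<kappa>) ^ n * \<bar>x - q\<bar>)" by (rule mult_left_mono[OF Suc]) (use k in simp)
      finally show ?case by (simp add: mult.assoc)
    qed (simp add: z_def)
    have "(\<lambda>n. (1 / \<kappa>) ^ n * \<bar>x - q\<bar>) \<longlonglongrightarrow> 0 * \<bar>x - q\<bar>"
      by (intro tendsto_mult_right LIMSEQ_realpow_zero) (use k in auto)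
    then have lim0: "(\<lambda>n. (1 / \<kappa>) ^ n * \<bar>x - q\<bar>) \<longlonglongrightarrow> 0" by simp
    have "(\<lambda>n. \<bar>z n - q\<bar>) \<longlonglongrightarrow> 0"
      by (rule tendsto_sandwich[OF _ _ tendsto_const lim0]) (use zb in \<open>auto simp: always_eventually\<close>)
    then have "z \<longlonglongrightarrow> q" by (simp add: tendsto_rabs_zero_iff LIM_zero_iff)
    then show "\<exists>z. z 0 = x \<and> (\<forall>k. z k \<in> {0..1} \<and> fold f w (z (Suc k)) = z k) \<and> z \<longlonglongrightarrow> q"
    proof (intro exI[of _ z] conjI allI)
      show "z 0 = x" by (simp add: z_def)
      show "z k \<in> {0..1}" for k using zW[of k] del' by auto
    qed (use zT in auto)
  qed
qed

definition \<delta> :: real where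
  "\<delta> = (SOME \<delta>. 0 < \<delta> \<and> 0 < q - \<delta> \<and> q + \<delta> < 1 \<and>
    (\<forall>x\<in>{q - \<delta>..q + \<delta>}. \<exists>z. z 0 = x \<and> (\<forall>k. z k \<in> {0..1} \<and> fold f w (z (Suc k)) = z k) \<and> z \<longlonglongrightarrow> q))"

abbreviation W :: "real set" where "W \<equiv> {q - \<delta>..q + \<delta>}"

lemma \<delta>: "0 < \<delta>" "0 < q - \<delta>" "q + \<delta> < 1"
  and W: "x \<in> W \<Longrightarrow> \<exists>z. z 0 = x \<and> (\<forall>k. z k \<in> {0..1} \<and> fold f w (z (Suc k)) = z k) \<and> z \<longlonglongrightarrow> q"
proof -
  have "\<exists>\<delta>. 0 < \<delta> \<and> 0 < q - \<delta> \<and> q + \<delta> < 1 \<and>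
    (\<forall>x\<in>{q - \<delta>..q + \<delta>}. \<exists>z. z 0 = x \<and> (\<forall>k. z k \<in> {0..1} \<and> fold f w (z (Suc k)) = z k) \<and> z \<longlonglongrightarrow> q)"
    using local_unstable_fibre by metis
  from someI_ex[OF this, folded \<delta>_def]
  show "0 < \<delta>" "0 < q - \<delta>" "q + \<delta> < 1"
    "x \<in> W \<Longrightarrow> \<exists>z. z 0 = x \<and> (\<forall>k. z k \<in> {0..1} \<and> fold f w (z (Suc k)) = z k) \<and> z \<longlonglongrightarrow> q" by auto
qed

lemma W_unit: "x \<in> W \<Longrightarrow> x \<in> {0..1}"
  using \<delta> by auto

text \<open>Going back one period keeps \<open>sQ\<close>, applies the contraction
  \<open>foldr A w\<close> to \<open>u\<close> and follows the fibre history of \<open>x\<close>;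
  all three coordinates tend to those of \<open>Q\<close>.\<close>

lemma local_unstable:
  assumes u: "u \<in> Iu" and x: "x \<in> W"
  shows "((sQ, u), x) \<in> unstable_manifold D F Q"
proof -
  obtain z where z: "z 0 = x" "\<And>k. z k \<in> {0..1}" "\<And>k. fold f w (z (Suc k)) = z k" "z \<longlonglongrightarrow> q"
    using W[OF x] by blast
  define us where "us n = (foldr A w ^^ n) u" for n
  have us: "us n \<in> Iu" for n by (induction n) (use u foldr_A_Iu[OF w(1)] in \<open>auto simp: us_def\<close>)
  have ub: "\<bar>us n - uQ\<bar> \<le> (rate ^ P) ^ n * \<bar>u - uQ\<bar>" for n
  proof (induction n)
    case (Suc n)
    have "\<bar>us (Suc n) - uQ\<bar> \<le> rate ^ P * \<bar>us n - uQ\<bar>"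
      using foldr_A_contraction[OF w(1), of "us n" uQ] uQ(2) by (simp add: us_def)
    also have "\<dots> \<le> rate ^ P * ((rate ^ P) ^ n * \<bar>u - uQ\<bar>)"
      by (rule mult_left_mono[OF Suc]) (use rate_bounds in simp)
    finally show ?case by (simp add: mult.assoc)
  qed (simp add: us_def)
  have "(\<lambda>n. (rate ^ P) ^ n * \<bar>u - uQ\<bar>) \<longlonglongrightarrow> 0 * \<bar>u - uQ\<bar>"
    by (intro tendsto_mult_right LIMSEQ_realpow_zero) (use rate_bounds rate_pow_P in auto)
  then have lim0: "(\<lambda>n. (rate ^ P) ^ n * \<bar>u - uQ\<bar>) \<longlonglongrightarrow> 0" by simp
  have "(\<lambda>n. \<bar>us n - uQ\<bar>) \<longlonglongrightarrow> 0"
    by (rule tendsto_sandwich[OF _ _ tendsto_const lim0]) (use ub in \<open>auto simp: always_eventually\<close>)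
  then have usl: "us \<longlonglongrightarrow> uQ" by (simp add: tendsto_rabs_zero_iff LIM_zero_iff)
  define Z where "Z k = ((sQ, us k), z k)" for k
  have "Z 0 \<in> unstable_manifold D F Q"
  proof (rule unstable_periodic[OF F_continuous Q_period(2,1) Q_in_D])
    fix k
    have Zk: "Z (Suc k) = ((sQ, foldr A w (us k)), z (Suc k))" by (simp add: Z_def us_def)
    show "(F ^^ P) (Z (Suc k)) = Z k"
      unfolding Zk word_orbit_end[OF w(1) sQ(1) us z(2)] by (simp add: Z_def sQ z)
    show "(F ^^ j) (Z (Suc k)) \<in> D" if "j < P" for j
      unfolding Zk by (rule word_orbit_in_D[OF w(1) sQ(1) us z(2) that])
  next
    show "Z \<longlonglongrightarrow> Q" unfolding Z_def by (intro tendsto_Pair tendsto_const usl z(4))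
  qed
  then show ?thesis by (simp add: Z_def us_def z)
qed

abbreviation Ws where "Ws \<equiv> (\<Union>Y\<in>forward_orbit F Q. stable_manifold D F Y)"
abbreviation Wu where "Wu \<equiv> (\<Union>Y\<in>forward_orbit F Q. unstable_manifold D F Y)"

lemma global_unstable:
  assumes v: "word v" and u: "u \<in> Iu" and x: "x \<in> W"
  shows "((fold B v sQ, u), fold f v x) \<in> Wu"
proof -
  have "((sQ, foldr A v u), x) \<in> unstable_manifold D F Q"
    by (rule local_unstable[OF foldr_A_Iu[OF v u] x])
  then have "(F ^^ length v) ((sQ, foldr A v u), x) \<in> unstable_manifold D F ((F ^^ length v) Q)"
    by (rule unstable_push_pow[rotated 2]) (use word_orbit_in_D[OF v sQ(1) u W_unit[OF x]] Q_in_D in auto)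
  then show ?thesis
    unfolding word_orbit_end[OF v sQ(1) u W_unit[OF x]] forward_orbit_def by blast
qed

lemma local_stable:
  assumes s: "s \<in> Is"
  shows "((s, uQ), q) \<in> stable_manifold D F Q"
proof -
  \<comment> \<open>The future of \<open>uQ\<close> is \<open>w\<close> repeated; cutting it after
    \<open>n\<close> letters supplies words of every length, not only of multiples of the
    period.\<close>
  have prefix: "\<exists>v u. word v \<and> length v = n \<and> u \<in> Iu \<and> foldr A v u = uQ" for n
  proof -
    let ?c = "concat (replicate n w)"
    have c: "word ?c" using w(1) by auto
    have f: "foldr A ?c uQ = uQ" by (induction n) (simp_all add: uQ)
    have "length ?c = n * P" by (induction n) auto
    moreover have "n * 1 \<le> n * P" using Q_period(2) by (intro mult_le_mono2) linarith
    ultimately have l: "length (take n ?c) = n" by simp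
    have "foldr A (take n ?c @ drop n ?c) uQ = uQ" using f by simp
    then have "foldr A (take n ?c) (foldr A (drop n ?c) uQ) = uQ" by (simp only: foldr_append comp_apply)
    moreover have "word (take n ?c)" "word (drop n ?c)" using c by (auto dest!: in_set_takeD in_set_dropD)
    ultimately show ?thesis using l foldr_A_Iu uQ(1) by blast
  qed
  have q1: "q \<in> {0..1}" using q by simp
  have *: "(F ^^ n) ((s, uQ), q) \<in> D \<and> dist ((F ^^ n) ((s, uQ), q)) ((F ^^ n) Q) \<le> rate ^ n * \<bar>s - sQ\<bar>" for n
  proof
    \<comment> \<open>Length \<open>Suc n\<close>, since \<open>word_orbit_in_D\<close> places in
      \<open>D\<close> only the iterates before the length of the word.\<close>
    obtain v u where v: "word v" "length v = Suc n" "u \<in> Iu" "foldr A v u = uQ" using prefix by blast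
    show "(F ^^ n) ((s, uQ), q) \<in> D"
      using word_orbit_in_D[OF v(1) s v(3) q1, of n] v by simp
    obtain v u where v: "word v" "length v = n" "u \<in> Iu" "foldr A v u = uQ" using prefix by blast
    have e: "(F ^^ n) ((t, uQ), q) = ((fold B v t, u), fold f v q)" if "t \<in> Is" for t
      using word_orbit_end[OF v(1) that v(3) q1] v by simp
    have "dist ((F ^^ n) ((s, uQ), q)) ((F ^^ n) Q) \<le> \<bar>fold B v s - fold B v sQ\<bar>"
      unfolding e[OF s] e[OF sQ(1)] using dist_triple_le[of "fold B v s" u "fold f v q" "fold B v sQ" u "fold f v q"] by simp
    then show "dist ((F ^^ n) ((s, uQ), q)) ((F ^^ n) Q) \<le> rate ^ n * \<bar>s - sQ\<bar>"
      using fold_B_contraction[OF v(1), of s sQ] v(2) by simp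
  qed
  have "(\<lambda>n. rate ^ n * \<bar>s - sQ\<bar>) \<longlonglongrightarrow> 0 * \<bar>s - sQ\<bar>"
    by (intro tendsto_mult_right LIMSEQ_realpow_zero rate_bounds)
  then have lim0: "(\<lambda>n. rate ^ n * \<bar>s - sQ\<bar>) \<longlonglongrightarrow> 0" by simp
  have "(\<lambda>n. dist ((F ^^ n) ((s, uQ), q)) ((F ^^ n) Q)) \<longlonglongrightarrow> 0"
    by (rule tendsto_sandwich[OF _ _ tendsto_const lim0]) (use * in \<open>auto simp: always_eventually\<close>)
  then show ?thesis using * by (simp add: stable_manifold_def)
qed

lemma global_stable:
  assumes v: "word v" and s: "s \<in> Is" and x: "x \<in> {0..1}" "fold f v x = q"
  shows "((s, foldr A v uQ), x) \<in> Ws"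
proof -
  \<comment> \<open>\<open>(F ^^ ?j) Q\<close> is the orbit point that reaches \<open>Q\<close>
    after \<open>?n\<close> further steps, because \<open>?n + ?j = ?n * P\<close>.\<close>
  let ?n = "length v" and ?j = "length v * (P - 1)"
  have "(F ^^ (?n + ?j)) Q = (F ^^ (?n * P)) Q"
    using Q_period(2) by (cases P) auto
  then have "(F ^^ ?n) ((F ^^ ?j) Q) = Q" by (simp only: funpow_add comp_apply Q_multiple_period)
  then have "(F ^^ ?n) ((s, foldr A v uQ), x) \<in> stable_manifold D F ((F ^^ ?n) ((F ^^ ?j) Q))"
    unfolding word_orbit_end[OF v s uQ(1) x(1)] x(2) using local_stable fold_B_Is[OF v s] by simp
  then have "((s, foldr A v uQ), x) \<in> stable_manifold D F ((F ^^ ?j) Q)"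
    by (rule stable_pullback_pow[rotated]) (rule word_orbit_in_D[OF v s uQ(1) x(1)])
  then show ?thesis unfolding forward_orbit_def by blast
qed

section \<open>Homoclinic points and their density\<close>

text \<open>Through \<open>X\<close> the stable set contains a segment over \<open>Is\<close>, and
  the unstable set contains \<open>Iu\<close> times the image of \<open>W\<close> under
  \<open>\<alpha>\<close>. These pieces are parallel to the axes, so transversality reduces to the
  three coordinate vectors.\<close>

lemma homoclinic_point:
  assumes v: "word \<alpha>" "word \<beta>" and x: "x \<in> W" and hit: "fold f (\<alpha> @ \<beta>) x = q"
  defines "X \<equiv> ((fold B \<alpha> sQ, foldr A \<beta> uQ), fold f \<alpha> x)"
  shows "X \<in> \<Lambda>" "transverse_at Ws Wu X"
proof -
  have x1: "x \<in> {0..1}" by (rule W_unit[OF x])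
  have ax: "fold f \<alpha> x \<in> {0..1}" by (rule word_unit[OF v(1) x1])
  have hit': "fold f \<beta> (fold f \<alpha> x) = q" using hit by simp
  have sA: "fold B \<alpha> sQ \<in> Is" by (rule fold_B_Is[OF v(1) sQ(1)])
  have uA: "foldr A \<beta> uQ \<in> Iu" by (rule foldr_A_Iu[OF v(2) uQ(1)])
  have Xs: "((s, foldr A \<beta> uQ), fold f \<alpha> x) \<in> Ws" if "s \<in> Is" for s
    by (rule global_stable[OF v(2) that ax hit'])
  have Xu: "((fold B \<alpha> sQ, u), fold f \<alpha> y) \<in> Wu" if "u \<in> Iu" "y \<in> W" for u y
    by (rule global_unstable[OF v(1) that])
  have XWs: "X \<in> Ws" unfolding X_def by (rule Xs[OF sA])
  have XWu: "X \<in> Wu" unfolding X_def by (rule Xu[OF uA x])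
  show "X \<in> \<Lambda>"
    unfolding Lambda_iff using XWs XWu by (auto simp: stable_manifold_def unstable_manifold_def)
  let ?V = "tangent_space Ws X" and ?W = "tangent_space Wu X"
  have e1: "((1, 0), 0) \<in> ?V"
  proof -
    obtain s0 s1 where I: "s0 < s1" "Is = {s0..s1}" using Is_nondegenerate by blast
    obtain e where e: "e \<noteq> 0" "\<And>t. t \<in> {0..1} \<Longrightarrow> fold B \<alpha> sQ + t * e \<in> Is"
      by (rule interval_direction[OF sA[unfolded I(2)] I(1), folded I(2)]) blast
    have "e *\<^sub>R ((1, 0), 0) \<in> ?V"
      by (rule segment_in_tangent_space) (use Xs e(2) in \<open>simp add: X_def\<close>)
    then show ?thesis using rescale_in_subspace[OF subspace_tangent_space] e(1) by blast
  qed
  have e2: "((0, 1), 0) \<in> ?W"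
  proof -
    obtain s0 s1 where I: "s0 < s1" "Iu = {s0..s1}" using Iu_nondegenerate by blast
    obtain e where e: "e \<noteq> 0" "\<And>t. t \<in> {0..1} \<Longrightarrow> foldr A \<beta> uQ + t * e \<in> Iu"
      by (rule interval_direction[OF uA[unfolded I(2)] I(1), folded I(2)]) blast
    have "e *\<^sub>R ((0, 1), 0) \<in> ?W"
      by (rule segment_in_tangent_space) (use Xu[OF e(2) x] in \<open>simp add: X_def\<close>)
    then show ?thesis using rescale_in_subspace[OF subspace_tangent_space] e(1) by blast
  qed
  have e3: "((0, 0), 1) \<in> ?W"
  proof -
    obtain y where y: "y \<in> W" "y \<noteq> x" 
    proof (cases "x = q - \<delta>")
      case True then show ?thesis using that[of "q + \<delta>"] \<delta> by simp
    next
      case False then show ?thesis using that[of "q - \<delta>"] \<delta> by simp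
    qed
    define e where "e = fold f \<alpha> y - fold f \<alpha> x"
    have e0: "e \<noteq> 0"
      using inj_onD[OF word_inj[OF v(1)] _ W_unit[OF y(1)] x1] y(2) by (auto simp: e_def)
    \<comment> \<open>The segment is straight although \<open>fold f \<alpha>\<close> need not be
      affine: only the image set counts, and the intermediate value theorem finds each point of the
      segment in it.\<close>
    have e: "fold f \<alpha> x + t * e \<in> fold f \<alpha> ` W" if t: "t \<in> {0..1}" for t
    proof -
      define r where "r = fold f \<alpha> x + t * e"
      have fy: "fold f \<alpha> y = fold f \<alpha> x + e" by (simp add: e_def)
      have between: "fold f \<alpha> x \<le> r \<and> r \<le> fold f \<alpha> y \<or> fold f \<alpha> y \<le> r \<and> r \<le> fold f \<alpha> x"
      proof (cases "0 \<le> e")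
        case True
        then have "0 \<le> t * e" "t * e \<le> 1 * e" using t mult_right_mono[of t 1 e] by simp_all
        then show ?thesis using fy by (intro disjI1) (simp only: r_def, linarith)
      next
        case False
        then have "t * e \<le> 0" "1 * e \<le> t * e"
          using t mult_right_mono_neg[of t 1 e] by (simp_all add: mult_le_0_iff)
        then show ?thesis using fy by (intro disjI2) (simp only: r_def, linarith)
      qed
      have "\<exists>z\<in>{min x y..max x y}. fold f \<alpha> z = r"
        by (rule word_ivt[OF v(1)])
          (use between W_unit[OF y(1)] x1 in \<open>auto simp: min_def max_def\<close>)
      then obtain z where z: "z \<in> {min x y..max x y}" "r = fold f \<alpha> z" by metis
      have "z \<in> W" using z(1) x y(1) by auto
      then show ?thesis using z(2) unfolding r_def by (rule image_eqI[rotated])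
    qed
    have "e *\<^sub>R ((0, 0), 1) \<in> ?W"
    proof (rule segment_in_tangent_space)
      fix t :: real assume "t \<in> {0..1}"
      then obtain y where "y \<in> W" "fold f \<alpha> x + t * e = fold f \<alpha> y" using e by (metis imageE)
      then show "X + t *\<^sub>R e *\<^sub>R ((0, 0), 1) \<in> Wu" using Xu[OF uA, of y] by (simp add: X_def)
    qed
    then show ?thesis using rescale_in_subspace[OF subspace_tangent_space] e0 by blast
  qed
  have "p \<in> {v + w |v w. v \<in> ?V \<and> w \<in> ?W}" for p
  proof -
    have "fst (fst p) *\<^sub>R ((1, 0), 0) \<in> ?V" using subspace_scale[OF subspace_tangent_space e1] .
    moreover have "snd (fst p) *\<^sub>R ((0, 1), 0) + snd p *\<^sub>R ((0, 0), 1) \<in> ?W"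
      by (intro subspace_add subspace_scale subspace_tangent_space e2 e3)
    moreover have "p = fst (fst p) *\<^sub>R ((1, 0), 0) + (snd (fst p) *\<^sub>R ((0, 1), 0) + snd p *\<^sub>R ((0, 0), 1))"
      by (simp add: prod_eq_iff)
    ultimately show ?thesis by blast
  qed
  then show "transverse_at Ws Wu X" unfolding transverse_at_def using XWs XWu by blast
qed

lemma Lambda_homoclinic_class: "\<Lambda> = homoclinic_class D F unit_cube Q"
proof
  show "homoclinic_class D F unit_cube Q \<subseteq> \<Lambda>"
    unfolding homoclinic_class_def by (rule closure_minimal[OF _ closed_Lambda]) blast
  show "\<Lambda> \<subseteq> homoclinic_class D F unit_cube Q"
  proof
    fix X assume X: "X \<in> \<Lambda>"
    show "X \<in> homoclinic_class D F unit_cube Q"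
      unfolding homoclinic_class_def closure_approachable
    proof (intro allI impI)
      fix \<epsilon> :: real assume "0 < \<epsilon>"
      then obtain v \<beta> z1 z2 where a: "word v" "word \<beta>" "0 < real_of_rat z1" "z1 < z2" "real_of_rat z2 < 1"
        and near: "\<And>s u z. s \<in> Is \<Longrightarrow> u \<in> Iu \<Longrightarrow> z \<in> {real_of_rat z1..real_of_rat z2} \<Longrightarrow>
          dist ((fold B v s, foldr A \<beta> u), fold f v z) X < \<epsilon>"
        using Lambda_approx[OF X] by metis
      have "\<exists>\<alpha> y1 y2. word \<alpha> \<and> q - \<delta> \<le> y1 \<and> y1 < y2 \<and> y2 \<le> q + \<delta> \<and>
          fold f ([] @ \<alpha>) ` {y1..y2} \<subseteq> {real_of_rat z1..real_of_rat z2}"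
        by (rule word_image_hits_interval) (use a \<delta> in \<open>auto simp: of_rat_less\<close>)
      then obtain \<alpha> y1 y2 where y: "word \<alpha>" "q - \<delta> \<le> y1" "y1 < y2" "y2 \<le> q + \<delta>"
        "fold f \<alpha> ` {y1..y2} \<subseteq> {real_of_rat z1..real_of_rat z2}" by auto
      \<comment> \<open>Hitting \<open>q\<close> exactly takes a whole interval of starting points;
        \<open>y1 < y2\<close> was kept for this.\<close>
      have "\<exists>\<tau>. word \<tau> \<and> q \<in> fold f ((\<alpha> @ v @ \<beta>) @ \<tau>) ` {y1..y2}"
        by (rule word_image_hits_point) (use a y \<delta> q in auto)
      then obtain \<tau> x where t: "word \<tau>" "x \<in> {y1..y2}" "fold f ((\<alpha> @ v @ \<beta>) @ \<tau>) x = q" by blast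
      \<comment> \<open>The cut between past and future comes after \<open>v\<close>: there the past
        ends in \<open>v\<close> and the future begins with \<open>\<beta>\<close>, so
        \<open>H\<close> lies in the cylinder around \<open>X\<close>.\<close>
      define H where "H = ((fold B (\<alpha> @ v) sQ, foldr A (\<beta> @ \<tau>) uQ), fold f (\<alpha> @ v) x)"
      have "H \<in> \<Lambda>" "transverse_at Ws Wu H"
        unfolding H_def by (rule homoclinic_point; use a y t in simp)+
      moreover have "dist H X < \<epsilon>"
      proof -
        have "H = ((fold B v (fold B \<alpha> sQ), foldr A \<beta> (foldr A \<tau> uQ)), fold f v (fold f \<alpha> x))"
          by (simp add: H_def)
        moreover have "fold f \<alpha> x \<in> {real_of_rat z1..real_of_rat z2}" using y(5) t(2) by blast
        ultimately show ?thesis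
          using near[OF fold_B_Is[OF y(1) sQ(1)] foldr_A_Iu[OF t(1) uQ(1)]] by simp
      qed
      ultimately show "\<exists>Y\<in>{X \<in> \<Lambda>. transverse_at Ws Wu X}. dist Y X < \<epsilon>" by blast
    qed
  qed
qed

text \<open>A curve in the unstable set of \<open>Q\<close> follows, under backward iteration, the rectangles of the
  orbit of \<open>Q\<close>; so its first coordinate is constant.\<close>

lemma unstable_curve_fst_const:
  assumes c: "continuous_on {0..1} c" "c 0 = Q" "c ` {0..1} \<subseteq> unstable_manifold D F Q" and t: "t \<in> {0..1::real}"
  shows "fst (fst (c t)) = sQ"
proof -
  \<comment> \<open>The base history of \<open>c t\<close> is unique because \<Phi> is injective, so
    it depends continuously on \<open>t\<close>.\<close>
  define h where "h n t = (inv \<Phi> ^^ n) (fst (c t))" for n t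
  have hc: "continuous_on {0..1} (h n)" for n
  proof (induction n)
    case 0 then show ?case using c(1) by (simp add: h_def[abs_def] continuous_on_fst)
  next
    case (Suc n)
    then show ?case
      using continuous_on_compose2[OF inv_Phi_cont Suc] by (simp add: h_def[abs_def])
  qed
  \<comment> \<open>Only from \<open>Suc n\<close> on: an unstable set requires the preimages of its
    points, not the points themselves, to lie in \<open>D\<close>.\<close>
  have hR: "\<exists>i<3. h (Suc n) t \<in> R i" if "t \<in> {0..1}" for n t
  proof -
    have "c t \<in> unstable_manifold D F Q" using that c(3) by blast
    then obtain x where x: "backward_orbit D F x" "x 0 = c t" by (auto simp: unstable_manifold_def)
    have "h n t = fst (x n)" for n
    proof (induction n)
      case (Suc n)
      have "x (Suc n) \<in> D" "F (x (Suc n)) = x n" using x by (auto simp: backward_orbit_def)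
      then have "fst (x n) = \<Phi> (fst (x (Suc n)))" using fst_F by metis
      then show ?case using Suc by (simp add: h_def)
    qed (simp add: h_def x)
    then show ?thesis using x by (auto simp: backward_orbit_def D_iff)
  qed
  \<comment> \<open>The rectangles are disjoint and closed and the curve is connected, so a single
    rectangle contains it.\<close>
  have same: "\<exists>i<3. \<forall>t\<in>{0..1}. h (Suc n) t \<in> R i" for n
  proof -
    let ?S = "h (Suc n) ` {0..1}"
    have conn: "connected ?S" by (rule connected_continuous_image[OF hc]) simp
    obtain i where i: "i < 3" "h (Suc n) 0 \<in> R i" using hR[of 0] by auto
    let ?O = "\<Union>j\<in>{..<3} - {i}. R j"
    have "closed (R i)" "closed ?O" using i R_compact by (auto intro!: closed_UN compact_imp_closed)
    moreover have "R i \<inter> ?O \<inter> ?S = {}" using R_unique i by blast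
    moreover have "?S \<subseteq> R i \<union> ?O" using hR by blast
    ultimately have "R i \<inter> ?S = {} \<or> ?O \<inter> ?S = {}"
      using conn unfolding connected_closed by blast
    moreover have "h (Suc n) 0 \<in> R i \<inter> ?S" using i by auto
    ultimately have "?O \<inter> ?S = {}" by blast
    then show ?thesis using \<open>?S \<subseteq> R i \<union> ?O\<close> i by blast
  qed
  have step: "\<bar>fst (h n t) - fst (h n 0)\<bar> \<le> rate * \<bar>fst (h (Suc n) t) - fst (h (Suc n) 0)\<bar>" for n
  proof -
    obtain i where i: "i < 3" "\<forall>t\<in>{0..1}. h (Suc n) t \<in> R i" using same by blast
    have "fst (h n r) = B i (fst (h (Suc n) r))" if "r \<in> {0..1}" for r
      using fst_Phi_R[OF i(1), of "h (Suc n) r"] i(2) that by (simp add: h_def)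
    then show ?thesis using B_contraction[OF i(1)] t by simp
  qed
  have "\<bar>fst (h 0 t) - fst (h 0 0)\<bar> \<le> rate ^ n * \<bar>fst (h n t) - fst (h n 0)\<bar>" for n
  proof (induction n)
    case (Suc n)
    then have "\<bar>fst (h 0 t) - fst (h 0 0)\<bar> \<le> rate ^ n * (rate * \<bar>fst (h (Suc n) t) - fst (h (Suc n) 0)\<bar>)"
      using mult_left_mono[OF step, of "rate ^ n" n] rate_bounds by (meson order_trans zero_le_power)
    then show ?case by (simp add: mult_ac)
  qed simp
  moreover have "\<bar>fst (h (Suc n) t) - fst (h (Suc n) 0)\<bar> \<le> 1" for n
  proof -
    obtain i where i: "i < 3" "\<forall>t\<in>{0..1}. h (Suc n) t \<in> R i" using same by blast
    have "fst (h (Suc n) r) \<in> {0..1}" if "r \<in> {0..1}" for r using R_unit[OF i(1)] i(2) that by blast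
    from this[of t] this[of 0] t show ?thesis by auto
  qed
  ultimately have "\<bar>fst (h 0 t) - fst (h 0 0)\<bar> \<le> rate ^ Suc n * 1" for n
    using rate_bounds by (meson mult_left_mono order_trans zero_le_power)
  moreover have "rate ^ Suc n \<le> rate ^ n" for n
    using rate_bounds mult_right_mono[of rate 1 "rate ^ n"] by simp
  ultimately have "\<bar>fst (h 0 t) - fst (h 0 0)\<bar> \<le> rate ^ n" for n by (metis mult_1_right order_trans)
  then have "fst (h 0 t) = fst (h 0 0)" by (rule eq_of_geometric[OF rate_bounds(3,4)])
  then show ?thesis using c(2) by (simp add: h_def)
qed

text \<open>Segments in the local unstable set give two directions. Conversely, the first coordinate
  is constant along unstable curves, so no velocity has a first component.\<close>

lemma Q_u_index: "u_index D F Q = 2"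
proof -
  let ?T = "tangent_space (unstable_manifold D F Q) Q"
  let ?e2 = "((0, 1), 0) :: (real \<times> real) \<times> real" and ?e3 = "((0, 0), 1) :: (real \<times> real) \<times> real"
  have e2: "?e2 \<in> ?T"
  proof -
    obtain s0 s1 where I: "s0 < s1" "Iu = {s0..s1}" using Iu_nondegenerate by blast
    obtain e where e: "e \<noteq> 0" "\<And>t. t \<in> {0..1} \<Longrightarrow> uQ + t * e \<in> Iu"
      by (rule interval_direction[OF uQ(1)[unfolded I(2)] I(1), folded I(2)]) blast
    have "e *\<^sub>R ?e2 \<in> ?T"
      by (rule segment_in_tangent_space) (use local_unstable[OF e(2), of _ q] \<delta> in simp)
    then show ?thesis using rescale_in_subspace[OF subspace_tangent_space] e(1) by blast
  qed
  have e3: "?e3 \<in> ?T"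
  proof -
    have qW: "q \<in> W" "q - \<delta> < q + \<delta>" using \<delta> by auto
    obtain e where e: "e \<noteq> 0" "\<And>t. t \<in> {0..1} \<Longrightarrow> q + t * e \<in> W"
      by (rule interval_direction[OF qW]) blast
    have "e *\<^sub>R ?e3 \<in> ?T"
      by (rule segment_in_tangent_space) (use local_unstable[OF uQ(1) e(2)] in simp)
    then show ?thesis using rescale_in_subspace[OF subspace_tangent_space] e(1) by blast
  qed
  have upper: "fst (fst v) = 0" if "v \<in> ?T" for v
  proof -
    have sub: "subspace {v :: (real \<times> real) \<times> real. fst (fst v) = 0}" by (auto simp: subspace_def)
    have velocity: "fst (fst v) = 0"
      if c: "c C1_differentiable_on {0..1}" "c 0 = Q" "c ` {0..1} \<subseteq> unstable_manifold D F Q"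
        "(c has_vector_derivative v) (at 0)" for c v
    proof -
      have const: "fst (fst (c t)) = sQ" if "t \<in> {0..1}" for t
        by (rule unstable_curve_fst_const[OF C1_differentiable_imp_continuous_on[OF c(1)] c(2,3) that])
      have "((\<lambda>t. fst (fst (c t))) has_vector_derivative fst (fst v)) (at 0)"
        using bounded_linear.has_vector_derivative[OF bounded_linear_fst
            bounded_linear.has_vector_derivative[OF bounded_linear_fst c(4)]] .
      then have 1: "((\<lambda>t. fst (fst (c t))) has_vector_derivative fst (fst v)) (at 0 within {0..1})"
        by (rule has_vector_derivative_at_within)
      have 2: "((\<lambda>t. fst (fst (c t))) has_vector_derivative 0) (at 0 within {0..1})"
        by (rule has_vector_derivative_transform[OF _ _ has_vector_derivative_const[of sQ]]) (use const in auto)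
      show ?thesis
        by (rule vector_derivative_unique_within[OF _ 1 2]) (simp add: trivial_limit_within islimpt_Icc)
    qed
    have "?T \<subseteq> {v. fst (fst v) = 0}"
      unfolding tangent_space_def
    proof (rule span_minimal[OF _ sub], rule subsetI)
      fix v assume "v \<in> {v. \<exists>c. c C1_differentiable_on {0..1} \<and> c 0 = Q \<and>
        c ` {0..1} \<subseteq> unstable_manifold D F Q \<and> (c has_vector_derivative v) (at 0)}"
      then obtain c where "c C1_differentiable_on {0..1}" "c 0 = Q"
        "c ` {0..1} \<subseteq> unstable_manifold D F Q" "(c has_vector_derivative v) (at 0)" by auto
      then have "fst (fst v) = 0" by (rule velocity)
      then show "v \<in> {v. fst (fst v) = 0}" by simp
    qed
    then show ?thesis using that by blast
  qed
  have T: "?T = span {?e2, ?e3}"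
  proof
    show "span {?e2, ?e3} \<subseteq> ?T" by (rule span_minimal) (use e2 e3 subspace_tangent_space in auto)
    show "?T \<subseteq> span {?e2, ?e3}"
    proof
      fix v assume "v \<in> ?T"
      then have "v = snd (fst v) *\<^sub>R ?e2 + snd v *\<^sub>R ?e3" using upper by (simp add: prod_eq_iff)
      moreover have "snd (fst v) *\<^sub>R ?e2 + snd v *\<^sub>R ?e3 \<in> span {?e2, ?e3}"
        by (intro span_add span_scale span_base) auto
      ultimately show "v \<in> span {?e2, ?e3}" by simp
    qed
  qed
  have "independent {?e2, ?e3}"
    by (rule pairwise_orthogonal_independent) (auto simp: pairwise_def orthogonal_def zero_prod_def inner_Pair)
  then have "dim (span {?e2, ?e3}) = card {?e2, ?e3}" by (rule dim_span_eq_card_independent)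
  then show ?thesis unfolding u_index_def T by simp
qed

section \<open>A dense orbit\<close>

lemma Lambda_transitive: "transitive_on D F \<Lambda>"
proof -
  text \<open>Itineraries \<open>\<omega>\<close> with intervals \<open>{y1..y2}\<close> of fibre points, extended so as to visit the \<open>n\<close>-th of
    countably many cylinders at stage \<open>n\<close>.\<close>
  define good where "good = (\<lambda>(\<omega>, y1, y2). word \<omega> \<and> q - \<delta> \<le> y1 \<and> y1 < y2 \<and> y2 \<le> q + \<delta>)"
  define visits where "visits = (\<lambda>(v, \<beta>, z1, z2) (\<omega>, _ :: real, _ :: real) (\<omega>', y1', y2').
    word v \<and> word \<beta> \<and> v \<noteq> [] \<and> 0 < real_of_rat z1 \<and> z1 < z2 \<and> real_of_rat z2 < 1 \<longrightarrow>
    (\<exists>\<alpha>. word \<alpha> \<and> \<omega>' = \<omega> @ \<alpha> @ v @ \<beta> \<and>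
      fold f (\<omega> @ \<alpha>) ` {y1'..y2'} \<subseteq> {real_of_rat z1..real_of_rat z2}))"
  define extends where "extends = (\<lambda>(\<omega>, y1, y2) (\<omega>', y1', y2').
    \<exists>\<tau>. word \<tau> \<and> \<tau> \<noteq> [] \<and> \<omega>' = \<omega> @ \<tau> \<and> (y1 :: real) \<le> y1' \<and> y2' \<le> (y2 :: real))"
  let ?target = "from_nat :: nat \<Rightarrow> nat list \<times> nat list \<times> rat \<times> rat"
  have "\<exists>S. \<forall>n. good (S n) \<and> (extends (S n) (S (Suc n)) \<and> visits (?target n) (S n) (S (Suc n)))"
  proof (rule dependent_nat_choice)
    show "\<exists>x. good x" by (rule exI[of _ "([], q - \<delta>, q + \<delta>)"]) (use \<delta> in \<open>simp add: good_def\<close>)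
    fix x n assume "good x"
    then obtain \<omega> y1 y2 where x: "x = (\<omega>, y1, y2)" "word \<omega>" "q - \<delta> \<le> y1" "y1 < y2" "y2 \<le> q + \<delta>"
      by (auto simp: good_def)
    obtain v \<beta> z1 z2 where tn: "?target n = (v, \<beta>, z1, z2)" by (metis prod.exhaust)
    show "\<exists>y. good y \<and> extends x y \<and> visits (?target n) x y"
    proof (cases "word v \<and> word \<beta> \<and> v \<noteq> [] \<and> 0 < real_of_rat z1 \<and> z1 < z2 \<and> real_of_rat z2 < 1")
      case True
      have "\<exists>\<alpha> p1 p2. word \<alpha> \<and> y1 \<le> p1 \<and> p1 < p2 \<and> p2 \<le> y2 \<and>
          fold f (\<omega> @ \<alpha>) ` {p1..p2} \<subseteq> {real_of_rat z1..real_of_rat z2}"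
        by (rule word_image_hits_interval) (use True x \<delta> in \<open>auto simp: of_rat_less\<close>)
      then obtain \<alpha> p1 p2 where a: "word \<alpha>" "y1 \<le> p1" "p1 < p2" "p2 \<le> y2"
        "fold f (\<omega> @ \<alpha>) ` {p1..p2} \<subseteq> {real_of_rat z1..real_of_rat z2}" by blast
      have "extends x (\<omega> @ \<alpha> @ v @ \<beta>, p1, p2)"
        unfolding extends_def x(1) prod.case using a True by (intro exI[of _ "\<alpha> @ v @ \<beta>"]) auto
      moreover have "good (\<omega> @ \<alpha> @ v @ \<beta>, p1, p2)" using a x True by (auto simp: good_def)
      moreover have "visits (?target n) x (\<omega> @ \<alpha> @ v @ \<beta>, p1, p2)"
        unfolding visits_def x(1) tn prod.case using a by blast
      ultimately show ?thesis by blast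
    next
      case False
      \<comment> \<open>If the \<open>n\<close>-th tuple does not describe a cylinder, a letter
        \<open>0\<close> is appended so that the itinerary still grows.\<close>
      have "extends x (\<omega> @ [0], y1, y2)"
        unfolding extends_def x(1) prod.case by (intro exI[of _ "[0]"]) auto
      moreover have "good (\<omega> @ [0], y1, y2)" using x by (auto simp: good_def)
      moreover have "visits (?target n) x (\<omega> @ [0], y1, y2)"
        unfolding visits_def x(1) tn prod.case using False by blast
      ultimately show ?thesis by blast
    qed
  qed
  then obtain S where S: "\<And>n. good (S n)" "\<And>n. extends (S n) (S (Suc n))" "\<And>n. visits (?target n) (S n) (S (Suc n))"
    by blast
  define \<omega> y1 y2 where "\<omega> n = fst (S n)" and "y1 n = fst (snd (S n))" and "y2 n = snd (snd (S n))" for n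
  have Sn: "S n = (\<omega> n, y1 n, y2 n)" for n by (simp add: \<omega>_def y1_def y2_def)
  have g: "word (\<omega> n)" "q - \<delta> \<le> y1 n" "y1 n < y2 n" "y2 n \<le> q + \<delta>" for n
    using S(1)[of n] by (simp_all add: good_def Sn)
  have ext: "\<exists>\<tau>. word \<tau> \<and> \<tau> \<noteq> [] \<and> \<omega> (Suc n) = \<omega> n @ \<tau> \<and> y1 n \<le> y1 (Suc n) \<and> y2 (Suc n) \<le> y2 n" for n
    using S(2)[of n] unfolding extends_def Sn prod.case .
  \<comment> \<open>Itineraries of unbounded length keep the forward orbit of the limit point in
    \<open>D\<close> for all times.\<close>
  have len: "n \<le> length (\<omega> n)" for n
  proof (induction n)
    case (Suc n)
    then show ?case using ext[of n] by (metis Suc_leI length_append length_greater_0_conv less_add_same_cancel1 le_less_trans)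
  qed simp
  \<comment> \<open>Points of the local unstable set of \<open>Q\<close> whose future begins with
    \<open>\<omega> n\<close> and whose fibre coordinate lies in the \<open>n\<close>-th interval.
    These sets are compact and nested, and a common point realises all itineraries.\<close>
  define C where "C n = (\<lambda>(u, x). ((sQ, foldr A (\<omega> n) u), x)) ` (Iu \<times> {y1 n..y2 n})" for n
  have "\<Inter> (range C) \<noteq> {}"
  proof (rule compact_nest)
    fix n
    have Ac: "continuous_on Iu (foldr A v)" if "word v" for v
      using that
    proof (induction v)
      case (Cons i v)
      then show ?case using cu_nz[of i] by (auto simp: A_def[abs_def] comp_def intro!: continuous_intros)
    qed (simp add: id_def continuous_on_id)
    have "compact Iu" by (simp add: Iu_def)
    moreover have "continuous_on (Iu \<times> {y1 n..y2 n}) (\<lambda>(u, x). ((sQ, foldr A (\<omega> n) u), x))"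
      unfolding case_prod_beta
      by (intro continuous_intros continuous_on_compose2[OF Ac[OF g(1)]]) auto
    ultimately show "compact (C n)"
      unfolding C_def by (intro compact_continuous_image compact_Times) auto
    show "C n \<noteq> {}" unfolding C_def using g(3)[of n] uQ(1) by auto
  next
    fix m n :: nat assume "m \<le> n"
    then show "C n \<subseteq> C m"
    proof (induction n rule: dec_induct)
      case (step n)
      have "C (Suc n) \<subseteq> C n"
      proof
        fix X assume "X \<in> C (Suc n)"
        then obtain u x where X: "u \<in> Iu" "x \<in> {y1 (Suc n)..y2 (Suc n)}" "X = ((sQ, foldr A (\<omega> (Suc n)) u), x)"
          by (auto simp: C_def)
        obtain \<tau> where t: "word \<tau>" "\<omega> (Suc n) = \<omega> n @ \<tau>" "y1 n \<le> y1 (Suc n)" "y2 (Suc n) \<le> y2 n"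
          using ext[of n] by blast
        have "X = (\<lambda>(u, x). ((sQ, foldr A (\<omega> n) u), x)) (foldr A \<tau> u, x)" using X t by simp
        moreover have "(foldr A \<tau> u, x) \<in> Iu \<times> {y1 n..y2 n}" using X t foldr_A_Iu[OF t(1) X(1)] by auto
        ultimately show "X \<in> C n" unfolding C_def by (rule image_eqI)
      qed
      then show ?case using step by blast
    qed simp
  qed
  then obtain X0 where X0: "\<And>n. X0 \<in> C n" by blast
  have rep: "\<exists>u x. u \<in> Iu \<and> x \<in> {y1 n..y2 n} \<and> X0 = ((sQ, foldr A (\<omega> n) u), x)" for n
    using X0[of n] by (auto simp: C_def)
  have yW: "x \<in> W" if "x \<in> {y1 n..y2 n}" for x n using that g(2,4)[of n] by auto
  have fw: "(F ^^ n) X0 \<in> D" for n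
  proof -
    obtain u x where u: "u \<in> Iu" "x \<in> {y1 (Suc n)..y2 (Suc n)}" "X0 = ((sQ, foldr A (\<omega> (Suc n)) u), x)"
      using rep by blast
    show ?thesis unfolding u(3)
      by (rule word_orbit_in_D[OF g(1) sQ(1) u(1) W_unit[OF yW[OF u(2)]]]) (use len[of "Suc n"] in simp)
  qed
  obtain b where b: "backward_orbit D F b" "b 0 = X0"
  proof -
    obtain u x where u: "u \<in> Iu" "x \<in> {y1 0..y2 0}" "X0 = ((sQ, foldr A (\<omega> 0) u), x)" using rep by blast
    \<comment> \<open>Starting in the unstable set of \<open>Q\<close> supplies the past of the
      orbit, which density does not constrain.\<close>
    have "X0 \<in> unstable_manifold D F Q"
      unfolding u(3) by (rule local_unstable[OF foldr_A_Iu[OF g(1) u(1)] yW[OF u(2)]])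
    then show thesis using that by (auto simp: unstable_manifold_def)
  qed
  define orb where "orb k = (if 0 \<le> k then (F ^^ nat k) X0 else b (nat (- k)))" for k
  have bD: "b n \<in> D" for n using b fw[of 0] by (cases n) (auto simp: backward_orbit_def)
  have orb: "complete_orbit D F orb"
    unfolding complete_orbit_def
  proof (intro allI conjI)
    fix k
    show "orb k \<in> D" using fw bD by (simp add: orb_def)
    show "F (orb k) = orb (k + 1)"
    proof (cases "0 \<le> k")
      case True
      then have "nat (k + 1) = Suc (nat k)" by simp
      then show ?thesis using True by (simp add: orb_def)
    next
      case False
      then have "nat (- k) = Suc (nat (- (k + 1)))" by simp
      then have "F (orb k) = b (nat (- (k + 1)))" using False b by (simp add: orb_def backward_orbit_def)
      then show ?thesis using False b by (cases "k = -1") (auto simp: orb_def)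
    qed
  qed
  have orb_shift: "orb (k + int n) = (F ^^ n) (orb k)" for k n
  proof (induction n)
    case (Suc n)
    have "F (orb (k + int n)) = orb (k + int n + 1)" using orb by (simp add: complete_orbit_def)
    then show ?case using Suc by (simp add: add.commute add.left_commute)
  qed simp
  have "orb k \<in> \<Lambda>" for k
    unfolding Lambda_iff
  proof (intro conjI allI exI[of _ "\<lambda>n. orb (k - int n)"])
    show "(F ^^ n) (orb k) \<in> D" for n
      using orb orb_shift[of k n] by (metis complete_orbit_def)
    have "F (orb (k - int (Suc n))) = orb (k - int n)" for n
      using orb[unfolded complete_orbit_def, THEN spec, of "k - int (Suc n)"] by simp
    then show "backward_orbit D F (\<lambda>n. orb (k - int n))"
      using orb by (simp add: backward_orbit_def complete_orbit_def)
  qed simp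
  then have "range orb \<subseteq> \<Lambda>" by blast
  moreover have "\<Lambda> \<subseteq> closure (range orb)"
  proof
    fix X assume X: "X \<in> \<Lambda>"
    show "X \<in> closure (range orb)"
      unfolding closure_approachable
    proof (intro allI impI)
      fix \<epsilon> :: real assume "0 < \<epsilon>"
      then obtain v \<beta> z1 z2 where a: "word v" "word \<beta>" "v \<noteq> []" "0 < real_of_rat z1" "z1 < z2" "real_of_rat z2 < 1"
        and near: "\<And>s u z. s \<in> Is \<Longrightarrow> u \<in> Iu \<Longrightarrow> z \<in> {real_of_rat z1..real_of_rat z2} \<Longrightarrow>
          dist ((fold B v s, foldr A \<beta> u), fold f v z) X < \<epsilon>"
        using Lambda_approx[OF X] by metis
      define n where "n = to_nat (v, \<beta>, z1, z2)"
      have "?target n = (v, \<beta>, z1, z2)" by (simp add: n_def)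
      then have "visits (v, \<beta>, z1, z2) (S n) (S (Suc n))" using S(3)[of n] by simp
      then obtain \<alpha> where al: "word \<alpha>" "\<omega> (Suc n) = \<omega> n @ \<alpha> @ v @ \<beta>"
        "fold f (\<omega> n @ \<alpha>) ` {y1 (Suc n)..y2 (Suc n)} \<subseteq> {real_of_rat z1..real_of_rat z2}"
        using a unfolding visits_def Sn prod.case by blast
      obtain u x where u: "u \<in> Iu" "x \<in> {y1 (Suc n)..y2 (Suc n)}" "X0 = ((sQ, foldr A (\<omega> (Suc n)) u), x)"
        using rep by blast
      \<comment> \<open>At time \<open>length ?v\<close> the orbit has just followed
        \<open>v\<close> and is about to follow \<open>\<beta>\<close>, so it lies in the cylinder
        around \<open>X\<close>.\<close>
      let ?v = "\<omega> n @ \<alpha> @ v"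
      have wv: "word ?v" using g(1) al a by simp
      have X0e: "X0 = ((sQ, foldr A ?v (foldr A \<beta> u)), x)" by (simp add: u(3) al(2))
      have "(F ^^ length ?v) X0 = ((fold B ?v sQ, foldr A \<beta> u), fold f ?v x)"
        unfolding X0e by (rule word_orbit_end[OF wv sQ(1) foldr_A_Iu[OF a(2) u(1)] W_unit[OF yW[OF u(2)]]])
      also have "\<dots> = ((fold B v (fold B (\<omega> n @ \<alpha>) sQ), foldr A \<beta> u), fold f v (fold f (\<omega> n @ \<alpha>) x))" by simp
      finally have "(F ^^ length ?v) X0 = \<dots>" .
      moreover have "dist ((fold B v (fold B (\<omega> n @ \<alpha>) sQ), foldr A \<beta> u), fold f v (fold f (\<omega> n @ \<alpha>) x)) X < \<epsilon>"
      proof (rule near[OF fold_B_Is[OF _ sQ(1)] u(1)])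
        show "word (\<omega> n @ \<alpha>)" using g(1) al(1) by simp
        show "fold f (\<omega> n @ \<alpha>) x \<in> {real_of_rat z1..real_of_rat z2}" using al(3) u(2) by blast
      qed
      moreover have "(F ^^ length ?v) X0 = orb (int (length ?v))"
        by (simp only: orb_def of_nat_0_le_iff if_True nat_int)
      ultimately show "\<exists>Y\<in>range orb. dist Y X < \<epsilon>" by (metis rangeI)
    qed
  qed
  ultimately show ?thesis unfolding transitive_on_def using orb by blast
qed

end

section \<open>Existence of the saddle and conclusion\<close>

lemma (in porcupine) contraction_fixed_points:
  assumes w: "word w" "w \<noteq> []"
  shows "\<exists>s\<in>Is. fold B w s = s" "\<exists>u\<in>Iu. foldr A w u = u"
proof -
  have r: "0 \<le> rate ^ length w" "rate ^ length w < 1"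
    using rate_bounds(3,4) w(2) power_less_one_iff[OF rate_bounds(3), of "length w"] by auto
  have ne: "complete Is" "Is \<noteq> {}" "complete Iu" "Iu \<noteq> {}"
    using Is_nondegenerate Iu_nondegenerate by (auto simp: complete_eq_closed)
  show "\<exists>s\<in>Is. fold B w s = s"
    using Banach_fix[OF ne(1,2) r, of "fold B w"] fold_B_Is[OF w(1)] fold_B_contraction[OF w(1)]
    unfolding dist_real_def by blast
  show "\<exists>u\<in>Iu. foldr A w u = u"
    using Banach_fix[OF ne(3,4) r, of "foldr A w"] foldr_A_Iu[OF w(1)] foldr_A_contraction[OF w(1)]
    unfolding dist_real_def by blast
qed

theorem proposition3p3:
  fixes \<Phi> :: "real \<times> real \<Rightarrow> real \<times> real"
    and R :: "nat \<Rightarrow> (real \<times> real) set"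
    and \<Gamma> :: "(real \<times> real) set"
    and code :: "real \<times> real \<Rightarrow> int \<Rightarrow> nat"
    and cs cu :: "nat \<Rightarrow> real"
    and f f' :: "nat \<Rightarrow> real \<Rightarrow> real"
    and \<gamma> lam beta :: real
    and D \<Lambda> :: "((real \<times> real) \<times> real) set"
    and F :: "(real \<times> real) \<times> real \<Rightarrow> (real \<times> real) \<times> real"
  assumes "three_legged_skew_product \<Phi> R \<Gamma> code cs cu f f'"
    and "lam = f' 0 1" and "beta = f' 0 0"
    and "F0 (f 0) (f' 0)"
    and "F1 (f 1) \<gamma> lam"
    and "F2 (f 2) (f' 2)"
    and "F01 (f' 0) \<gamma> lam beta"
    and "D = skew_domain R"
    and "F = skew_product \<Phi> R f"
    and "\<Lambda> = max_invariant D F unit_cube"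
  shows "(\<exists>Q. periodic_saddle D F Q \<and> u_index D F Q = 2 \<and>
              \<Lambda> = homoclinic_class D F unit_cube Q)
         \<and> transitive_on D F \<Lambda>"
proof -
  interpret porcupine \<Phi> R \<Gamma> code cs cu f f' \<gamma>
    using assms by (simp add: porcupine_def porcupine_axioms_def)
  obtain w q d where w: "word w" "w \<noteq> []" "0 < q" "q < 1" "fold f w q = q"
    "(fold f w has_real_derivative d) (at q within {0..1})" "1 < \<bar>d\<bar>"
    by (rule repelling_word)
  obtain s u where su: "s \<in> Is" "fold B w s = s" "u \<in> Iu" "foldr A w u = u"
    using contraction_fixed_points[OF w(1,2)] by blast
  interpret porcupine_saddle \<Phi> R \<Gamma> code cs cu f f' \<gamma> w q d s u
    by unfold_locales (use w su in auto)
  show ?thesis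
    unfolding assms(8-10) using Q_saddle Q_u_index Lambda_homoclinic_class Lambda_transitive by blast
qed

end
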